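(* Let $\mathcal C$ be a coring over a unital ring $A$ and $\Sigma$ a right $\mathcal C$-comodule. Let $S=\mathrm{End}_A(\Sigma)$, $\Sigma^*=\mathrm{Hom}_A(\Sigma,A)$, and let $\bar S\subseteq S$ be the ideal consisting of finite sums of endomorphisms of the form $x\xi(-)$ with $x\in\Sigma$, $\xi\in\Sigma^*$ (that is, the image of the connecting map $\Sigma\otimes_A\Sigma^*\to S$, $x\otimes_A\xi\mapsto x\xi(-)$, of the Morita context connecting $S$ and $A$ associated to $\Sigma$ as a right $A$-module). If there exists a firm ring $R$ together with a ring morphism $\iota:R\to\bar S$, then $R\otimes_R\Sigma$ (where $R$ acts on $\Sigma$ via $\iota$) is $R$-firmly projective as a right $A$-module. If there exists moreover a ring morphism $\iota':R\to T=\mathrm{End}^{\mathcal C}(\Sigma)$, then $\Sigma$ (and therefore $R\otimes_R\Sigma$ as well) is an $R$-$\mathcal C$ bicomodule.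
   Context: Rings are associative algebras over a fixed commutative ring $k$, not necessarily unital; ring morphisms need not preserve units. For a ring $R$, $M\otimes_R N$ is the quotient of $M\otimes_k N$ by the relations $mr\otimes n=m\otimes rn$. A left $R$-module $M$ is firm if the multiplication map $R\otimes_R M\to M$ is bijective; $R$ is a firm ring if $R\otimes_R R\to R$ is bijective. An $A$-coring is a comonoid in the monoidal category of unital $A$-bimodules; right $\mathcal C$-comodules are unital right $A$-modules with a coassociative counital right $A$-linear coaction. $\mathrm{End}^{\mathcal C}(\Sigma)$ is the ring of right $\mathcal C$-colinear endomorphisms of $\Sigma$. An $R$-$\mathcal C$ bicomodule is a right $\mathcal C$-comodule with a left $R$-module structure whose action is by right $\mathcal C$-colinear maps. For a firm ring $R$, an $R$-$A$ bimodule $P$ is called $R$-firmly projective as a right $A$-module if it is firm as a left $R$-module, unital as a right $A$-module, and there is a ring morphism $j:R\to P\otimes_A P^*$, with $P^*=\mathrm{Hom}_A(P,A)$ and $P\otimes_A P^*$ a (non-unital) ring with product $(x\otimes_A\xi)(y\otimes_A\upsilon)=x\xi(y)\otimes_A\upsilon$, which induces the left $R$-action: $j(r)=\sum_i x_i\otimes_A\xi_i$ implies $ry=\sum_i x_i\xi_i(y)$ for all $y\in P$.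
   Formalization: In the last claim, R⊗_RΣ is a bicomodule with R acting on Σ via ι′ (or via ι when ι′ and ι agree); for unrelated ι and ι′ the claim for the ι-action fails, e.g. for Σ=K^n over the matrix coalgebra with R=M_n(K), ι=id, ι′=0. *)

theory Defs
  imports "HOL-Algebra.Module" "HOL-Algebra.Free_Abelian_Groups"
begin

text \<open>
  Algebras over the commutative ring \<open>K\<close> are \<open>module\<close> records over \<open>K\<close> whose \<open>mult\<close> field is the
  product; the \<open>one\<close> field has no meaning unless the algebra is assumed to be unital.
\<close>

locale nu_algebra = module K R for K (structure) and R +
  assumes mult_closed:
      "\<lbrakk>x \<in> carrier R; y \<in> carrier R\<rbrakk> \<Longrightarrow> x \<otimes>\<^bsub>R\<^esub> y \<in> carrier R"
    and mult_assoc: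
      "\<lbrakk>x \<in> carrier R; y \<in> carrier R; z \<in> carrier R\<rbrakk> \<Longrightarrow>
        (x \<otimes>\<^bsub>R\<^esub> y) \<otimes>\<^bsub>R\<^esub> z = x \<otimes>\<^bsub>R\<^esub> (y \<otimes>\<^bsub>R\<^esub> z)"
    and mult_l_distr:
      "\<lbrakk>x \<in> carrier R; y \<in> carrier R; z \<in> carrier R\<rbrakk> \<Longrightarrow>
        (x \<oplus>\<^bsub>R\<^esub> y) \<otimes>\<^bsub>R\<^esub> z = x \<otimes>\<^bsub>R\<^esub> z \<oplus>\<^bsub>R\<^esub> y \<otimes>\<^bsub>R\<^esub> z"
    and mult_r_distr:
      "\<lbrakk>x \<in> carrier R; y \<in> carrier R; z \<in> carrier R\<rbrakk> \<Longrightarrow>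
        x \<otimes>\<^bsub>R\<^esub> (y \<oplus>\<^bsub>R\<^esub> z) = x \<otimes>\<^bsub>R\<^esub> y \<oplus>\<^bsub>R\<^esub> x \<otimes>\<^bsub>R\<^esub> z"
    and smult_mult_l:
      "\<lbrakk>c \<in> carrier K; x \<in> carrier R; y \<in> carrier R\<rbrakk> \<Longrightarrow>
        (c \<odot>\<^bsub>R\<^esub> x) \<otimes>\<^bsub>R\<^esub> y = c \<odot>\<^bsub>R\<^esub> (x \<otimes>\<^bsub>R\<^esub> y)"
    and smult_mult_r:
      "\<lbrakk>c \<in> carrier K; x \<in> carrier R; y \<in> carrier R\<rbrakk> \<Longrightarrow>
        x \<otimes>\<^bsub>R\<^esub> (c \<odot>\<^bsub>R\<^esub> y) = c \<odot>\<^bsub>R\<^esub> (x \<otimes>\<^bsub>R\<^esub> y)"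

locale unital_algebra = nu_algebra K A + ring A for K (structure) and A

definition alg_hom ::
  "('k, 'm) ring_scheme \<Rightarrow> ('k, 'r, 'x) module_scheme \<Rightarrow> ('k, 's, 'y) module_scheme \<Rightarrow> ('r \<Rightarrow> 's) set"
where
  "alg_hom K R S = {h \<in> carrier R \<rightarrow> carrier S.
     (\<forall>x \<in> carrier R. \<forall>y \<in> carrier R. h (x \<oplus>\<^bsub>R\<^esub> y) = h x \<oplus>\<^bsub>S\<^esub> h y) \<and>
     (\<forall>x \<in> carrier R. \<forall>y \<in> carrier R. h (x \<otimes>\<^bsub>R\<^esub> y) = h x \<otimes>\<^bsub>S\<^esub> h y) \<and>
     (\<forall>c \<in> carrier K. \<forall>x \<in> carrier R. h (c \<odot>\<^bsub>R\<^esub> x) = c \<odot>\<^bsub>S\<^esub> h x)}"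

section \<open>Modules and bimodules\<close>

text \<open>
  One record type serves left modules, right modules and bimodules: a locale that concerns only
  one side ignores the other action.  The inherited \<open>mult\<close> and \<open>one\<close> fields are never used for
  modules.
\<close>

record ('k, 'm, 'l, 'r) bimod = "('k, 'm) module" +
  lact :: "'l \<Rightarrow> 'm \<Rightarrow> 'm" (infixr \<open>\<triangleright>\<index>\<close> 70)
  ract :: "'m \<Rightarrow> 'r \<Rightarrow> 'm" (infixl \<open>\<triangleleft>\<index>\<close> 70)

locale left_module = alg: nu_algebra K R + mod: module K M
  for K :: "('k, 'x) ring_scheme" (structure) and R :: "('k, 'r) module"
    and M :: "('k, 'm, 'r, 'a) bimod" +
  assumes lact_closed:
      "\<lbrakk>r \<in> carrier R; m \<in> carrier M\<rbrakk> \<Longrightarrow> r \<triangleright>\<^bsub>M\<^esub> m \<in> carrier M"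
    and lact_add_l:
      "\<lbrakk>r \<in> carrier R; s \<in> carrier R; m \<in> carrier M\<rbrakk> \<Longrightarrow>
        (r \<oplus>\<^bsub>R\<^esub> s) \<triangleright>\<^bsub>M\<^esub> m = (r \<triangleright>\<^bsub>M\<^esub> m) \<oplus>\<^bsub>M\<^esub> (s \<triangleright>\<^bsub>M\<^esub> m)"
    and lact_add_r:
      "\<lbrakk>r \<in> carrier R; m \<in> carrier M; n \<in> carrier M\<rbrakk> \<Longrightarrow>
        r \<triangleright>\<^bsub>M\<^esub> (m \<oplus>\<^bsub>M\<^esub> n) = (r \<triangleright>\<^bsub>M\<^esub> m) \<oplus>\<^bsub>M\<^esub> (r \<triangleright>\<^bsub>M\<^esub> n)"
    and lact_smult_l:
      "\<lbrakk>c \<in> carrier K; r \<in> carrier R; m \<in> carrier M\<rbrakk> \<Longrightarrow>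
        (c \<odot>\<^bsub>R\<^esub> r) \<triangleright>\<^bsub>M\<^esub> m = c \<odot>\<^bsub>M\<^esub> (r \<triangleright>\<^bsub>M\<^esub> m)"
    and lact_smult_r:
      "\<lbrakk>c \<in> carrier K; r \<in> carrier R; m \<in> carrier M\<rbrakk> \<Longrightarrow>
        r \<triangleright>\<^bsub>M\<^esub> (c \<odot>\<^bsub>M\<^esub> m) = c \<odot>\<^bsub>M\<^esub> (r \<triangleright>\<^bsub>M\<^esub> m)"
    and lact_assoc:
      "\<lbrakk>r \<in> carrier R; s \<in> carrier R; m \<in> carrier M\<rbrakk> \<Longrightarrow>
        (r \<otimes>\<^bsub>R\<^esub> s) \<triangleright>\<^bsub>M\<^esub> m = r \<triangleright>\<^bsub>M\<^esub> (s \<triangleright>\<^bsub>M\<^esub> m)"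

locale right_module = alg: nu_algebra K R + mod: module K M
  for K :: "('k, 'x) ring_scheme" (structure) and R :: "('k, 'r) module"
    and M :: "('k, 'm, 'l, 'r) bimod" +
  assumes ract_closed:
      "\<lbrakk>m \<in> carrier M; r \<in> carrier R\<rbrakk> \<Longrightarrow> m \<triangleleft>\<^bsub>M\<^esub> r \<in> carrier M"
    and ract_add_l:
      "\<lbrakk>m \<in> carrier M; n \<in> carrier M; r \<in> carrier R\<rbrakk> \<Longrightarrow>
        (m \<oplus>\<^bsub>M\<^esub> n) \<triangleleft>\<^bsub>M\<^esub> r = (m \<triangleleft>\<^bsub>M\<^esub> r) \<oplus>\<^bsub>M\<^esub> (n \<triangleleft>\<^bsub>M\<^esub> r)"
    and ract_add_r:
      "\<lbrakk>m \<in> carrier M; r \<in> carrier R; s \<in> carrier R\<rbrakk> \<Longrightarrow>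
        m \<triangleleft>\<^bsub>M\<^esub> (r \<oplus>\<^bsub>R\<^esub> s) = (m \<triangleleft>\<^bsub>M\<^esub> r) \<oplus>\<^bsub>M\<^esub> (m \<triangleleft>\<^bsub>M\<^esub> s)"
    and ract_smult_l:
      "\<lbrakk>c \<in> carrier K; m \<in> carrier M; r \<in> carrier R\<rbrakk> \<Longrightarrow>
        (c \<odot>\<^bsub>M\<^esub> m) \<triangleleft>\<^bsub>M\<^esub> r = c \<odot>\<^bsub>M\<^esub> (m \<triangleleft>\<^bsub>M\<^esub> r)"
    and ract_smult_r:
      "\<lbrakk>c \<in> carrier K; m \<in> carrier M; r \<in> carrier R\<rbrakk> \<Longrightarrow>
        m \<triangleleft>\<^bsub>M\<^esub> (c \<odot>\<^bsub>R\<^esub> r) = c \<odot>\<^bsub>M\<^esub> (m \<triangleleft>\<^bsub>M\<^esub> r)"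
    and ract_assoc:
      "\<lbrakk>m \<in> carrier M; r \<in> carrier R; s \<in> carrier R\<rbrakk> \<Longrightarrow>
        m \<triangleleft>\<^bsub>M\<^esub> (r \<otimes>\<^bsub>R\<^esub> s) = (m \<triangleleft>\<^bsub>M\<^esub> r) \<triangleleft>\<^bsub>M\<^esub> s"

locale bimodule = left: left_module K R M + right: right_module K A M
  for K :: "('k, 'x) ring_scheme" (structure) and R :: "('k, 'r) module"
    and A :: "('k, 'a) module" and M :: "('k, 'm, 'r, 'a) bimod" +
  assumes lact_ract:
      "\<lbrakk>r \<in> carrier R; m \<in> carrier M; a \<in> carrier A\<rbrakk> \<Longrightarrow>
        (r \<triangleright>\<^bsub>M\<^esub> m) \<triangleleft>\<^bsub>M\<^esub> a = r \<triangleright>\<^bsub>M\<^esub> (m \<triangleleft>\<^bsub>M\<^esub> a)"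

locale unital_right_module = right_module K A M + unital_algebra K A
  for K :: "('k, 'x) ring_scheme" (structure) and A :: "('k, 'a) module"
    and M :: "('k, 'm, 'l, 'a) bimod" +
  assumes ract_one: "m \<in> carrier M \<Longrightarrow> m \<triangleleft>\<^bsub>M\<^esub> \<one>\<^bsub>A\<^esub> = m"

locale unital_bimodule = bimodule K A A M + unital_right_module K A M
  for K :: "('k, 'x) ring_scheme" (structure) and A :: "('k, 'a) module"
    and M :: "('k, 'm, 'a, 'a) bimod" +
  assumes lact_one: "m \<in> carrier M \<Longrightarrow> \<one>\<^bsub>A\<^esub> \<triangleright>\<^bsub>M\<^esub> m = m"

definition regular :: "('k, 'r) module \<Rightarrow> ('k, 'r, 'r, 'r) bimod" where
  "regular R = module.extend R (bimod.fields (mult R) (mult R))"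

definition with_left :: "('l \<Rightarrow> 'm \<Rightarrow> 'm) \<Rightarrow> ('k, 'm, 'x, 'r) bimod \<Rightarrow> ('k, 'm, 'l, 'r) bimod" where
  "with_left l M = module.extend (module.truncate M) (bimod.fields l (ract M))"

definition right_hom ::
  "('k, 'x) ring_scheme \<Rightarrow> ('k, 'a) module \<Rightarrow> ('k, 'm, 'l, 'a) bimod \<Rightarrow> ('k, 'n, 'l2, 'a) bimod
    \<Rightarrow> ('m \<Rightarrow> 'n) set"
where
  "right_hom K A M N = {f \<in> carrier M \<rightarrow> carrier N.
     (\<forall>x \<in> carrier M. \<forall>y \<in> carrier M. f (x \<oplus>\<^bsub>M\<^esub> y) = f x \<oplus>\<^bsub>N\<^esub> f y) \<and>
     (\<forall>c \<in> carrier K. \<forall>x \<in> carrier M. f (c \<odot>\<^bsub>M\<^esub> x) = c \<odot>\<^bsub>N\<^esub> f x) \<and>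
     (\<forall>x \<in> carrier M. \<forall>a \<in> carrier A. f (x \<triangleleft>\<^bsub>M\<^esub> a) = f x \<triangleleft>\<^bsub>N\<^esub> a)}"

definition bimodule_hom ::
  "('k, 'x) ring_scheme \<Rightarrow> ('k, 'r) module \<Rightarrow> ('k, 'a) module
    \<Rightarrow> ('k, 'm, 'r, 'a) bimod \<Rightarrow> ('k, 'n, 'r, 'a) bimod \<Rightarrow> ('m \<Rightarrow> 'n) set"
where
  "bimodule_hom K R A M N = {f \<in> right_hom K A M N.
     \<forall>r \<in> carrier R. \<forall>x \<in> carrier M. f (r \<triangleright>\<^bsub>M\<^esub> x) = r \<triangleright>\<^bsub>N\<^esub> f x}"

section \<open>Tensor products\<close>

text \<open>
  \<open>tensor K B M N\<close> is \<open>M \<otimes>\<^sub>B N\<close> for a right \<open>B\<close>-module \<open>M\<close> and a left \<open>B\<close>-module \<open>N\<close>.  The relations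
  defining \<open>M \<otimes>\<^sub>K N\<close> and the \<open>B\<close>-balancing relations on top of it are divided out of the free abelian
  group on \<open>M \<times> N\<close> at once, so that elements are cosets.  As \<open>B\<close> need not be unital, the \<open>K\<close>-balancing
  relations do not follow from the \<open>B\<close>-balancing ones.
\<close>

type_synonym ('m, 'n) tens = "('m \<times> 'n \<Rightarrow>\<^sub>0 int) set"

definition tensor_rels ::
  "('k, 'x) ring_scheme \<Rightarrow> ('k, 'b) module \<Rightarrow> ('k, 'm, 'l, 'b) bimod \<Rightarrow> ('k, 'n, 'b, 'r) bimod
    \<Rightarrow> ('m, 'n) tens"
where
  "tensor_rels K B M N =
     {frag_of (m \<oplus>\<^bsub>M\<^esub> m', n) - frag_of (m, n) - frag_of (m', n) |m m' n.
        m \<in> carrier M \<and> m' \<in> carrier M \<and> n \<in> carrier N} \<union>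
     {frag_of (m, n \<oplus>\<^bsub>N\<^esub> n') - frag_of (m, n) - frag_of (m, n') |m n n'.
        m \<in> carrier M \<and> n \<in> carrier N \<and> n' \<in> carrier N} \<union>
     {frag_of (c \<odot>\<^bsub>M\<^esub> m, n) - frag_of (m, c \<odot>\<^bsub>N\<^esub> n) |c m n.
        c \<in> carrier K \<and> m \<in> carrier M \<and> n \<in> carrier N} \<union>
     {frag_of (m \<triangleleft>\<^bsub>M\<^esub> b, n) - frag_of (m, b \<triangleright>\<^bsub>N\<^esub> n) |m b n.
        m \<in> carrier M \<and> b \<in> carrier B \<and> n \<in> carrier N}"

definition tensor_null ::
  "('k, 'x) ring_scheme \<Rightarrow> ('k, 'b) module \<Rightarrow> ('k, 'm, 'l, 'b) bimod \<Rightarrow> ('k, 'n, 'b, 'r) bimod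
    \<Rightarrow> ('m, 'n) tens"
where
  "tensor_null K B M N =
     generate (free_Abelian_group (carrier M \<times> carrier N)) (tensor_rels K B M N)"

definition tensor_group ::
  "('k, 'x) ring_scheme \<Rightarrow> ('k, 'b) module \<Rightarrow> ('k, 'm, 'l, 'b) bimod \<Rightarrow> ('k, 'n, 'b, 'r) bimod
    \<Rightarrow> ('m, 'n) tens ring"
where
  "tensor_group K B M N =
     (let Q = free_Abelian_group (carrier M \<times> carrier N) Mod tensor_null K B M N
      in \<lparr>carrier = carrier Q, mult = undefined, one = undefined,
          ring.zero = \<one>\<^bsub>Q\<^esub>, ring.add = mult Q\<rparr>)"

definition pure ::
  "('k, 'x) ring_scheme \<Rightarrow> ('k, 'b) module \<Rightarrow> ('k, 'm, 'l, 'b) bimod \<Rightarrow> ('k, 'n, 'b, 'r) bimod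
    \<Rightarrow> 'm \<Rightarrow> 'n \<Rightarrow> ('m, 'n) tens"
where
  "pure K B M N m n =
     tensor_null K B M N #>\<^bsub>free_Abelian_group (carrier M \<times> carrier N)\<^esub> frag_of (m, n)"

text \<open>
  The additive map from a tensor product to \<open>Q\<close> that sends \<open>m \<otimes> n\<close> to \<open>f (m, n)\<close>: every
  representative \<open>\<Sum>\<^sub>i k\<^sub>i (m\<^sub>i, n\<^sub>i)\<close> of the class \<open>X\<close> is sent to \<open>\<Sum>\<^sub>i k\<^sub>i f (m\<^sub>i, n\<^sub>i)\<close>.  It is meaningful
  when \<open>f\<close> respects the defining relations, the image of \<open>X\<close> being a singleton in this case.
\<close>

definition tensor_lift ::
  "('q, 'z) ring_scheme \<Rightarrow> ('m \<times> 'n \<Rightarrow> 'q) \<Rightarrow> ('m, 'n) tens \<Rightarrow> 'q"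
where
  "tensor_lift Q f X = the_elem
     ((\<lambda>x. \<Oplus>\<^bsub>Q\<^esub>p \<in> Poly_Mapping.keys x. [Poly_Mapping.lookup x p] \<cdot>\<^bsub>Q\<^esub> f p) ` X)"

definition tensor ::
  "('k, 'x) ring_scheme \<Rightarrow> ('k, 'b) module \<Rightarrow> ('k, 'm, 'l, 'b) bimod \<Rightarrow> ('k, 'n, 'b, 'r) bimod
    \<Rightarrow> ('k, ('m, 'n) tens, 'l, 'r) bimod"
where
  "tensor K B M N =
     (let Q = tensor_group K B M N; t = pure K B M N
      in \<lparr>carrier = carrier Q, mult = undefined, one = undefined,
          ring.zero = \<zero>\<^bsub>Q\<^esub>, ring.add = ring.add Q,
          smult = (\<lambda>c. tensor_lift Q (\<lambda>(m, n). t (c \<odot>\<^bsub>M\<^esub> m) n)),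
          lact = (\<lambda>l. tensor_lift Q (\<lambda>(m, n). t (l \<triangleright>\<^bsub>M\<^esub> m) n)),
          ract = (\<lambda>X r. tensor_lift Q (\<lambda>(m, n). t m (n \<triangleleft>\<^bsub>N\<^esub> r)) X)\<rparr>)"

text \<open>\<open>f \<otimes>\<^sub>B g\<close> with values in \<open>M \<otimes>\<^sub>B N\<close>.\<close>

definition tensor_map ::
  "('k, 'x) ring_scheme \<Rightarrow> ('k, 'b) module \<Rightarrow> ('k, 'm, 'l, 'b) bimod \<Rightarrow> ('k, 'n, 'b, 'r) bimod
    \<Rightarrow> ('m0 \<Rightarrow> 'm) \<Rightarrow> ('n0 \<Rightarrow> 'n) \<Rightarrow> ('m0, 'n0) tens \<Rightarrow> ('m, 'n) tens"
where
  "tensor_map K B M N f g =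
     tensor_lift (tensor K B M N) (\<lambda>(m, n). pure K B M N (f m) (g n))"

text \<open>The canonical map \<open>(L \<otimes>\<^sub>A M) \<otimes>\<^sub>B N \<rightarrow> L \<otimes>\<^sub>A (M \<otimes>\<^sub>B N)\<close>.\<close>

definition tensor_assoc ::
  "('k, 'x) ring_scheme \<Rightarrow> ('k, 'a) module \<Rightarrow> ('k, 'b) module
    \<Rightarrow> ('k, 'u, 'l, 'a) bimod \<Rightarrow> ('k, 'm, 'a, 'b) bimod \<Rightarrow> ('k, 'n, 'b, 'r) bimod
    \<Rightarrow> (('u, 'm) tens, 'n) tens \<Rightarrow> ('u, ('m, 'n) tens) tens"
where
  "tensor_assoc K A B L M N =
     (let Q = tensor K A L (tensor K B M N)
      in tensor_lift Q (\<lambda>(X, n).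
           tensor_lift Q (\<lambda>(l, m). pure K A L (tensor K B M N) l (pure K B M N m n)) X))"

section \<open>Firm rings and firm modules\<close>

locale firm_left_module = left_module K R M
  for K :: "('k, 'x) ring_scheme" (structure) and R :: "('k, 'r) module"
    and M :: "('k, 'm, 'r, 'a) bimod" +
  assumes firm: "bij_betw (tensor_lift M (\<lambda>(r, m). r \<triangleright>\<^bsub>M\<^esub> m))
                   (carrier (tensor K R (regular R) M)) (carrier M)"

locale firm_ring = nu_algebra K R
  for K :: "('k, 'x) ring_scheme" (structure) and R :: "('k, 'r) module" +
  assumes firm: "bij_betw (tensor_lift R (\<lambda>(r, s). r \<otimes>\<^bsub>R\<^esub> s))
                   (carrier (tensor K R (regular R) (regular R))) (carrier R)"

section \<open>Duals, endomorphism rings and firm projectivity\<close>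

text \<open>\<open>M\<^sup>* = Hom\<^sub>A(M, A)\<close>, with \<open>(a\<xi>)(x) = a\<xi>(x)\<close> and \<open>(\<xi>l)(x) = \<xi>(lx)\<close>.\<close>

definition dual ::
  "('k, 'x) ring_scheme \<Rightarrow> ('k, 'a) module \<Rightarrow> ('k, 'm, 'l, 'a) bimod
    \<Rightarrow> ('k, 'm \<Rightarrow> 'a, 'a, 'l) bimod"
where
  "dual K A M =
     \<lparr>carrier = right_hom K A M (regular A) \<inter> extensional (carrier M),
      mult = undefined, one = undefined,
      ring.zero = (\<lambda>x \<in> carrier M. \<zero>\<^bsub>A\<^esub>),
      ring.add = (\<lambda>\<xi> \<upsilon>. \<lambda>x \<in> carrier M. \<xi> x \<oplus>\<^bsub>A\<^esub> \<upsilon> x),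
      smult = (\<lambda>c \<xi>. \<lambda>x \<in> carrier M. c \<odot>\<^bsub>A\<^esub> \<xi> x),
      lact = (\<lambda>a \<xi>. \<lambda>x \<in> carrier M. a \<otimes>\<^bsub>A\<^esub> \<xi> x),
      ract = (\<lambda>\<xi> l. \<lambda>x \<in> carrier M. \<xi> (l \<triangleright>\<^bsub>M\<^esub> x))\<rparr>"

definition end_algebra ::
  "('k, 'x) ring_scheme \<Rightarrow> ('k, 'a) module \<Rightarrow> ('k, 'm, 'l, 'a) bimod \<Rightarrow> ('k, 'm \<Rightarrow> 'm) module"
where
  "end_algebra K A M =
     \<lparr>carrier = right_hom K A M M \<inter> extensional (carrier M),
      mult = compose (carrier M), one = (\<lambda>x \<in> carrier M. x),
      ring.zero = (\<lambda>x \<in> carrier M. \<zero>\<^bsub>M\<^esub>),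
      ring.add = (\<lambda>f g. \<lambda>x \<in> carrier M. f x \<oplus>\<^bsub>M\<^esub> g x),
      smult = (\<lambda>c f. \<lambda>x \<in> carrier M. c \<odot>\<^bsub>M\<^esub> f x)\<rparr>"

text \<open>The ideal of finite sums of endomorphisms \<open>x\<xi>(-)\<close>, as a non-unital algebra.\<close>

definition finite_rank_algebra ::
  "('k, 'x) ring_scheme \<Rightarrow> ('k, 'a) module \<Rightarrow> ('k, 'm, 'l, 'a) bimod \<Rightarrow> ('k, 'm \<Rightarrow> 'm) module"
where
  "finite_rank_algebra K A M = (end_algebra K A M)
     \<lparr>carrier :=
       {\<Oplus>\<^bsub>end_algebra K A M\<^esub>i \<in> {..<n}. (\<lambda>y \<in> carrier M. x i \<triangleleft>\<^bsub>M\<^esub> \<xi> i y) |(n :: nat) x \<xi>.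
          x \<in> {..<n} \<rightarrow> carrier M \<and> \<xi> \<in> {..<n} \<rightarrow> carrier (dual K A M)}\<rparr>"

text \<open>\<open>P \<otimes>\<^sub>A P\<^sup>*\<close> with the product \<open>(x \<otimes> \<xi>)(y \<otimes> \<upsilon>) = x\<xi>(y) \<otimes> \<upsilon>\<close>.\<close>

definition dual_tensor_algebra ::
  "('k, 'x) ring_scheme \<Rightarrow> ('k, 'a) module \<Rightarrow> ('k, 'm, 'l, 'a) bimod
    \<Rightarrow> ('k, ('m, 'm \<Rightarrow> 'a) tens) module"
where
  "dual_tensor_algebra K A P =
     (let D = tensor K A P (dual K A P)
      in (module.truncate D)
           \<lparr>mult := (\<lambda>X Y. tensor_lift D (\<lambda>(x, \<xi>).
              tensor_lift D (\<lambda>(y, \<upsilon>). pure K A P (dual K A P) (x \<triangleleft>\<^bsub>P\<^esub> \<xi> y) \<upsilon>) Y) X)\<rparr>)"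

locale firmly_projective =
  firm_ring K R + bimodule K R A P + firm_left_module K R P + unital_right_module K A P
  for K :: "('k, 'x) ring_scheme" (structure) and R :: "('k, 'r) module"
    and A :: "('k, 'a) module" and P :: "('k, 'p, 'r, 'a) bimod" +
  assumes ex_ring_morphism:
    "\<exists>j \<in> alg_hom K R (dual_tensor_algebra K A P).
       \<forall>r \<in> carrier R. \<forall>(n :: nat) x \<xi>.
         x \<in> {..<n} \<rightarrow> carrier P \<longrightarrow> \<xi> \<in> {..<n} \<rightarrow> carrier (dual K A P) \<longrightarrow>
         j r = (\<Oplus>\<^bsub>dual_tensor_algebra K A P\<^esub>i \<in> {..<n}. pure K A P (dual K A P) (x i) (\<xi> i)) \<longrightarrow>
         (\<forall>y \<in> carrier P. r \<triangleright>\<^bsub>P\<^esub> y = (\<Oplus>\<^bsub>P\<^esub>i \<in> {..<n}. x i \<triangleleft>\<^bsub>P\<^esub> \<xi> i y))"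

section \<open>Corings and comodules\<close>

locale coring = unital_bimodule K A C
  for K :: "('k, 'x) ring_scheme" (structure) and A :: "('k, 'a) module"
    and C :: "('k, 'c, 'a, 'a) bimod"
    and \<Delta> :: "'c \<Rightarrow> ('c, 'c) tens" and \<epsilon> :: "'c \<Rightarrow> 'a" +
  assumes comult_hom: "\<Delta> \<in> bimodule_hom K A A C (tensor K A C C)"
    and counit_hom: "\<epsilon> \<in> bimodule_hom K A A C (regular A)"
    and coassoc: "c \<in> carrier C \<Longrightarrow>
      tensor_assoc K A A C C C (tensor_map K A (tensor K A C C) C \<Delta> (\<lambda>d. d) (\<Delta> c))
        = tensor_map K A C (tensor K A C C) (\<lambda>d. d) \<Delta> (\<Delta> c)"
    and counit_l: "c \<in> carrier C \<Longrightarrow> tensor_lift C (\<lambda>(d, e). \<epsilon> d \<triangleright>\<^bsub>C\<^esub> e) (\<Delta> c) = c"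
    and counit_r: "c \<in> carrier C \<Longrightarrow> tensor_lift C (\<lambda>(d, e). d \<triangleleft>\<^bsub>C\<^esub> \<epsilon> e) (\<Delta> c) = c"

locale right_comodule = coring K A C \<Delta> \<epsilon> + unital_right_module K A M
  for K :: "('k, 'x) ring_scheme" (structure) and A :: "('k, 'a) module"
    and C :: "('k, 'c, 'a, 'a) bimod" and \<Delta> and \<epsilon>
    and M :: "('k, 'm, 'l, 'a) bimod" and \<rho> :: "'m \<Rightarrow> ('m, 'c) tens" +
  assumes coact_hom: "\<rho> \<in> right_hom K A M (tensor K A M C)"
    and coact_coassoc: "x \<in> carrier M \<Longrightarrow>
      tensor_assoc K A A M C C (tensor_map K A (tensor K A M C) C \<rho> (\<lambda>d. d) (\<rho> x))
        = tensor_map K A M (tensor K A C C) (\<lambda>y. y) \<Delta> (\<rho> x)"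
    and coact_counit: "x \<in> carrier M \<Longrightarrow> tensor_lift M (\<lambda>(y, d). y \<triangleleft>\<^bsub>M\<^esub> \<epsilon> d) (\<rho> x) = x"

definition comodule_end_algebra ::
  "('k, 'x) ring_scheme \<Rightarrow> ('k, 'a) module \<Rightarrow> ('k, 'c, 'a, 'a) bimod
    \<Rightarrow> ('k, 'm, 'l, 'a) bimod \<Rightarrow> ('m \<Rightarrow> ('m, 'c) tens) \<Rightarrow> ('k, 'm \<Rightarrow> 'm) module"
where
  "comodule_end_algebra K A C M \<rho> = (end_algebra K A M)
     \<lparr>carrier := {f \<in> carrier (end_algebra K A M).
        \<forall>x \<in> carrier M. \<rho> (f x) = tensor_map K A M C f (\<lambda>d. d) (\<rho> x)}\<rparr>"

locale bicomodule = right_comodule K A C \<Delta> \<epsilon> M \<rho> + left_module K R M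
  for K :: "('k, 'x) ring_scheme" (structure) and R :: "('k, 'r) module" and A :: "('k, 'a) module"
    and C :: "('k, 'c, 'a, 'a) bimod" and \<Delta> and \<epsilon>
    and M :: "('k, 'm, 'r, 'a) bimod" and \<rho> +
  assumes lact_colinear:
    "r \<in> carrier R \<Longrightarrow>
      (\<lambda>x \<in> carrier M. r \<triangleright>\<^bsub>M\<^esub> x) \<in> carrier (comodule_end_algebra K A C M \<rho>)"

text \<open>
  The coaction \<open>R \<otimes>\<^sub>R \<rho>\<close> on \<open>R \<otimes>\<^sub>R M\<close>, composed with \<open>R \<otimes>\<^sub>R (M \<otimes>\<^sub>A C) \<cong> (R \<otimes>\<^sub>R M) \<otimes>\<^sub>A C\<close>: it sends
  \<open>r \<otimes> x\<close> to \<open>\<Sum>\<^sub>i (r \<otimes> y\<^sub>i) \<otimes> c\<^sub>i\<close> if \<open>\<rho> x = \<Sum>\<^sub>i y\<^sub>i \<otimes> c\<^sub>i\<close>.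
\<close>

definition tensor_coact ::
  "('k, 'x) ring_scheme \<Rightarrow> ('k, 'r) module \<Rightarrow> ('k, 'a) module \<Rightarrow> ('k, 'c, 'a, 'a) bimod
    \<Rightarrow> ('k, 'm, 'r, 'a) bimod \<Rightarrow> ('m \<Rightarrow> ('m, 'c) tens)
    \<Rightarrow> ('r, 'm) tens \<Rightarrow> (('r, 'm) tens, 'c) tens"
where
  "tensor_coact K R A C M \<rho> =
     (let P = tensor K R (regular R) M; Q = tensor K A P C
      in tensor_lift Q (\<lambda>(r, x).
           tensor_lift Q (\<lambda>(y, c). pure K A P C (pure K R (regular R) M r y) c) (\<rho> x)))"

end

theory Submission
  imports Defs
begin

text \<open>
  \<open>P = R \<otimes>\<^sub>R \<Sigma>\<close> is firm because \<open>R\<close> is, the inverse of the action being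
  \<open>r \<otimes> x \<mapsto> \<Sum>\<^sub>i s\<^sub>i \<otimes> (t\<^sub>i \<otimes> x)\<close>, where \<open>\<Sum>\<^sub>i s\<^sub>i \<otimes> t\<^sub>i\<close> is the element of \<open>R \<otimes>\<^sub>R R\<close> over \<open>r\<close>.
  Each \<open>\<xi> \<in> \<Sigma>\<^sup>*\<close> gives \<open>\<xi>' \<in> P\<^sup>*\<close>, \<open>\<xi>'(u \<otimes> z) = \<xi>(\<iota>(u)z)\<close>, and the ring morphism \<open>j : R \<rightarrow> P \<otimes>\<^sub>A P\<^sup>*\<close> sends \<open>r\<close> to
  \<open>\<Sum>\<^sub>i \<Sum>\<^sub>k (s\<^sub>i \<otimes> x\<^sub>i\<^sub>k) \<otimes> \<xi>\<^sub>i\<^sub>k'\<close> if \<open>\<iota>(t\<^sub>i) = \<Sum>\<^sub>k x\<^sub>i\<^sub>k \<xi>\<^sub>i\<^sub>k(-)\<close>.  The map \<open>\<Sigma> \<otimes>\<^sub>A \<Sigma>\<^sup>* \<rightarrow> S\<close> need not be injective,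
  but its kernel is annihilated by finite rank operators; as \<open>R = R R\<close>, the choice of the
  \<open>x\<^sub>i\<^sub>k\<close> and \<open>\<xi>\<^sub>i\<^sub>k\<close> does not matter.  In \<open>P \<otimes>\<^sub>A P\<^sup>*\<close>, left multiplication by an element that acts on
  \<open>P\<close> like \<open>r\<close> is the action of \<open>r\<close>, so that \<open>j\<close> is multiplicative because it is left \<open>R\<close>-linear.

  For the coaction on \<open>P\<close>, every map \<open>r \<otimes> - : \<Sigma> \<rightarrow> P\<close> is colinear by construction, and the
  comodule axioms on \<open>P\<close> are carried over from \<open>\<Sigma>\<close> along these maps.
\<close>

section \<open>Additive and balanced maps\<close>

text \<open>The obstacle is that \<open>\<iota>\<close> takes values in the image of the connecting
  map, while firm projectivity asks for values in a tensor product. Each \<open>\<iota>(t)\<close>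
  lifts, but the chosen lifts need not be additive, let alone multiplicative. The extra factor
  \<open>R\<close> repairs this: in \<open>s u \<otimes> x = s \<otimes> u x\<close> the finite rank
  operator of \<open>u\<close> replaces \<open>x\<close> by a combination of fixed vectors with
  coefficients in \<open>A\<close>, and these coefficients cross to the dual side, where only the
  operator induced by the lift is seen. In the absence of a unit, \<open>r = r 1\<close> is replaced
  by the element of \<open>R \<otimes> R\<close> over \<open>r\<close>; the linearity of this
  assignment on both sides supplies what the unit would give.

  Maps out of tensor products are functions on cosets. Existence is a check of balancedness, and
  equality of two additive maps is tested on pure tensors, so plain additivity is the property
  carried through all compositions. Iterated tensor products lead to lifts whose values are again
  lifts; these are treated one layer at a time.\<close>

definition additive :: "('a, 'x) ring_scheme \<Rightarrow> ('b, 'y) ring_scheme \<Rightarrow> ('a \<Rightarrow> 'b) set" where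
  "additive G H = {f \<in> carrier G \<rightarrow> carrier H.
     \<forall>x \<in> carrier G. \<forall>y \<in> carrier G. f (x \<oplus>\<^bsub>G\<^esub> y) = f x \<oplus>\<^bsub>H\<^esub> f y}"

lemma additiveI:
  assumes "\<And>x. x \<in> carrier G \<Longrightarrow> f x \<in> carrier H"
    and "\<And>x y. \<lbrakk>x \<in> carrier G; y \<in> carrier G\<rbrakk> \<Longrightarrow> f (x \<oplus>\<^bsub>G\<^esub> y) = f x \<oplus>\<^bsub>H\<^esub> f y"
  shows "f \<in> additive G H"
  using assms by (auto simp: additive_def)

lemma additive_closed: "\<lbrakk>f \<in> additive G H; x \<in> carrier G\<rbrakk> \<Longrightarrow> f x \<in> carrier H"
  by (auto simp: additive_def)

lemma additive_add:
  "\<lbrakk>f \<in> additive G H; x \<in> carrier G; y \<in> carrier G\<rbrakk> \<Longrightarrow> f (x \<oplus>\<^bsub>G\<^esub> y) = f x \<oplus>\<^bsub>H\<^esub> f y"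
  by (auto simp: additive_def)

lemma additive_comp:
  "\<lbrakk>f \<in> additive G H; g \<in> additive H L\<rbrakk> \<Longrightarrow> (\<lambda>x. g (f x)) \<in> additive G L"
  by (auto simp: additive_def Pi_def)

lemma additive_id: "(\<lambda>x. x) \<in> additive G G"
  by (auto simp: additive_def)

lemma additive_zero:
  assumes "abelian_group G" "abelian_group H" "f \<in> additive G H"
  shows "f \<zero>\<^bsub>G\<^esub> = \<zero>\<^bsub>H\<^esub>"
proof -
  interpret G: abelian_group G by fact
  interpret H: abelian_group H by fact
  have c: "f \<zero>\<^bsub>G\<^esub> \<in> carrier H" using assms(3) by (auto simp: additive_def)
  have "f \<zero>\<^bsub>G\<^esub> \<oplus>\<^bsub>H\<^esub> f \<zero>\<^bsub>G\<^esub> = f \<zero>\<^bsub>G\<^esub>"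
    using additive_add[OF assms(3) G.zero_closed G.zero_closed] by simp
  then show ?thesis using c by (metis H.add.l_cancel_one')
qed

lemma additive_finsum:
  assumes "abelian_group G" "abelian_group H" "f \<in> additive G H"
    and "finite I" "x \<in> I \<rightarrow> carrier G"
  shows "f (\<Oplus>\<^bsub>G\<^esub>i \<in> I. x i) = (\<Oplus>\<^bsub>H\<^esub>i \<in> I. f (x i))"
  using assms(4,5)
proof (induction I)
  interpret G: abelian_group G by fact
  interpret H: abelian_group H by fact
  case empty
  show ?case using additive_zero[OF assms(1-3)] by simp
next
  interpret G: abelian_group G by fact
  interpret H: abelian_group H by fact
  case (insert i I)
  then have c: "x i \<in> carrier G" "x \<in> I \<rightarrow> carrier G" by auto
  have d: "f (x i) \<in> carrier H" "(\<lambda>i. f (x i)) \<in> I \<rightarrow> carrier H"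
    using c additive_closed[OF assms(3)] by auto
  show ?case using insert c d
    by (simp add: additive_add[OF assms(3)])
qed

lemma additive_plus:
  assumes "abelian_group H" "f \<in> additive G H" "g \<in> additive G H"
  shows "(\<lambda>x. f x \<oplus>\<^bsub>H\<^esub> g x) \<in> additive G H"
proof -
  interpret H: abelian_group H by fact
  show ?thesis
    using assms(2,3) by (intro additiveI) (auto simp: additive_def Pi_def H.a_ac)
qed

lemma additive_sum:
  assumes "abelian_group H" "finite I" "\<And>i. i \<in> I \<Longrightarrow> f i \<in> additive G H"
  shows "(\<lambda>x. \<Oplus>\<^bsub>H\<^esub>i \<in> I. f i x) \<in> additive G H"
proof -
  interpret H: abelian_group H by fact
  show ?thesis
  proof (rule additiveI)
    fix x y assume xy: "x \<in> carrier G" "y \<in> carrier G"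
    have "(\<Oplus>\<^bsub>H\<^esub>i \<in> I. f i (x \<oplus>\<^bsub>G\<^esub> y)) = (\<Oplus>\<^bsub>H\<^esub>i \<in> I. f i x \<oplus>\<^bsub>H\<^esub> f i y)"
      using assms(3) xy by (intro H.finsum_cong') (auto simp: additive_def Pi_def)
    then show "(\<Oplus>\<^bsub>H\<^esub>i \<in> I. f i (x \<oplus>\<^bsub>G\<^esub> y)) = (\<Oplus>\<^bsub>H\<^esub>i \<in> I. f i x) \<oplus>\<^bsub>H\<^esub> (\<Oplus>\<^bsub>H\<^esub>i \<in> I. f i y)"
      using assms(3) xy by (subst H.finsum_addf[symmetric]) (auto simp: additive_def Pi_def)
  qed (use assms(3) in \<open>auto intro!: H.finsum_closed simp: additive_def\<close>)
qed

text \<open>The clauses answer the four families in \<open>tensor_rels\<close> one by one. Scalars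
  of \<open>K\<close> are asked to be balanced between the factors rather than preserved, which lets
  \<open>Q\<close> be any abelian group.\<close>

definition balanced ::
  "('k, 'x) ring_scheme \<Rightarrow> ('k, 'b) module \<Rightarrow> ('k, 'm, 'l, 'b) bimod \<Rightarrow> ('k, 'n, 'b, 'r) bimod
    \<Rightarrow> ('q, 'z) ring_scheme \<Rightarrow> ('m \<Rightarrow> 'n \<Rightarrow> 'q) \<Rightarrow> bool"
where
  "balanced K B M N Q f \<longleftrightarrow>
     (\<forall>n \<in> carrier N. (\<lambda>m. f m n) \<in> additive M Q) \<and>
     (\<forall>m \<in> carrier M. f m \<in> additive N Q) \<and>
     (\<forall>c \<in> carrier K. \<forall>m \<in> carrier M. \<forall>n \<in> carrier N. f (c \<odot>\<^bsub>M\<^esub> m) n = f m (c \<odot>\<^bsub>N\<^esub> n)) \<and>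
     (\<forall>b \<in> carrier B. \<forall>m \<in> carrier M. \<forall>n \<in> carrier N. f (m \<triangleleft>\<^bsub>M\<^esub> b) n = f m (b \<triangleright>\<^bsub>N\<^esub> n))"

lemma balancedI:
  assumes "\<And>n. n \<in> carrier N \<Longrightarrow> (\<lambda>m. f m n) \<in> additive M Q"
    and "\<And>m. m \<in> carrier M \<Longrightarrow> f m \<in> additive N Q"
    and "\<And>c m n. \<lbrakk>c \<in> carrier K; m \<in> carrier M; n \<in> carrier N\<rbrakk> \<Longrightarrow> f (c \<odot>\<^bsub>M\<^esub> m) n = f m (c \<odot>\<^bsub>N\<^esub> n)"
    and "\<And>b m n. \<lbrakk>b \<in> carrier B; m \<in> carrier M; n \<in> carrier N\<rbrakk> \<Longrightarrow> f (m \<triangleleft>\<^bsub>M\<^esub> b) n = f m (b \<triangleright>\<^bsub>N\<^esub> n)"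
  shows "balanced K B M N Q f"
  using assms by (auto simp: balanced_def)

lemma balancedD:
  assumes "balanced K B M N Q f"
  shows "\<And>m n. \<lbrakk>m \<in> carrier M; n \<in> carrier N\<rbrakk> \<Longrightarrow> f m n \<in> carrier Q"
    and "\<And>m m' n. \<lbrakk>m \<in> carrier M; m' \<in> carrier M; n \<in> carrier N\<rbrakk> \<Longrightarrow>
           f (m \<oplus>\<^bsub>M\<^esub> m') n = f m n \<oplus>\<^bsub>Q\<^esub> f m' n"
    and "\<And>m n n'. \<lbrakk>m \<in> carrier M; n \<in> carrier N; n' \<in> carrier N\<rbrakk> \<Longrightarrow>
           f m (n \<oplus>\<^bsub>N\<^esub> n') = f m n \<oplus>\<^bsub>Q\<^esub> f m n'"
    and "\<And>c m n. \<lbrakk>c \<in> carrier K; m \<in> carrier M; n \<in> carrier N\<rbrakk> \<Longrightarrow>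
           f (c \<odot>\<^bsub>M\<^esub> m) n = f m (c \<odot>\<^bsub>N\<^esub> n)"
    and "\<And>b m n. \<lbrakk>b \<in> carrier B; m \<in> carrier M; n \<in> carrier N\<rbrakk> \<Longrightarrow>
           f (m \<triangleleft>\<^bsub>M\<^esub> b) n = f m (b \<triangleright>\<^bsub>N\<^esub> n)"
  using assms by (auto simp: balanced_def additive_def)

section \<open>Evaluation of formal integer combinations in an abelian group\<close>

context abelian_group begin

text \<open>The homomorphism on the free abelian group that extends \<open>f\<close>; the same
  expression is applied by \<open>tensor_lift\<close> to each representative of a class.\<close>

definition frag_eval :: "('c \<Rightarrow> 'a) \<Rightarrow> ('c \<Rightarrow>\<^sub>0 int) \<Rightarrow> 'a" where
  "frag_eval f x = (\<Oplus>p \<in> Poly_Mapping.keys x. [Poly_Mapping.lookup x p] \<cdot> f p)"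

text \<open>Terms may cancel in \<open>x + y\<close>, so the supports of \<open>x\<close>,
  \<open>y\<close> and \<open>x + y\<close> differ; over a common finite superset the sums can be
  added termwise.\<close>

lemma frag_eval_superset:
  assumes "f \<in> S \<rightarrow> carrier G" "finite F" "Poly_Mapping.keys x \<subseteq> F" "F \<subseteq> S"
  shows "frag_eval f x = (\<Oplus>p \<in> F. [Poly_Mapping.lookup x p] \<cdot> f p)"
proof -
  have z: "[(0::int)] \<cdot> a = \<zero>" for a
    by (simp add: add_pow_def int_pow_def2)
  show ?thesis
    unfolding frag_eval_def
  proof (rule add.finprod_mono_neutral_cong_left)
    show "(\<lambda>p. [Poly_Mapping.lookup x p] \<cdot> f p) \<in> F \<rightarrow> carrier G"
      using assms by (intro Pi_I add.int_pow_closed) auto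
    show "[Poly_Mapping.lookup x i] \<cdot> f i = \<zero>" if "i \<in> F - Poly_Mapping.keys x" for i
      using that by (simp add: in_keys_iff z)
  qed (use assms in auto)
qed

lemma frag_eval_closed:
  assumes "f \<in> S \<rightarrow> carrier G" "Poly_Mapping.keys x \<subseteq> S"
  shows "frag_eval f x \<in> carrier G"
  unfolding frag_eval_def using assms
  by (intro finsum_closed Pi_I add.int_pow_closed) auto

lemma frag_eval_add:
  assumes f: "f \<in> S \<rightarrow> carrier G" and x: "Poly_Mapping.keys x \<subseteq> S" and y: "Poly_Mapping.keys y \<subseteq> S"
  shows "frag_eval f (x + y) = frag_eval f x \<oplus> frag_eval f y"
proof -
  let ?F = "Poly_Mapping.keys x \<union> Poly_Mapping.keys y"
  have F: "finite ?F" "?F \<subseteq> S" "Poly_Mapping.keys (x + y) \<subseteq> ?F"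
    using x y Poly_Mapping.keys_add[of x y] by auto
  have "(\<Oplus>p \<in> ?F. [Poly_Mapping.lookup (x + y) p] \<cdot> f p) =
        (\<Oplus>p \<in> ?F. [Poly_Mapping.lookup x p] \<cdot> f p \<oplus> [Poly_Mapping.lookup y p] \<cdot> f p)"
    using f F by (intro finsum_cong')
      (auto simp: lookup_add Pi_def intro!: add.int_pow_mult[unfolded] add.m_closed add.int_pow_closed)
  also have "\<dots> = (\<Oplus>p \<in> ?F. [Poly_Mapping.lookup x p] \<cdot> f p) \<oplus> (\<Oplus>p \<in> ?F. [Poly_Mapping.lookup y p] \<cdot> f p)"
    using f F by (intro finsum_addf) (auto simp: Pi_def intro!: add.int_pow_closed)
  finally show ?thesis
    using frag_eval_superset[OF f F(1) _ F(2)] F(3) by simp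
qed

lemma frag_eval_zero: "frag_eval f 0 = \<zero>"
  by (simp add: frag_eval_def)

lemma frag_eval_minus:
  assumes f: "f \<in> S \<rightarrow> carrier G" and x: "Poly_Mapping.keys x \<subseteq> S"
  shows "frag_eval f (- x) = \<ominus> frag_eval f x"
proof -
  have "frag_eval f (- x) \<oplus> frag_eval f x = \<zero>"
    using frag_eval_add[OF f, of "- x" x] x by (simp add: frag_eval_zero)
  then show ?thesis
    using frag_eval_closed[OF f] x by (metis add.inv_equality keys_minus)
qed

lemma frag_eval_diff:
  assumes f: "f \<in> S \<rightarrow> carrier G" and x: "Poly_Mapping.keys x \<subseteq> S" and y: "Poly_Mapping.keys y \<subseteq> S"
  shows "frag_eval f (x - y) = frag_eval f x \<ominus> frag_eval f y"
  using frag_eval_add[OF f x, of "- y"] frag_eval_minus[OF f y] y by (simp add: a_minus_def)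

lemma frag_eval_frag_of:
  assumes "f p \<in> carrier G"
  shows "frag_eval f (frag_of p) = f p"
proof -
  have "[(1::int)] \<cdot> f p = f p"
    using assms by (rule add.int_pow_1)
  then show ?thesis
    using assms finsum_insert[of "{}" p "\<lambda>q. [Poly_Mapping.lookup (frag_of p) q] \<cdot> f q"]
    by (simp add: frag_eval_def)
qed

end

section \<open>The universal property of the tensor product\<close>

lemma keys_diff_subset:
  "\<lbrakk>Poly_Mapping.keys x \<subseteq> S; Poly_Mapping.keys y \<subseteq> S\<rbrakk> \<Longrightarrow> Poly_Mapping.keys (x - y) \<subseteq> S"
  using keys_diff[of x y] by blast

lemma frag_add_subset:
  "\<lbrakk>p \<in> S; q \<in> S\<rbrakk> \<Longrightarrow> Poly_Mapping.keys (frag_of p + frag_of q) \<subseteq> S"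
  using keys_add[of "frag_of p" "frag_of q"] by auto

locale tensor_pair = M: right_module K B M + N: left_module K B N
  for K :: "('k, 'x) ring_scheme" (structure) and B :: "('k, 'b) module"
    and M :: "('k, 'm, 'l, 'b) bimod" and N :: "('k, 'n, 'b, 'r) bimod"
begin

abbreviation "F \<equiv> free_Abelian_group (carrier M \<times> carrier N)"
abbreviation "Null \<equiv> tensor_null K B M N"
abbreviation "T \<equiv> tensor K B M N"
abbreviation "p \<equiv> pure K B M N"

lemma rels_carrier: "tensor_rels K B M N \<subseteq> carrier F"
proof
  fix x assume "x \<in> tensor_rels K B M N"
  then show "x \<in> carrier F"
    unfolding tensor_rels_def
    by (elim UnE CollectE exE conjE)
       (simp_all add: keys_diff_subset M.ract_closed N.lact_closed)
qed

lemma null_subgroup: "subgroup Null F"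
  unfolding tensor_null_def
  by (intro group.generate_is_subgroup rels_carrier) simp

lemma null_normal: "Null \<lhd> F"
  using null_subgroup abelian_free_Abelian_group comm_group.normal_iff_subgroup by blast

lemma carrier_tensor: "carrier T = (\<lambda>x. Null #>\<^bsub>F\<^esub> x) ` carrier F"
  by (simp add: tensor_def tensor_group_def Let_def carrier_FactGroup)

lemma add_tensor: "x \<oplus>\<^bsub>T\<^esub> y = x <#>\<^bsub>F\<^esub> y"
  by (simp add: tensor_def tensor_group_def Let_def)

lemma zero_tensor: "\<zero>\<^bsub>T\<^esub> = Null"
  by (simp add: tensor_def tensor_group_def Let_def)

text \<open>Addition and zero of \<open>tensor\<close> are the product and the unit of the factor
  group, which is commutative because the free abelian group is.\<close>

lemma abelian_group_tensor: "abelian_group T"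
proof -
  interpret Q: comm_group "F Mod Null"
    by (rule comm_group.abelian_FactGroup[OF abelian_free_Abelian_group null_subgroup])
  have eq: "carrier T = carrier (F Mod Null)" "add T = mult (F Mod Null)" "ring.zero T = one (F Mod Null)"
    by (simp_all add: tensor_def tensor_group_def Let_def)
  show ?thesis
    by (rule abelian_groupI; unfold eq)
      (assumption | rule Q.m_closed Q.one_closed Q.m_assoc Q.m_comm Q.l_one Q.l_inv Q.inv_closed bexI[where x = "inv\<^bsub>F Mod Null\<^esub> x" for x])+
qed

lemma coset_add:
  "\<lbrakk>x \<in> carrier F; y \<in> carrier F\<rbrakk> \<Longrightarrow> (Null #>\<^bsub>F\<^esub> x) \<oplus>\<^bsub>T\<^esub> (Null #>\<^bsub>F\<^esub> y) = Null #>\<^bsub>F\<^esub> (x + y)"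
  using normal.rcos_sum[OF null_normal, of x y] by (simp add: add_tensor)

lemma coset_eq:
  assumes "x \<in> carrier F" "y \<in> carrier F" "x - y \<in> Null"
  shows "Null #>\<^bsub>F\<^esub> x = Null #>\<^bsub>F\<^esub> y"
proof -
  have "x \<in> Null #>\<^bsub>F\<^esub> y"
    using assms(3) by (auto simp: r_coset_def intro!: bexI[of _ "x - y"])
  then show ?thesis
    using group.repr_independence[OF group_free_Abelian_group _ _ null_subgroup] assms(2) by blast
qed

lemma pure_closed: "\<lbrakk>m \<in> carrier M; n \<in> carrier N\<rbrakk> \<Longrightarrow> p m n \<in> carrier T"
  by (auto simp: carrier_tensor pure_def)

lemma rel_null: "x \<in> tensor_rels K B M N \<Longrightarrow> x \<in> Null"
  by (simp add: tensor_null_def generate.incl)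

text \<open>The difference of the two representatives is itself a generator of \<open>Null\<close>;
  regrouping it as \<open>a - b - c\<close> exposes the generator.\<close>

lemma pure_add_l:
  assumes "m \<in> carrier M" "m' \<in> carrier M" "n \<in> carrier N"
  shows "p (m \<oplus>\<^bsub>M\<^esub> m') n = p m n \<oplus>\<^bsub>T\<^esub> p m' n"
  unfolding pure_def using assms
  by (subst coset_add, simp, simp, intro coset_eq rel_null)
    (simp_all add: frag_add_subset diff_diff_add[symmetric] tensor_rels_def, blast)

lemma pure_add_r:
  assumes "m \<in> carrier M" "n' \<in> carrier N" "n \<in> carrier N"
  shows "p m (n \<oplus>\<^bsub>N\<^esub> n') = p m n \<oplus>\<^bsub>T\<^esub> p m n'"
  unfolding pure_def using assms
  by (subst coset_add, simp, simp, intro coset_eq rel_null)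
    (simp_all add: frag_add_subset diff_diff_add[symmetric] tensor_rels_def, blast)

lemma pure_smult:
  assumes "c \<in> carrier K" "m \<in> carrier M" "n \<in> carrier N"
  shows "p (c \<odot>\<^bsub>M\<^esub> m) n = p m (c \<odot>\<^bsub>N\<^esub> n)"
  unfolding pure_def using assms
  by (intro coset_eq rel_null) (auto simp: tensor_rels_def)

lemma pure_act:
  assumes "b \<in> carrier B" "m \<in> carrier M" "n \<in> carrier N"
  shows "p (m \<triangleleft>\<^bsub>M\<^esub> b) n = p m (b \<triangleright>\<^bsub>N\<^esub> n)"
  unfolding pure_def using assms
  by (intro coset_eq rel_null) (auto simp: tensor_rels_def M.ract_closed N.lact_closed)

context
  fixes Q :: "('q, 'z) ring_scheme" and f :: "'m \<Rightarrow> 'n \<Rightarrow> 'q"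
  assumes Q: "abelian_group Q" and f: "balanced K B M N Q f"
begin

interpretation Q: abelian_group Q by (rule Q)

lemma lift_fun: "(\<lambda>(m, n). f m n) \<in> carrier M \<times> carrier N \<rightarrow> carrier Q"
  using f by (auto simp: balanced_def additive_def)

text \<open>Each family of relations is killed by the clause of \<open>balanced\<close> made for
  it.\<close>

lemma eval_rel:
  assumes "x \<in> tensor_rels K B M N"
  shows "Q.frag_eval (\<lambda>(m, n). f m n) x = \<zero>\<^bsub>Q\<^esub>"
proof -
  have r': "a \<ominus>\<^bsub>Q\<^esub> a = \<zero>\<^bsub>Q\<^esub>" if "a \<in> carrier Q" for a
    using that by (simp add: a_minus_def Q.r_neg)
  have r: "a \<oplus>\<^bsub>Q\<^esub> b \<ominus>\<^bsub>Q\<^esub> a \<ominus>\<^bsub>Q\<^esub> b = \<zero>\<^bsub>Q\<^esub>"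
    if "a \<in> carrier Q" "b \<in> carrier Q" for a b
    using that by (simp_all add: a_minus_def Q.a_assoc Q.a_lcomm[of a b] Q.r_neg Q.a_comm[of a b] )
  show ?thesis
    using assms unfolding tensor_rels_def
    by (elim UnE CollectE exE conjE)
      (simp_all add: Q.frag_eval_diff[OF lift_fun] keys_diff_subset M.ract_closed N.lact_closed
        Q.frag_eval_frag_of r r' balancedD[OF f])
qed

lemma eval_null:
  assumes "x \<in> Null"
  shows "Q.frag_eval (\<lambda>(m, n). f m n) x = \<zero>\<^bsub>Q\<^esub>"
proof -
  \<comment> \<open>Membership in the free group is carried along because additivity of
    \<open>frag_eval\<close> requires supports on which \<open>f\<close> has values in
    \<open>Q\<close>.\<close>
  have "x \<in> carrier F \<and> Q.frag_eval (\<lambda>(m, n). f m n) x = \<zero>\<^bsub>Q\<^esub>"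
    using assms unfolding tensor_null_def
  proof (induction rule: generate.induct)
    case (incl h)
    then show ?case using rels_carrier eval_rel by blast
  next
    case (inv h)
    then have "h \<in> carrier F" using rels_carrier by blast
    then show ?case using eval_rel[OF inv]
      by (simp add: Q.frag_eval_minus[OF lift_fun])
  next
    case (eng g h)
    then show ?case
      using keys_add[of g h] by (auto simp: Q.frag_eval_add[OF lift_fun])
  qed (simp add: Q.frag_eval_zero)
  then show ?thesis ..
qed

text \<open>Well-definedness of \<open>tensor_lift\<close>: representatives of a coset differ by an
  element of \<open>Null\<close>, where the evaluation vanishes, so the set passed to
  \<open>the_elem\<close> is a singleton.\<close>

lemma lift_coset:
  assumes "x \<in> carrier F"
  shows "tensor_lift Q (\<lambda>(m, n). f m n) (Null #>\<^bsub>F\<^esub> x) = Q.frag_eval (\<lambda>(m, n). f m n) x"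
proof -
  have "Q.frag_eval (\<lambda>(m, n). f m n) y = Q.frag_eval (\<lambda>(m, n). f m n) x" if "y \<in> Null #>\<^bsub>F\<^esub> x" for y
  proof -
    obtain z where z: "z \<in> Null" "y = z + x" using \<open>y \<in> Null #>\<^bsub>F\<^esub> x\<close> by (auto simp: r_coset_def)
    have "z \<in> carrier F" by (rule subgroup.mem_carrier[OF null_subgroup z(1)])
    then have "Q.frag_eval (\<lambda>(m, n). f m n) y
        = Q.frag_eval (\<lambda>(m, n). f m n) z \<oplus>\<^bsub>Q\<^esub> Q.frag_eval (\<lambda>(m, n). f m n) x"
      using assms z(2) by (simp only: carrier_free_Abelian_group_iff Q.frag_eval_add[OF lift_fun])
    also have "\<dots> = Q.frag_eval (\<lambda>(m, n). f m n) x"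
      using assms Q.frag_eval_closed[OF lift_fun, of x] by (simp add: eval_null[OF z(1)])
    finally show ?thesis .
  qed
  then have "Q.frag_eval (\<lambda>(m, n). f m n) ` (Null #>\<^bsub>F\<^esub> x)
      = (\<lambda>y. Q.frag_eval (\<lambda>(m, n). f m n) x) ` (Null #>\<^bsub>F\<^esub> x)"
    by (rule image_cong[OF refl])
  also have "\<dots> = {Q.frag_eval (\<lambda>(m, n). f m n) x}"
    by (rule image_constant[OF group.rcos_self[OF group_free_Abelian_group assms null_subgroup]])
  finally have "Q.frag_eval (\<lambda>(m, n). f m n) ` (Null #>\<^bsub>F\<^esub> x) = {Q.frag_eval (\<lambda>(m, n). f m n) x}" .
  then show ?thesis
    by (simp add: tensor_lift_def Q.frag_eval_def[abs_def])
qed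

lemma lift_additive: "tensor_lift Q (\<lambda>(m, n). f m n) \<in> additive T Q"
proof (rule additiveI)
  fix X assume "X \<in> carrier T"
  then obtain x where "x \<in> carrier F" "X = Null #>\<^bsub>F\<^esub> x" by (auto simp: carrier_tensor)
  then show "tensor_lift Q (\<lambda>(m, n). f m n) X \<in> carrier Q"
    using lift_coset Q.frag_eval_closed[OF lift_fun] by auto
next
  fix X Y assume "X \<in> carrier T" "Y \<in> carrier T"
  then obtain x y where xy: "x \<in> carrier F" "X = Null #>\<^bsub>F\<^esub> x" "y \<in> carrier F" "Y = Null #>\<^bsub>F\<^esub> y"
    by (auto simp: carrier_tensor)
  then have "x + y \<in> carrier F" using keys_add[of x y] by auto
  then show "tensor_lift Q (\<lambda>(m, n). f m n) (X \<oplus>\<^bsub>T\<^esub> Y)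
      = tensor_lift Q (\<lambda>(m, n). f m n) X \<oplus>\<^bsub>Q\<^esub> tensor_lift Q (\<lambda>(m, n). f m n) Y"
    using xy by (simp add: coset_add lift_coset Q.frag_eval_add[OF lift_fun] del: carrier_free_Abelian_group_iff)
      (simp add: Q.frag_eval_add[OF lift_fun])
qed

lemma lift_pure:
  "\<lbrakk>m \<in> carrier M; n \<in> carrier N\<rbrakk> \<Longrightarrow> tensor_lift Q (\<lambda>(m, n). f m n) (p m n) = f m n"
  by (simp add: pure_def lift_coset Q.frag_eval_frag_of balancedD[OF f])

end

text \<open>Sums of pure tensors already exhaust the tensor product, since \<open>0\<close> is the
  pure tensor \<open>0 \<otimes> 0\<close> and \<open>- (m \<otimes> n)\<close> is the pure tensor
  \<open>(- m) \<otimes> n\<close>.\<close>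

lemma tensor_induct [consumes 1, case_names pure add]:
  assumes X: "X \<in> carrier T"
    and pure: "\<And>m n. \<lbrakk>m \<in> carrier M; n \<in> carrier N\<rbrakk> \<Longrightarrow> P (p m n)"
    and add: "\<And>X Y. \<lbrakk>X \<in> carrier T; Y \<in> carrier T; P X; P Y\<rbrakk> \<Longrightarrow> P (X \<oplus>\<^bsub>T\<^esub> Y)"
  shows "P X"
proof -
  interpret T: abelian_group T by (rule abelian_group_tensor)
  have zero: "P \<zero>\<^bsub>T\<^esub>"
  proof -
    have "p \<zero>\<^bsub>M\<^esub> \<zero>\<^bsub>N\<^esub> \<oplus>\<^bsub>T\<^esub> p \<zero>\<^bsub>M\<^esub> \<zero>\<^bsub>N\<^esub> = p \<zero>\<^bsub>M\<^esub> \<zero>\<^bsub>N\<^esub>"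
      using pure_add_l[of "\<zero>\<^bsub>M\<^esub>" "\<zero>\<^bsub>M\<^esub>" "\<zero>\<^bsub>N\<^esub>"] by simp
    then have "p \<zero>\<^bsub>M\<^esub> \<zero>\<^bsub>N\<^esub> = \<zero>\<^bsub>T\<^esub>"
      using pure_closed[of "\<zero>\<^bsub>M\<^esub>" "\<zero>\<^bsub>N\<^esub>"] by (metis M.mod.M.zero_closed N.mod.M.zero_closed T.add.l_cancel_one')
    then show ?thesis using pure[of "\<zero>\<^bsub>M\<^esub>" "\<zero>\<^bsub>N\<^esub>"] by simp
  qed
  have neg: "p (\<ominus>\<^bsub>M\<^esub> m) n = \<ominus>\<^bsub>T\<^esub> p m n" if "m \<in> carrier M" "n \<in> carrier N" for m n
  proof -
    have z: "p \<zero>\<^bsub>M\<^esub> n \<oplus>\<^bsub>T\<^esub> p \<zero>\<^bsub>M\<^esub> n = p \<zero>\<^bsub>M\<^esub> n"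
      using pure_add_l[of "\<zero>\<^bsub>M\<^esub>" "\<zero>\<^bsub>M\<^esub>" n] that by simp
    then have "p \<zero>\<^bsub>M\<^esub> n = \<zero>\<^bsub>T\<^esub>"
      using pure_closed[of "\<zero>\<^bsub>M\<^esub>" n] that by (metis M.mod.M.zero_closed T.add.l_cancel_one')
    then have "p (\<ominus>\<^bsub>M\<^esub> m) n \<oplus>\<^bsub>T\<^esub> p m n = \<zero>\<^bsub>T\<^esub>"
      using pure_add_l[of "\<ominus>\<^bsub>M\<^esub> m" m n] that by (simp add: M.mod.M.l_neg)
    then show ?thesis
      using that by (metis T.minus_equality M.mod.M.a_inv_closed pure_closed)
  qed
  obtain x where x: "x \<in> carrier F" "X = Null #>\<^bsub>F\<^esub> x" using X by (auto simp: carrier_tensor)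
  \<comment> \<open>\<open>frag_induction\<close> passes to differences \<open>a - b\<close>, so the
    claim is made for \<open>x\<close> and \<open>- x\<close> together; this provides
    \<open>P\<close> for the class of \<open>- b\<close>.\<close>
  have "x \<in> carrier F \<and> P (Null #>\<^bsub>F\<^esub> x) \<and> P (Null #>\<^bsub>F\<^esub> (- x))"
  proof -
    have "Poly_Mapping.keys x \<subseteq> carrier M \<times> carrier N" using x by simp
    then show ?thesis
    proof (induction rule: frag_induction)
      case zero
      have "Null #>\<^bsub>F\<^esub> 0 = \<zero>\<^bsub>T\<^esub>"
        using group.coset_mult_one[OF group_free_Abelian_group subgroup.subset[OF null_subgroup]]
        by (simp add: zero_tensor)
      then show ?case using \<open>P \<zero>\<^bsub>T\<^esub>\<close> by simp
    next
      case (one q)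
      then obtain m n where q: "q = (m, n)" "m \<in> carrier M" "n \<in> carrier N" by auto
      have "(Null #>\<^bsub>F\<^esub> (- frag_of q)) \<oplus>\<^bsub>T\<^esub> p m n = Null #>\<^bsub>F\<^esub> 0"
        using coset_add[of "- frag_of q" "frag_of q"] q by (simp add: pure_def)
      also have "\<dots> = \<zero>\<^bsub>T\<^esub>"
        using group.coset_mult_one[OF group_free_Abelian_group subgroup.subset[OF null_subgroup]]
        by (simp add: zero_tensor)
      finally have "\<ominus>\<^bsub>T\<^esub> p m n = Null #>\<^bsub>F\<^esub> (- frag_of q)"
        by (rule T.minus_equality) (use q in \<open>auto simp: carrier_tensor pure_def\<close>)
      then have "Null #>\<^bsub>F\<^esub> (- frag_of q) = p (\<ominus>\<^bsub>M\<^esub> m) n"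
        using q by (simp add: neg)
      then show ?case using q pure[of m n] pure[of "\<ominus>\<^bsub>M\<^esub> m" n] by (simp add: pure_def)
    next
      case (diff a b)
      have c: "Null #>\<^bsub>F\<^esub> x \<in> carrier T" if "x \<in> carrier F" for x
        using that by (auto simp: carrier_tensor)
      have d: "- x \<in> carrier F" if "x \<in> carrier F" for x using that by simp
      have "a + - b \<in> carrier F"
        using keys_add[of a "- b"] diff by auto
      moreover have "P (Null #>\<^bsub>F\<^esub> (a + - b))" "P (Null #>\<^bsub>F\<^esub> (- a + b))"
        using diff by (simp_all only: coset_add[symmetric] add c d)
      ultimately show ?case by simp
    qed
  qed
  then show ?thesis using x by simp
qed

text \<open>The uniqueness half of the universal property, and the standard argument from here on:
  once both sides are known to be additive in the tensor argument, pure tensors decide.\<close>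

lemma tensor_ext:
  assumes "h \<in> additive T Q" "h' \<in> additive T Q"
    and "\<And>m n. \<lbrakk>m \<in> carrier M; n \<in> carrier N\<rbrakk> \<Longrightarrow> h (p m n) = h' (p m n)"
    and "X \<in> carrier T"
  shows "h X = h' X"
  using assms(4)
  by (induction rule: tensor_induct) (simp_all add: assms(3) additive_add[OF assms(1)] additive_add[OF assms(2)])

end

section \<open>Module structures on tensor products\<close>

text \<open>\<open>tensor_lift\<close> sees only the carrier, addition and zero of its target. The
  operations of \<open>tensor\<close> are defined by lifts into \<open>tensor_group\<close>, a
  record of another type; this turns them into lifts into \<open>tensor\<close> itself.\<close>

lemma tensor_lift_ring_cong:
  assumes "carrier Q = carrier Q'" "add Q = add Q'" "ring.zero Q = ring.zero Q'"
  shows "tensor_lift Q f = tensor_lift Q' f"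
proof -
  have pow: "[k] \<cdot>\<^bsub>Q\<^esub> x = [k] \<cdot>\<^bsub>Q'\<^esub> x" for k :: int and x
    unfolding add_pow_def int_pow_def nat_pow_def m_inv_def Let_def by (cases "k < 0") (simp_all add: assms)
  show ?thesis
    by (rule ext) (simp add: pow tensor_lift_def finsum_def finprod_def assms)
qed

context tensor_pair begin

text \<open>For lifts nested inside lifts: the inner lift depends on a parameter \<open>u\<close>,
  and balancedness of the outer one asks for additivity in \<open>u\<close>.\<close>

lemma lift_additive_param:
  assumes Q: "abelian_group Q" and f: "\<And>u. u \<in> carrier G \<Longrightarrow> balanced K B M N Q (f u)"
    and add: "\<And>m n. \<lbrakk>m \<in> carrier M; n \<in> carrier N\<rbrakk> \<Longrightarrow> (\<lambda>u. f u m n) \<in> additive G Q"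
    and G: "abelian_group G" and X: "X \<in> carrier T"
  shows "(\<lambda>u. tensor_lift Q (\<lambda>(m, n). f u m n) X) \<in> additive G Q"
proof (rule additiveI)
  fix u assume "u \<in> carrier G"
  then show "tensor_lift Q (\<lambda>(m, n). f u m n) X \<in> carrier Q"
    using additive_closed[OF lift_additive[OF Q f] X] by simp
next
  fix u v assume uv: "u \<in> carrier G" "v \<in> carrier G"
  then have w: "u \<oplus>\<^bsub>G\<^esub> v \<in> carrier G" using G by (simp add: abelian_groupE)
  show "tensor_lift Q (\<lambda>(m, n). f (u \<oplus>\<^bsub>G\<^esub> v) m n) X
      = tensor_lift Q (\<lambda>(m, n). f u m n) X \<oplus>\<^bsub>Q\<^esub> tensor_lift Q (\<lambda>(m, n). f v m n) X"
    by (rule tensor_ext[OF lift_additive[OF Q f[OF w]]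
          additive_plus[OF Q lift_additive[OF Q f[OF uv(1)]] lift_additive[OF Q f[OF uv(2)]]] _ X])
       (simp add: lift_pure[OF Q] f uv w additive_add[OF add])
qed

lemma lift_tensor_group: "tensor_lift (tensor_group K B M N) f = tensor_lift T f"
  by (rule tensor_lift_ring_cong) (simp_all add: tensor_def Let_def)

lemma smult_tensor: "c \<odot>\<^bsub>T\<^esub> X = tensor_lift T (\<lambda>(m, n). p (c \<odot>\<^bsub>M\<^esub> m) n) X"
  by (simp add: lift_tensor_group[symmetric]) (simp add: tensor_def Let_def)

lemma lact_tensor: "l \<triangleright>\<^bsub>T\<^esub> X = tensor_lift T (\<lambda>(m, n). p (l \<triangleright>\<^bsub>M\<^esub> m) n) X"
  by (simp add: lift_tensor_group[symmetric]) (simp add: tensor_def Let_def)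

lemma ract_tensor: "X \<triangleleft>\<^bsub>T\<^esub> a = tensor_lift T (\<lambda>(m, n). p m (n \<triangleleft>\<^bsub>N\<^esub> a)) X"
  by (simp add: lift_tensor_group[symmetric]) (simp add: tensor_def Let_def)

lemma balanced_smult:
  assumes "c \<in> carrier K"
  shows "balanced K B M N T (\<lambda>m. p (c \<odot>\<^bsub>M\<^esub> m))"
proof (intro balancedI additiveI)
  fix b m n assume *: "b \<in> carrier B" "m \<in> carrier M" "n \<in> carrier N"
  have "c \<odot>\<^bsub>M\<^esub> (m \<triangleleft>\<^bsub>M\<^esub> b) = (c \<odot>\<^bsub>M\<^esub> m) \<triangleleft>\<^bsub>M\<^esub> b"
    using * assms by (simp add: M.ract_smult_l)
  then show "p (c \<odot>\<^bsub>M\<^esub> (m \<triangleleft>\<^bsub>M\<^esub> b)) n = p (c \<odot>\<^bsub>M\<^esub> m) (b \<triangleright>\<^bsub>N\<^esub> n)"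
    using * assms by (simp add: pure_act)
next
  fix d m n assume *: "d \<in> carrier K" "m \<in> carrier M" "n \<in> carrier N"
  \<comment> \<open>Commutativity of \<open>K\<close> makes scaling by \<open>c\<close> compatible
    with the \<open>K\<close>-relations.\<close>
  have "c \<odot>\<^bsub>M\<^esub> (d \<odot>\<^bsub>M\<^esub> m) = d \<odot>\<^bsub>M\<^esub> (c \<odot>\<^bsub>M\<^esub> m)"
    using * assms M.alg.R.m_comm[of c d] by (simp add: M.mod.smult_assoc1[symmetric])
  then show "p (c \<odot>\<^bsub>M\<^esub> (d \<odot>\<^bsub>M\<^esub> m)) n = p (c \<odot>\<^bsub>M\<^esub> m) (d \<odot>\<^bsub>N\<^esub> n)"
    using * assms by (simp add: pure_smult)
qed (use assms in \<open>simp_all add: pure_closed pure_add_l pure_add_r M.mod.smult_r_distr\<close>)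

lemma smult_additive: "c \<in> carrier K \<Longrightarrow> smult T c \<in> additive T T"
  unfolding smult_tensor[abs_def]
  by (rule lift_additive[OF abelian_group_tensor balanced_smult])

lemma smult_pure:
  "\<lbrakk>c \<in> carrier K; m \<in> carrier M; n \<in> carrier N\<rbrakk> \<Longrightarrow> c \<odot>\<^bsub>T\<^esub> p m n = p (c \<odot>\<^bsub>M\<^esub> m) n"
  unfolding smult_tensor by (rule lift_pure[OF abelian_group_tensor balanced_smult])

lemma module_tensor: "module K T"
proof (rule moduleI)
  show "cring K" by (rule M.alg.R.cring_axioms)
  show "abelian_group T" by (rule abelian_group_tensor)
  note [simp] = pure_closed smult_pure additive_add[OF smult_additive] pure_add_l
  interpret T: abelian_group T by (rule abelian_group_tensor)
  fix c d X assume cd: "c \<in> carrier K" "d \<in> carrier K" and X: "X \<in> carrier T"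
  show "(c \<oplus> d) \<odot>\<^bsub>T\<^esub> X = c \<odot>\<^bsub>T\<^esub> X \<oplus>\<^bsub>T\<^esub> d \<odot>\<^bsub>T\<^esub> X"
    by (rule tensor_ext[OF smult_additive additive_plus[OF abelian_group_tensor smult_additive smult_additive] _ X])
       (use cd in \<open>simp_all add: M.mod.smult_l_distr\<close>)
  show "(c \<otimes> d) \<odot>\<^bsub>T\<^esub> X = c \<odot>\<^bsub>T\<^esub> (d \<odot>\<^bsub>T\<^esub> X)"
    by (rule tensor_ext[OF smult_additive additive_comp[OF smult_additive smult_additive] _ X])
       (use cd in \<open>simp_all add: M.mod.smult_assoc1\<close>)
next
  fix X assume X: "X \<in> carrier T"
  show "\<one> \<odot>\<^bsub>T\<^esub> X = X"
    by (rule tensor_ext[OF smult_additive additive_id _ X]) (simp_all add: smult_pure)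
qed (simp_all add: additive_closed[OF smult_additive] additive_add[OF smult_additive])

text \<open>Acting on the left factor respects the \<open>B\<close>-relations because the actions of
  \<open>L\<close> and \<open>B\<close> on \<open>M\<close> commute.\<close>

lemma balanced_lact:
  assumes "bimodule K L B M" "l \<in> carrier L"
  shows "balanced K B M N T (\<lambda>m. p (l \<triangleright>\<^bsub>M\<^esub> m))"
proof -
  interpret L: bimodule K L B M by fact
  note [simp] = L.left.lact_closed
  show ?thesis
    using assms(2)
    by (intro balancedI additiveI)
      (simp_all add: pure_closed pure_add_l pure_add_r L.left.lact_add_r L.left.lact_smult_r
        pure_smult L.lact_ract[symmetric] pure_act)
qed

lemma lact_additive: "\<lbrakk>bimodule K L B M; l \<in> carrier L\<rbrakk> \<Longrightarrow> lact T l \<in> additive T T"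
  unfolding lact_tensor[abs_def]
  by (rule lift_additive[OF abelian_group_tensor balanced_lact])

lemma lact_pure:
  "\<lbrakk>bimodule K L B M; l \<in> carrier L; m \<in> carrier M; n \<in> carrier N\<rbrakk> \<Longrightarrow> l \<triangleright>\<^bsub>T\<^esub> p m n = p (l \<triangleright>\<^bsub>M\<^esub> m) n"
  unfolding lact_tensor by (rule lift_pure[OF abelian_group_tensor balanced_lact])

lemma left_module_tensor:
  assumes L: "bimodule K L B M"
  shows "left_module K L T"
proof -
  interpret L: bimodule K L B M by fact
  interpret T: module K T by (rule module_tensor)
  note [simp] = pure_closed smult_pure lact_pure[OF L] pure_add_l L.left.lact_closed
  note ab = abelian_group_tensor
  show ?thesis
  proof (intro left_module.intro left_module_axioms.intro)
    show "nu_algebra K L" by (rule L.left.alg.nu_algebra_axioms)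
    show "module K T" by (rule module_tensor)
    fix r s X assume r: "r \<in> carrier L" "s \<in> carrier L" and X: "X \<in> carrier T"
    show "(r \<oplus>\<^bsub>L\<^esub> s) \<triangleright>\<^bsub>T\<^esub> X = r \<triangleright>\<^bsub>T\<^esub> X \<oplus>\<^bsub>T\<^esub> s \<triangleright>\<^bsub>T\<^esub> X"
      by (rule tensor_ext[OF lact_additive[OF L] additive_plus[OF ab lact_additive[OF L] lact_additive[OF L]] _ X])
         (use r in \<open>simp_all add: L.left.lact_add_l\<close>)
    show "(r \<otimes>\<^bsub>L\<^esub> s) \<triangleright>\<^bsub>T\<^esub> X = r \<triangleright>\<^bsub>T\<^esub> (s \<triangleright>\<^bsub>T\<^esub> X)"
      by (rule tensor_ext[OF lact_additive[OF L] additive_comp[OF lact_additive[OF L] lact_additive[OF L]] _ X])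
         (use r in \<open>simp_all add: L.left.lact_assoc L.left.alg.mult_closed\<close>)
  next
    fix c r X assume c: "c \<in> carrier K" and r: "r \<in> carrier L" and X: "X \<in> carrier T"
    show "(c \<odot>\<^bsub>L\<^esub> r) \<triangleright>\<^bsub>T\<^esub> X = c \<odot>\<^bsub>T\<^esub> (r \<triangleright>\<^bsub>T\<^esub> X)"
      by (rule tensor_ext[OF lact_additive[OF L] additive_comp[OF lact_additive[OF L] smult_additive] _ X])
         (use r c in \<open>simp_all add: L.left.lact_smult_l\<close>)
    show "r \<triangleright>\<^bsub>T\<^esub> (c \<odot>\<^bsub>T\<^esub> X) = c \<odot>\<^bsub>T\<^esub> (r \<triangleright>\<^bsub>T\<^esub> X)"
      by (rule tensor_ext[OF additive_comp[OF smult_additive lact_additive[OF L]]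
            additive_comp[OF lact_additive[OF L] smult_additive] _ X])
         (use r c in \<open>simp_all add: L.left.lact_smult_r\<close>)
  qed (simp_all add: additive_closed[OF lact_additive[OF L]] additive_add[OF lact_additive[OF L]])
qed

lemma balanced_ract:
  assumes "bimodule K B A N" "a \<in> carrier A"
  shows "balanced K B M N T (\<lambda>m n. p m (n \<triangleleft>\<^bsub>N\<^esub> a))"
proof -
  interpret A: bimodule K B A N by fact
  note [simp] = A.right.ract_closed
  show ?thesis
    using assms(2)
    by (intro balancedI additiveI)
      (simp_all add: pure_closed pure_add_l pure_add_r A.right.ract_add_l A.right.ract_smult_l
        pure_smult A.lact_ract pure_act)
qed

lemma ract_additive: "\<lbrakk>bimodule K B A N; a \<in> carrier A\<rbrakk> \<Longrightarrow> (\<lambda>X. X \<triangleleft>\<^bsub>T\<^esub> a) \<in> additive T T"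
  unfolding ract_tensor
  by (rule lift_additive[OF abelian_group_tensor balanced_ract])

lemma ract_pure:
  "\<lbrakk>bimodule K B A N; a \<in> carrier A; m \<in> carrier M; n \<in> carrier N\<rbrakk> \<Longrightarrow> p m n \<triangleleft>\<^bsub>T\<^esub> a = p m (n \<triangleleft>\<^bsub>N\<^esub> a)"
  unfolding ract_tensor by (rule lift_pure[OF abelian_group_tensor balanced_ract])

lemma right_module_tensor:
  assumes A: "bimodule K B A N"
  shows "right_module K A T"
proof -
  interpret A: bimodule K B A N by fact
  interpret T: module K T by (rule module_tensor)
  note [simp] = pure_closed smult_pure ract_pure[OF A] pure_add_r A.right.ract_closed pure_smult
  note ab = abelian_group_tensor
  show ?thesis
  proof (intro right_module.intro right_module_axioms.intro)
    show "nu_algebra K A" by (rule A.right.alg.nu_algebra_axioms)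
    show "module K T" by (rule module_tensor)
    fix r s X assume r: "r \<in> carrier A" "s \<in> carrier A" and X: "X \<in> carrier T"
    show "X \<triangleleft>\<^bsub>T\<^esub> (r \<oplus>\<^bsub>A\<^esub> s) = (X \<triangleleft>\<^bsub>T\<^esub> r) \<oplus>\<^bsub>T\<^esub> (X \<triangleleft>\<^bsub>T\<^esub> s)"
      by (rule tensor_ext[OF ract_additive[OF A] additive_plus[OF ab ract_additive[OF A] ract_additive[OF A]] _ X])
         (use r in \<open>simp_all add: A.right.ract_add_r\<close>)
    show "X \<triangleleft>\<^bsub>T\<^esub> (r \<otimes>\<^bsub>A\<^esub> s) = (X \<triangleleft>\<^bsub>T\<^esub> r) \<triangleleft>\<^bsub>T\<^esub> s"
      by (rule tensor_ext[OF ract_additive[OF A] additive_comp[OF ract_additive[OF A] ract_additive[OF A]] _ X])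
         (use r in \<open>simp_all add: A.right.ract_assoc A.right.alg.mult_closed\<close>)
  next
    fix c r X assume c: "c \<in> carrier K" and r: "r \<in> carrier A" and X: "X \<in> carrier T"
    show "X \<triangleleft>\<^bsub>T\<^esub> (c \<odot>\<^bsub>A\<^esub> r) = c \<odot>\<^bsub>T\<^esub> (X \<triangleleft>\<^bsub>T\<^esub> r)"
      by (rule tensor_ext[OF ract_additive[OF A] additive_comp[OF ract_additive[OF A] smult_additive] _ X])
         (use r c in \<open>simp_all add: A.right.ract_smult_r\<close>)
    show "(c \<odot>\<^bsub>T\<^esub> X) \<triangleleft>\<^bsub>T\<^esub> r = c \<odot>\<^bsub>T\<^esub> (X \<triangleleft>\<^bsub>T\<^esub> r)"
      by (rule tensor_ext[OF additive_comp[OF smult_additive ract_additive[OF A]]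
            additive_comp[OF ract_additive[OF A] smult_additive] _ X])
         (use r c in \<open>simp_all add: A.right.ract_smult_l\<close>)
  qed (simp_all add: additive_closed[OF ract_additive[OF A]] additive_add[OF ract_additive[OF A]])
qed

lemma bimodule_tensor:
  assumes L: "bimodule K L B M" and A: "bimodule K B A N"
  shows "bimodule K L A T"
proof -
  interpret L: bimodule K L B M by fact
  interpret A: bimodule K B A N by fact
  show ?thesis
  proof (intro bimodule.intro bimodule_axioms.intro left_module_tensor[OF L] right_module_tensor[OF A])
    fix r X a assume r: "r \<in> carrier L" "a \<in> carrier A" and X: "X \<in> carrier T"
    show "(r \<triangleright>\<^bsub>T\<^esub> X) \<triangleleft>\<^bsub>T\<^esub> a = r \<triangleright>\<^bsub>T\<^esub> (X \<triangleleft>\<^bsub>T\<^esub> a)"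
      by (rule tensor_ext[OF additive_comp[OF lact_additive[OF L] ract_additive[OF A]]
            additive_comp[OF ract_additive[OF A] lact_additive[OF L]] _ X])
         (use r in \<open>simp_all add: lact_pure[OF L] ract_pure[OF A] L.left.lact_closed A.right.ract_closed\<close>)
  qed
qed

lemma unital_right_module_tensor:
  assumes A: "bimodule K B A N" and u: "unital_right_module K A N"
  shows "unital_right_module K A T"
proof -
  interpret u: unital_right_module K A N by fact
  show ?thesis
  proof (intro unital_right_module.intro unital_right_module_axioms.intro right_module_tensor[OF A])
    show "unital_algebra K A" by (rule u.unital_algebra_axioms)
    fix X assume X: "X \<in> carrier T"
    show "X \<triangleleft>\<^bsub>T\<^esub> \<one>\<^bsub>A\<^esub> = X"
      by (rule tensor_ext[OF ract_additive[OF A] additive_id _ X])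
         (simp_all add: ract_pure[OF A] u.ract_one)
  qed
qed

end

section \<open>Maps between tensor products\<close>

text \<open>Mirror image of \<open>right_hom\<close>. For \<open>f \<otimes> g\<close> over
  \<open>B\<close> to be well defined, \<open>f\<close> has to be linear on the right and
  \<open>g\<close> on the left.\<close>

definition left_hom ::
  "('k, 'x) ring_scheme \<Rightarrow> ('k, 'a) module \<Rightarrow> ('k, 'm, 'a, 'r) bimod \<Rightarrow> ('k, 'n, 'a, 'r2) bimod
    \<Rightarrow> ('m \<Rightarrow> 'n) set"
where
  "left_hom K A M N = {f \<in> additive M N.
     (\<forall>c \<in> carrier K. \<forall>x \<in> carrier M. f (c \<odot>\<^bsub>M\<^esub> x) = c \<odot>\<^bsub>N\<^esub> f x) \<and>
     (\<forall>a \<in> carrier A. \<forall>x \<in> carrier M. f (a \<triangleright>\<^bsub>M\<^esub> x) = a \<triangleright>\<^bsub>N\<^esub> f x)}"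

lemma left_homD:
  assumes "f \<in> left_hom K A M N"
  shows "f \<in> additive M N"
    and "\<And>x. x \<in> carrier M \<Longrightarrow> f x \<in> carrier N"
    and "\<And>x y. \<lbrakk>x \<in> carrier M; y \<in> carrier M\<rbrakk> \<Longrightarrow> f (x \<oplus>\<^bsub>M\<^esub> y) = f x \<oplus>\<^bsub>N\<^esub> f y"
    and "\<And>c x. \<lbrakk>c \<in> carrier K; x \<in> carrier M\<rbrakk> \<Longrightarrow> f (c \<odot>\<^bsub>M\<^esub> x) = c \<odot>\<^bsub>N\<^esub> f x"
    and "\<And>a x. \<lbrakk>a \<in> carrier A; x \<in> carrier M\<rbrakk> \<Longrightarrow> f (a \<triangleright>\<^bsub>M\<^esub> x) = a \<triangleright>\<^bsub>N\<^esub> f x"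
  using assms by (auto simp: left_hom_def additive_def)

lemma right_homD:
  assumes "f \<in> right_hom K A M N"
  shows "f \<in> additive M N"
    and "\<And>x. x \<in> carrier M \<Longrightarrow> f x \<in> carrier N"
    and "\<And>x y. \<lbrakk>x \<in> carrier M; y \<in> carrier M\<rbrakk> \<Longrightarrow> f (x \<oplus>\<^bsub>M\<^esub> y) = f x \<oplus>\<^bsub>N\<^esub> f y"
    and "\<And>c x. \<lbrakk>c \<in> carrier K; x \<in> carrier M\<rbrakk> \<Longrightarrow> f (c \<odot>\<^bsub>M\<^esub> x) = c \<odot>\<^bsub>N\<^esub> f x"
    and "\<And>a x. \<lbrakk>a \<in> carrier A; x \<in> carrier M\<rbrakk> \<Longrightarrow> f (x \<triangleleft>\<^bsub>M\<^esub> a) = f x \<triangleleft>\<^bsub>N\<^esub> a"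
  using assms by (auto simp: right_hom_def additive_def)

lemma right_homI:
  assumes "f \<in> additive M N"
    and "\<And>c x. \<lbrakk>c \<in> carrier K; x \<in> carrier M\<rbrakk> \<Longrightarrow> f (c \<odot>\<^bsub>M\<^esub> x) = c \<odot>\<^bsub>N\<^esub> f x"
    and "\<And>a x. \<lbrakk>a \<in> carrier A; x \<in> carrier M\<rbrakk> \<Longrightarrow> f (x \<triangleleft>\<^bsub>M\<^esub> a) = f x \<triangleleft>\<^bsub>N\<^esub> a"
  shows "f \<in> right_hom K A M N"
  using assms by (auto simp: right_hom_def additive_def)

lemma left_homI:
  assumes "f \<in> additive M N"
    and "\<And>c x. \<lbrakk>c \<in> carrier K; x \<in> carrier M\<rbrakk> \<Longrightarrow> f (c \<odot>\<^bsub>M\<^esub> x) = c \<odot>\<^bsub>N\<^esub> f x"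
    and "\<And>a x. \<lbrakk>a \<in> carrier A; x \<in> carrier M\<rbrakk> \<Longrightarrow> f (a \<triangleright>\<^bsub>M\<^esub> x) = a \<triangleright>\<^bsub>N\<^esub> f x"
  shows "f \<in> left_hom K A M N"
  using assms by (auto simp: left_hom_def)

lemma right_hom_id: "(\<lambda>x. x) \<in> right_hom K A M M"
  by (simp add: right_homI additive_id)

lemma left_hom_id: "(\<lambda>x. x) \<in> left_hom K A M M"
  by (simp add: left_homI additive_id)

lemma bimodule_hom_right: "f \<in> bimodule_hom K R A M N \<Longrightarrow> f \<in> right_hom K A M N"
  by (simp add: bimodule_hom_def)

lemma bimodule_hom_left: "f \<in> bimodule_hom K R A M N \<Longrightarrow> f \<in> left_hom K R M N"
  by (auto simp: bimodule_hom_def right_hom_def left_hom_def additive_def)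

locale tensor_maps = S: tensor_pair K B M N + U: tensor_pair K B M' N'
  for K :: "('k, 'x) ring_scheme" (structure) and B :: "('k, 'b) module"
    and M :: "('k, 'm, 'l, 'b) bimod" and N :: "('k, 'n, 'b, 'r) bimod"
    and M' :: "('k, 'm2, 'l2, 'b) bimod" and N' :: "('k, 'n2, 'b, 'r) bimod" +
  fixes f g
  assumes f: "f \<in> right_hom K B M M'" and g: "g \<in> left_hom K B N N'"
begin

lemma balanced_map: "balanced K B M N U.T (\<lambda>m n. U.p (f m) (g n))"
  by (intro balancedI additiveI)
    (simp_all add: right_homD[OF f] left_homD[OF g] U.pure_closed U.pure_add_l U.pure_add_r
      U.pure_smult U.pure_act)

lemma map_additive: "tensor_map K B M' N' f g \<in> additive S.T U.T"
  unfolding tensor_map_def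
  by (rule S.lift_additive[OF U.abelian_group_tensor balanced_map])

lemma map_pure:
  "\<lbrakk>m \<in> carrier M; n \<in> carrier N\<rbrakk> \<Longrightarrow> tensor_map K B M' N' f g (S.p m n) = U.p (f m) (g n)"
  unfolding tensor_map_def
  by (rule S.lift_pure[OF U.abelian_group_tensor balanced_map])

lemma map_smult:
  assumes "c \<in> carrier K" "X \<in> carrier S.T"
  shows "tensor_map K B M' N' f g (c \<odot>\<^bsub>S.T\<^esub> X) = c \<odot>\<^bsub>U.T\<^esub> tensor_map K B M' N' f g X"
  by (rule S.tensor_ext[OF additive_comp[OF S.smult_additive map_additive]
        additive_comp[OF map_additive U.smult_additive]])
     (use assms in \<open>simp_all add: S.smult_pure U.smult_pure map_pure right_homD[OF f] left_homD[OF g]\<close>)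

lemma map_right_hom:
  assumes A: "bimodule K B A N" and A': "bimodule K B A N'" and g': "g \<in> right_hom K A N N'"
  shows "tensor_map K B M' N' f g \<in> right_hom K A S.T U.T"
proof (rule right_homI[OF map_additive map_smult])
  interpret A: bimodule K B A N by fact
  fix a X assume aX: "a \<in> carrier A" "X \<in> carrier S.T"
  show "tensor_map K B M' N' f g (X \<triangleleft>\<^bsub>S.T\<^esub> a) = tensor_map K B M' N' f g X \<triangleleft>\<^bsub>U.T\<^esub> a"
    by (rule S.tensor_ext[OF additive_comp[OF S.ract_additive[OF A] map_additive]
        additive_comp[OF map_additive U.ract_additive[OF A']]])
       (use aX in \<open>simp_all add: S.ract_pure[OF A] U.ract_pure[OF A'] map_pure right_homD[OF f]
          left_homD[OF g] right_homD[OF g'] A.right.ract_closed\<close>)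
qed

end

locale tensor_triple = L: right_module K A L + M: bimodule K A B M + N: left_module K B N
  for K :: "('k, 'x) ring_scheme" (structure) and A :: "('k, 'a) module" and B :: "('k, 'b) module"
    and L :: "('k, 'u, 'l, 'a) bimod" and M :: "('k, 'm, 'a, 'b) bimod"
    and N :: "('k, 'n, 'b, 'r) bimod"
begin

sublocale LM: tensor_pair K A L M ..
sublocale MN: tensor_pair K B M N ..

sublocale LM_N: tensor_pair K B LM.T N
  by (intro tensor_pair.intro LM.right_module_tensor M.bimodule_axioms N.left_module_axioms)

sublocale L_MN: tensor_pair K A L MN.T
  by (intro tensor_pair.intro MN.left_module_tensor M.bimodule_axioms L.right_module_axioms)

lemma balanced_assoc_inner:
  assumes n: "n \<in> carrier N"
  shows "balanced K A L M L_MN.T (\<lambda>l m. L_MN.p l (MN.p m n))"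
  using n
  by (intro balancedI additiveI)
    (simp_all add: L_MN.pure_closed MN.pure_closed L_MN.pure_add_l MN.pure_add_l L_MN.pure_add_r
      L_MN.pure_smult L_MN.pure_act MN.smult_pure MN.lact_pure[OF M.bimodule_axioms])

text \<open>The associator is a lift in \<open>(X, n)\<close> whose values are lifts in
  \<open>(l, m)\<close>. The outer relations hold because an element of \<open>B\<close> acting on
  \<open>X\<close> lands on \<open>m\<close> and from there crosses to \<open>n\<close> inside
  \<open>M \<otimes> N\<close>.\<close>

lemma balanced_assoc:
  "balanced K B LM.T N L_MN.T (\<lambda>X n. tensor_lift L_MN.T (\<lambda>(l, m). L_MN.p l (MN.p m n)) X)"
proof (rule balancedI)
  note ab = L_MN.abelian_group_tensor
  note li = LM.lift_additive[OF ab balanced_assoc_inner] LM.lift_pure[OF ab balanced_assoc_inner]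
  note [simp] = N.lact_closed M.right.ract_closed
  show "(\<lambda>X. tensor_lift L_MN.T (\<lambda>(l, m). L_MN.p l (MN.p m n)) X) \<in> additive LM.T L_MN.T"
    if "n \<in> carrier N" for n
    using li(1)[OF that] .
  show "(\<lambda>n. tensor_lift L_MN.T (\<lambda>(l, m). L_MN.p l (MN.p m n)) X) \<in> additive N L_MN.T"
    if X: "X \<in> carrier LM.T" for X
    by (rule LM.lift_additive_param[OF ab balanced_assoc_inner _ _ X])
      (auto intro!: additiveI simp: L_MN.pure_closed MN.pure_closed L_MN.pure_add_r MN.pure_add_r
        N.mod.abelian_group_axioms)
  show "tensor_lift L_MN.T (\<lambda>(l, m). L_MN.p l (MN.p m n)) (c \<odot>\<^bsub>LM.T\<^esub> X)
      = tensor_lift L_MN.T (\<lambda>(l, m). L_MN.p l (MN.p m (c \<odot>\<^bsub>N\<^esub> n))) X"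
    if c: "c \<in> carrier K" and X: "X \<in> carrier LM.T" and n: "n \<in> carrier N" for c X n
    by (rule LM.tensor_ext[OF additive_comp[OF LM.smult_additive li(1)] li(1) _ X])
      (use c n in \<open>simp_all add: LM.smult_pure li(2) LM.pure_smult MN.pure_smult\<close>)
  show "tensor_lift L_MN.T (\<lambda>(l, m). L_MN.p l (MN.p m n)) (X \<triangleleft>\<^bsub>LM.T\<^esub> b)
      = tensor_lift L_MN.T (\<lambda>(l, m). L_MN.p l (MN.p m (b \<triangleright>\<^bsub>N\<^esub> n))) X"
    if c: "b \<in> carrier B" and X: "X \<in> carrier LM.T" and n: "n \<in> carrier N" for b X n
    by (rule LM.tensor_ext[OF additive_comp[OF LM.ract_additive[OF M.bimodule_axioms] li(1)] li(1) _ X])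
      (use c n in \<open>simp_all add: LM.ract_pure[OF M.bimodule_axioms] li(2) MN.pure_act\<close>)
qed

lemma assoc_additive: "tensor_assoc K A B L M N \<in> additive LM_N.T L_MN.T"
  unfolding tensor_assoc_def Let_def
  by (rule LM_N.lift_additive[OF L_MN.abelian_group_tensor balanced_assoc])

lemma assoc_pure:
  "\<lbrakk>l \<in> carrier L; m \<in> carrier M; n \<in> carrier N\<rbrakk> \<Longrightarrow>
    tensor_assoc K A B L M N (LM_N.p (LM.p l m) n) = L_MN.p l (MN.p m n)"
  unfolding tensor_assoc_def Let_def
  by (simp add: LM_N.lift_pure[OF L_MN.abelian_group_tensor balanced_assoc] LM.pure_closed
      LM.lift_pure[OF L_MN.abelian_group_tensor balanced_assoc_inner])

end

section \<open>Firmness of the tensor product\<close>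

lemma regular_simps [simp]:
  "carrier (regular R) = carrier R" "add (regular R) = add R" "ring.zero (regular R) = ring.zero R"
  "smult (regular R) = smult R" "lact (regular R) = mult R" "ract (regular R) = mult R"
  by (simp_all add: regular_def module.defs bimod.defs)

lemma with_left_simps [simp]:
  "carrier (with_left l M) = carrier M" "add (with_left l M) = add M"
  "ring.zero (with_left l M) = ring.zero M" "smult (with_left l M) = smult M"
  "lact (with_left l M) = l" "ract (with_left l M) = ract M"
  by (simp_all add: with_left_def module.defs bimod.defs)

text \<open>\<open>regular\<close>, \<open>with_left\<close> and \<open>dual_tensor_algebra\<close>
  produce records of other types with the same additive group, so facts are carried over field by
  field.\<close>

lemma abelian_group_cong:
  assumes "abelian_group G" "carrier H = carrier G" "add H = add G" "ring.zero H = ring.zero G"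
  shows "abelian_group H"
  by (intro abelian_groupI; unfold assms(2-4)) (use abelian_groupE[OF assms(1)] in blast)+

lemma module_cong:
  assumes "module K G" "carrier H = carrier G" "add H = add G" "ring.zero H = ring.zero G"
    and "smult H = smult G"
  shows "module K H"
proof -
  interpret module K G by fact
  show ?thesis
    by (intro moduleI abelian_group_cong[OF M.abelian_group_axioms assms(2-4)] R.cring_axioms)
      (simp_all add: assms(2-5) smult_l_distr smult_r_distr smult_assoc1)
qed

lemma bimodule_regular:
  assumes "nu_algebra K R"
  shows "bimodule K R R (regular R)"
proof -
  interpret R: nu_algebra K R by fact
  have "module K (regular R)"
    by (rule module_cong[OF R.module_axioms]) simp_all
  then show ?thesis
    by (intro bimodule.intro left_module.intro right_module.intro bimodule_axioms.intro
        left_module_axioms.intro right_module_axioms.intro assms)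
      (simp_all add: R.mult_closed R.mult_assoc R.mult_l_distr R.mult_r_distr R.smult_mult_l
        R.smult_mult_r)
qed

lemma right_module_with_left:
  assumes "right_module K A M"
  shows "right_module K A (with_left l M)"
proof -
  interpret M: right_module K A M by fact
  have "module K (with_left l M)"
    by (rule module_cong[OF M.mod.module_axioms]) simp_all
  then show ?thesis
    by (intro right_module.intro right_module_axioms.intro M.alg.nu_algebra_axioms)
      (simp_all add: M.ract_closed M.ract_add_l M.ract_add_r M.ract_smult_l M.ract_smult_r
        M.ract_assoc)
qed

lemma alg_hom_subalgebra:
  assumes "f \<in> alg_hom K R (S\<lparr>carrier := X\<rparr>)" "X \<subseteq> carrier S"
  shows "f \<in> alg_hom K R S"
  using assms by (auto simp: alg_hom_def)

lemma alg_homD: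
  assumes "f \<in> alg_hom K R S"
  shows "\<And>x. x \<in> carrier R \<Longrightarrow> f x \<in> carrier S"
    and "\<And>x y. \<lbrakk>x \<in> carrier R; y \<in> carrier R\<rbrakk> \<Longrightarrow> f (x \<oplus>\<^bsub>R\<^esub> y) = f x \<oplus>\<^bsub>S\<^esub> f y"
    and "\<And>x y. \<lbrakk>x \<in> carrier R; y \<in> carrier R\<rbrakk> \<Longrightarrow> f (x \<otimes>\<^bsub>R\<^esub> y) = f x \<otimes>\<^bsub>S\<^esub> f y"
    and "\<And>c x. \<lbrakk>c \<in> carrier K; x \<in> carrier R\<rbrakk> \<Longrightarrow> f (c \<odot>\<^bsub>R\<^esub> x) = c \<odot>\<^bsub>S\<^esub> f x"
  using assms by (auto simp: alg_hom_def)

lemma end_algebra_carrierD: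
  assumes "f \<in> carrier (end_algebra K A M)"
  shows "f \<in> right_hom K A M M" "f \<in> extensional (carrier M)"
  using assms by (simp_all add: end_algebra_def)

text \<open>Multiplication in \<open>end_algebra\<close> is composition, so multiplicativity of
  \<open>\<iota>\<close> is associativity of the action; \<open>A\<close>-linearity of each
  \<open>\<iota> r\<close> is the compatibility of the two actions.\<close>

lemma bimodule_with_left:
  assumes "right_module K A M" "nu_algebra K R" and \<iota>: "\<iota> \<in> alg_hom K R (end_algebra K A M)"
  shows "bimodule K R A (with_left \<iota> M)"
proof -
  interpret M: right_module K A M by fact
  interpret W: right_module K A "with_left \<iota> M" by (rule right_module_with_left) fact
  note h = right_homD[OF end_algebra_carrierD(1)[OF alg_homD(1)[OF \<iota>]]]
  show ?thesis
    by (intro bimodule.intro left_module.intro bimodule_axioms.intro left_module_axioms.intro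
        assms(2) W.right_module_axioms W.mod.module_axioms)
      (simp_all add: h alg_homD[OF \<iota>], simp_all add: end_algebra_def compose_def)
qed

lemma inv_into_additive:
  assumes "abelian_group G" "f \<in> additive G H" "bij_betw f (carrier G) (carrier H)"
  shows "inv_into (carrier G) f \<in> additive H G"
proof -
  interpret G: abelian_group G by fact
  note bij = bij_betw_inv_into_left[OF assms(3)] bij_betw_inv_into_right[OF assms(3)]
  have c: "inv_into (carrier G) f y \<in> carrier G" if "y \<in> carrier H" for y
    using that assms(3) by (metis bij_betw_imp_surj_on inv_into_into)
  show ?thesis
  proof (rule additiveI[OF c])
    fix x y assume "x \<in> carrier H" "y \<in> carrier H"
    then show "inv_into (carrier G) f (x \<oplus>\<^bsub>H\<^esub> y)
        = inv_into (carrier G) f x \<oplus>\<^bsub>G\<^esub> inv_into (carrier G) f y"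
      using additive_add[OF assms(2) c c, of x y] bij(1)[of "inv_into (carrier G) f x \<oplus>\<^bsub>G\<^esub> inv_into (carrier G) f y"]
      by (simp add: bij(2) c)
  qed
qed

section \<open>The inverse of the multiplication \<open>R \<otimes> R \<rightarrow> R\<close> of a
  firm ring\<close>

context firm_ring begin

lemma R_bimod: "bimodule K R R (regular R)"
  by (rule bimodule_regular) (rule nu_algebra_axioms)

sublocale RB: bimodule K R R "regular R" by (rule R_bimod)
sublocale RR: tensor_pair K R "regular R" "regular R" ..

definition \<mu> where "\<mu> = tensor_lift R (\<lambda>(r, s). r \<otimes>\<^bsub>R\<^esub> s)"
text \<open>In a unital ring this would be \<open>r \<mapsto> r \<otimes> 1\<close>.\<close>

definition \<sigma> where "\<sigma> = inv_into (carrier RR.T) \<mu>"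

lemma R_group: "abelian_group R" by (rule M.abelian_group_axioms)

lemma balanced_mult: "balanced K R (regular R) (regular R) R (\<lambda>r s. r \<otimes>\<^bsub>R\<^esub> s)"
  by (intro balancedI additiveI)
    (simp_all add: mult_closed mult_l_distr mult_r_distr smult_mult_l smult_mult_r mult_assoc)

lemma \<mu>_additive: "\<mu> \<in> additive RR.T R"
  unfolding \<mu>_def by (rule RR.lift_additive[OF R_group balanced_mult])

lemma \<mu>_pure: "\<lbrakk>r \<in> carrier R; s \<in> carrier R\<rbrakk> \<Longrightarrow> \<mu> (RR.p r s) = r \<otimes>\<^bsub>R\<^esub> s"
  unfolding \<mu>_def using RR.lift_pure[OF R_group balanced_mult] by simp

lemma \<mu>_bij: "bij_betw \<mu> (carrier RR.T) (carrier R)"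
  unfolding \<mu>_def by (rule firm)

lemma \<sigma>_additive: "\<sigma> \<in> additive R RR.T"
  unfolding \<sigma>_def by (rule inv_into_additive[OF RR.abelian_group_tensor \<mu>_additive \<mu>_bij])

lemma \<sigma>_closed: "r \<in> carrier R \<Longrightarrow> \<sigma> r \<in> carrier RR.T"
  by (rule additive_closed[OF \<sigma>_additive])

lemma \<mu>_\<sigma>: "r \<in> carrier R \<Longrightarrow> \<mu> (\<sigma> r) = r"
  unfolding \<sigma>_def by (rule bij_betw_inv_into_right[OF \<mu>_bij])

lemma \<sigma>_\<mu>: "Z \<in> carrier RR.T \<Longrightarrow> \<sigma> (\<mu> Z) = Z"
  unfolding \<sigma>_def by (rule bij_betw_inv_into_left[OF \<mu>_bij])

lemma \<sigma>_mult: "\<lbrakk>r \<in> carrier R; s \<in> carrier R\<rbrakk> \<Longrightarrow> \<sigma> (r \<otimes>\<^bsub>R\<^esub> s) = RR.p r s"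
  using \<sigma>_\<mu>[of "RR.p r s"] by (simp add: \<mu>_pure RR.pure_closed)

text \<open>\<open>\<mu>\<close> is left \<open>R\<close>-linear, and the inverse of a linear
  bijection is linear. The same argument serves the right action and the scalars.\<close>

lemma \<sigma>_lact:
  assumes "r \<in> carrier R" "s \<in> carrier R"
  shows "\<sigma> (r \<otimes>\<^bsub>R\<^esub> s) = r \<triangleright>\<^bsub>RR.T\<^esub> \<sigma> s"
proof -
  note la = RR.lact_additive[OF R_bimod assms(1)]
  have ra: "(\<lambda>x. r \<otimes>\<^bsub>R\<^esub> x) \<in> additive R R"
    using assms by (intro additiveI) (simp_all add: mult_closed mult_r_distr)
  have "\<mu> (r \<triangleright>\<^bsub>RR.T\<^esub> Z) = r \<otimes>\<^bsub>R\<^esub> \<mu> Z" if "Z \<in> carrier RR.T" for Z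
    by (rule RR.tensor_ext[OF additive_comp[OF la \<mu>_additive] additive_comp[OF \<mu>_additive ra] _ that])
      (use assms in \<open>simp_all add: RR.lact_pure[OF R_bimod] \<mu>_pure mult_closed mult_assoc\<close>)
  then have "\<mu> (r \<triangleright>\<^bsub>RR.T\<^esub> \<sigma> s) = r \<otimes>\<^bsub>R\<^esub> s"
    using assms by (simp add: \<sigma>_closed \<mu>_\<sigma>)
  then show ?thesis
    using \<sigma>_\<mu>[OF additive_closed[OF la \<sigma>_closed[OF assms(2)]]] by simp
qed

lemma \<sigma>_ract:
  assumes "r \<in> carrier R" "s \<in> carrier R"
  shows "\<sigma> (s \<otimes>\<^bsub>R\<^esub> r) = \<sigma> s \<triangleleft>\<^bsub>RR.T\<^esub> r"
proof -
  note la = RR.ract_additive[OF R_bimod assms(1)]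
  have ra: "(\<lambda>x. x \<otimes>\<^bsub>R\<^esub> r) \<in> additive R R"
    using assms by (intro additiveI) (simp_all add: mult_closed mult_l_distr)
  have "\<mu> (Z \<triangleleft>\<^bsub>RR.T\<^esub> r) = \<mu> Z \<otimes>\<^bsub>R\<^esub> r" if "Z \<in> carrier RR.T" for Z
    by (rule RR.tensor_ext[OF additive_comp[OF la \<mu>_additive] additive_comp[OF \<mu>_additive ra] _ that])
      (use assms in \<open>simp_all add: RR.ract_pure[OF R_bimod] \<mu>_pure mult_closed mult_assoc\<close>)
  then have "\<mu> (\<sigma> s \<triangleleft>\<^bsub>RR.T\<^esub> r) = s \<otimes>\<^bsub>R\<^esub> r"
    using assms by (simp add: \<sigma>_closed \<mu>_\<sigma>)
  then show ?thesis
    using \<sigma>_\<mu>[OF additive_closed[OF la \<sigma>_closed[OF assms(2)]]] by simp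
qed

lemma \<sigma>_smult:
  assumes "c \<in> carrier K" "s \<in> carrier R"
  shows "\<sigma> (c \<odot>\<^bsub>R\<^esub> s) = c \<odot>\<^bsub>RR.T\<^esub> \<sigma> s"
proof -
  note la = RR.smult_additive[OF assms(1)]
  have ra: "(\<lambda>x. c \<odot>\<^bsub>R\<^esub> x) \<in> additive R R"
    using assms by (intro additiveI) (simp_all add: smult_r_distr)
  have "\<mu> (c \<odot>\<^bsub>RR.T\<^esub> Z) = c \<odot>\<^bsub>R\<^esub> \<mu> Z" if "Z \<in> carrier RR.T" for Z
    by (rule RR.tensor_ext[OF additive_comp[OF la \<mu>_additive] additive_comp[OF \<mu>_additive ra] _ that])
      (use assms in \<open>simp_all add: RR.smult_pure \<mu>_pure smult_mult_l\<close>)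
  then have "\<mu> (c \<odot>\<^bsub>RR.T\<^esub> \<sigma> s) = c \<odot>\<^bsub>R\<^esub> s"
    using assms by (simp add: \<sigma>_closed \<mu>_\<sigma>)
  then show ?thesis
    using \<sigma>_\<mu>[OF additive_closed[OF la \<sigma>_closed[OF assms(2)]]] by simp
qed

end

section \<open>Firmness of \<open>R \<otimes> L\<close> for a firm ring \<open>R\<close>\<close>

locale firm_tensor = firm_ring K R + L: left_module K R L
  for K :: "('k, 'x) ring_scheme" (structure) and R :: "('k, 'r) module"
    and L :: "('k, 'm, 'r, 'a) bimod"
begin

sublocale P: tensor_pair K R "regular R" L ..

sublocale PL: left_module K R P.T by (rule P.left_module_tensor[OF R_bimod])

sublocale RP: tensor_pair K R "regular R" P.T ..

lemma balanced_firm_inner: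
  assumes x: "x \<in> carrier L"
  shows "balanced K R (regular R) (regular R) RP.T (\<lambda>s t. RP.p s (P.p t x))"
  using x
  by (intro balancedI additiveI)
    (simp_all add: RP.pure_closed P.pure_closed P.pure_add_l[simplified] RP.pure_add_l[simplified]
      RP.pure_add_r[simplified] RP.pure_smult[simplified] P.smult_pure RP.pure_act[simplified]
      P.lact_pure[OF R_bimod] mult_closed)

text \<open>For fixed \<open>x\<close>, the associativity map on tensors
  \<open>(s \<otimes> t) \<otimes> x\<close>. With \<open>\<sigma> r\<close> inserted it becomes the
  inverse of the action on \<open>P\<close>.\<close>

definition firm_inner where
  "firm_inner x = tensor_lift RP.T (\<lambda>(s, t). RP.p s (P.p t x))"

lemma firm_inner_additive: "x \<in> carrier L \<Longrightarrow> firm_inner x \<in> additive RR.T RP.T"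
  unfolding firm_inner_def
  by (rule RR.lift_additive[OF RP.abelian_group_tensor balanced_firm_inner])

lemma firm_inner_pure:
  "\<lbrakk>x \<in> carrier L; s \<in> carrier R; t \<in> carrier R\<rbrakk> \<Longrightarrow> firm_inner x (RR.p s t) = RP.p s (P.p t x)"
  unfolding firm_inner_def
  using RR.lift_pure[OF RP.abelian_group_tensor balanced_firm_inner] by simp

lemma balanced_firm: "balanced K R (regular R) L RP.T (\<lambda>r x. firm_inner x (\<sigma> r))"
proof (rule balancedI)
  fix x assume x: "x \<in> carrier L"
  have "(\<lambda>r. firm_inner x (\<sigma> r)) \<in> additive R RP.T"
    by (rule additive_comp[OF \<sigma>_additive firm_inner_additive[OF x]])
  then show "(\<lambda>r. firm_inner x (\<sigma> r)) \<in> additive (regular R) RP.T"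
    by (simp add: additive_def)
next
  fix r assume "r \<in> carrier (regular R)"
  then show "(\<lambda>x. firm_inner x (\<sigma> r)) \<in> additive L RP.T"
    unfolding firm_inner_def
    by (intro RR.lift_additive_param[OF RP.abelian_group_tensor balanced_firm_inner])
      (auto intro!: additiveI simp: P.pure_closed RP.pure_closed P.pure_add_r RP.pure_add_r
        L.mod.abelian_group_axioms \<sigma>_closed)
next
  fix c r x assume *: "c \<in> carrier K" "r \<in> carrier (regular R)" "x \<in> carrier L"
  have "firm_inner x (c \<odot>\<^bsub>RR.T\<^esub> Z) = firm_inner (c \<odot>\<^bsub>L\<^esub> x) Z" if "Z \<in> carrier RR.T" for Z
    by (rule RR.tensor_ext[OF additive_comp[OF RR.smult_additive firm_inner_additive]
          firm_inner_additive _ that])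
      (use * in \<open>simp_all add: RR.smult_pure firm_inner_pure RP.pure_smult[simplified]
        P.pure_closed P.smult_pure P.pure_smult[simplified]\<close>)
  then show "firm_inner x (\<sigma> (c \<odot>\<^bsub>regular R\<^esub> r)) = firm_inner (c \<odot>\<^bsub>L\<^esub> x) (\<sigma> r)"
    using * by (simp add: \<sigma>_smult \<sigma>_closed)
next
  fix u r x assume *: "u \<in> carrier R" "r \<in> carrier (regular R)" "x \<in> carrier L"
  \<comment> \<open>\<open>\<sigma>\<close> is right linear, so in \<open>r u\<close> the factor
    \<open>u\<close> ends up on the second tensor factor \<open>t\<close>, where
    \<open>t u \<otimes> x = t \<otimes> u x\<close>.\<close>
  have "firm_inner x (Z \<triangleleft>\<^bsub>RR.T\<^esub> u) = firm_inner (u \<triangleright>\<^bsub>L\<^esub> x) Z" if "Z \<in> carrier RR.T" for Z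
    by (rule RR.tensor_ext[OF additive_comp[OF RR.ract_additive[OF R_bimod] firm_inner_additive]
          firm_inner_additive _ that])
      (use * in \<open>simp_all add: RR.ract_pure[OF R_bimod] firm_inner_pure P.pure_act[simplified]
        mult_closed L.lact_closed\<close>)
  then show "firm_inner x (\<sigma> (r \<triangleleft>\<^bsub>regular R\<^esub> u)) = firm_inner (u \<triangleright>\<^bsub>L\<^esub> x) (\<sigma> r)"
    using * by (simp add: \<sigma>_ract \<sigma>_closed)
qed

lemma balanced_lact_P: "balanced K R (regular R) P.T P.T (\<lambda>r X. r \<triangleright>\<^bsub>P.T\<^esub> X)"
  by (intro balancedI additiveI)
    (simp_all add: PL.lact_closed PL.lact_add_l PL.lact_add_r PL.lact_smult_l PL.lact_smult_r
      PL.lact_assoc)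

lemma firm_left_module_tensor: "firm_left_module K R P.T"
proof (intro firm_left_module.intro firm_left_module_axioms.intro PL.left_module_axioms)
  let ?a = "tensor_lift P.T (\<lambda>(r, X). r \<triangleright>\<^bsub>P.T\<^esub> X)"
  let ?b = "tensor_lift RP.T (\<lambda>(r, x). firm_inner x (\<sigma> r))"
  note a = RP.lift_additive[OF P.abelian_group_tensor balanced_lact_P]
    RP.lift_pure[OF P.abelian_group_tensor balanced_lact_P, simplified]
  note b = P.lift_additive[OF RP.abelian_group_tensor balanced_firm]
    P.lift_pure[OF RP.abelian_group_tensor balanced_firm, simplified]
  have pa: "(\<lambda>r. P.p r x) \<in> additive R P.T" if "x \<in> carrier L" for x
    using that by (intro additiveI) (simp_all add: P.pure_closed P.pure_add_l[simplified])
  \<comment> \<open>The action after \<open>firm_inner\<close> is multiplication in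
    \<open>R\<close>; \<open>ab\<close> then reduces to
    \<open>\<mu> (\<sigma> r) = r\<close>.\<close>
  have ga: "?a (firm_inner x Z) = P.p (\<mu> Z) x" if "x \<in> carrier L" "Z \<in> carrier RR.T" for x Z
    by (rule RR.tensor_ext[OF additive_comp[OF firm_inner_additive a(1)]
          additive_comp[OF \<mu>_additive pa] _ that(2)])
      (use that(1) in \<open>simp_all add: firm_inner_pure a(2) P.pure_closed P.lact_pure[OF R_bimod] \<mu>_pure\<close>)
  have ba: "?b (?a W) = W" if "W \<in> carrier RP.T" for W
  proof (rule RP.tensor_ext[OF additive_comp[OF a(1) b(1)] additive_id _ that])
    fix s X assume s: "s \<in> carrier (regular R)" and X: "X \<in> carrier P.T"
    have rp: "RP.p s \<in> additive P.T RP.T"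
      using s by (intro additiveI) (simp_all add: RP.pure_closed RP.pure_add_r[simplified])
    \<comment> \<open>For \<open>X = r \<otimes> x\<close> the action gives
      \<open>s r \<otimes> x\<close>, and \<open>\<sigma> (s r)\<close> is exactly
      \<open>s \<otimes> r\<close>.\<close>
    have "?b (s \<triangleright>\<^bsub>P.T\<^esub> X) = RP.p s X"
      by (rule P.tensor_ext[OF additive_comp[OF P.lact_additive[OF R_bimod] b(1)] rp _ X])
        (use s in \<open>simp_all add: P.lact_pure[OF R_bimod] b(2) mult_closed \<sigma>_mult firm_inner_pure\<close>)
    then show "?b (?a (RP.p s X)) = RP.p s X"
      using s X by (simp add: a(2))
  qed
  have ab: "?a (?b X) = X" if "X \<in> carrier P.T" for X
    by (rule P.tensor_ext[OF additive_comp[OF b(1) a(1)] additive_id _ that])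
      (simp_all add: b(2) ga \<sigma>_closed \<mu>_\<sigma>)
  show "bij_betw ?a (carrier RP.T) (carrier P.T)"
    by (rule bij_betw_byWitness[where f' = ?b])
      (auto simp: ba ab additive_closed[OF a(1)] additive_closed[OF b(1)])
qed

end

section \<open>Duals and operators of finite rank\<close>

lemma dual_simps:
  "carrier (dual K A M) = right_hom K A M (regular A) \<inter> extensional (carrier M)"
  "ring.zero (dual K A M) = (\<lambda>x \<in> carrier M. \<zero>\<^bsub>A\<^esub>)"
  "\<xi> \<oplus>\<^bsub>dual K A M\<^esub> \<upsilon> = (\<lambda>x \<in> carrier M. \<xi> x \<oplus>\<^bsub>A\<^esub> \<upsilon> x)"
  "c \<odot>\<^bsub>dual K A M\<^esub> \<xi> = (\<lambda>x \<in> carrier M. c \<odot>\<^bsub>A\<^esub> \<xi> x)"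
  "a \<triangleright>\<^bsub>dual K A M\<^esub> \<xi> = (\<lambda>x \<in> carrier M. a \<otimes>\<^bsub>A\<^esub> \<xi> x)"
  by (simp_all add: dual_def)

lemma end_simps:
  "carrier (end_algebra K A M) = right_hom K A M M \<inter> extensional (carrier M)"
  "ring.zero (end_algebra K A M) = (\<lambda>x \<in> carrier M. \<zero>\<^bsub>M\<^esub>)"
  "f \<oplus>\<^bsub>end_algebra K A M\<^esub> g = (\<lambda>x \<in> carrier M. f x \<oplus>\<^bsub>M\<^esub> g x)"
  "f \<otimes>\<^bsub>end_algebra K A M\<^esub> g = compose (carrier M) f g"
  "c \<odot>\<^bsub>end_algebra K A M\<^esub> f = (\<lambda>x \<in> carrier M. c \<odot>\<^bsub>M\<^esub> f x)"
  by (simp_all add: end_algebra_def)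

lemma dualD:
  assumes "\<xi> \<in> carrier (dual K A M)"
  shows "\<And>x. x \<in> carrier M \<Longrightarrow> \<xi> x \<in> carrier A"
    and "\<And>x y. \<lbrakk>x \<in> carrier M; y \<in> carrier M\<rbrakk> \<Longrightarrow> \<xi> (x \<oplus>\<^bsub>M\<^esub> y) = \<xi> x \<oplus>\<^bsub>A\<^esub> \<xi> y"
    and "\<And>c x. \<lbrakk>c \<in> carrier K; x \<in> carrier M\<rbrakk> \<Longrightarrow> \<xi> (c \<odot>\<^bsub>M\<^esub> x) = c \<odot>\<^bsub>A\<^esub> \<xi> x"
    and "\<And>a x. \<lbrakk>a \<in> carrier A; x \<in> carrier M\<rbrakk> \<Longrightarrow> \<xi> (x \<triangleleft>\<^bsub>M\<^esub> a) = \<xi> x \<otimes>\<^bsub>A\<^esub> a"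
    and "\<xi> \<in> extensional (carrier M)"
  using assms by (auto simp: dual_simps right_hom_def)

context right_module begin

lemma dualI:
  assumes "\<And>x. x \<in> carrier M \<Longrightarrow> \<xi> x \<in> carrier R"
    and "\<And>x y. \<lbrakk>x \<in> carrier M; y \<in> carrier M\<rbrakk> \<Longrightarrow> \<xi> (x \<oplus>\<^bsub>M\<^esub> y) = \<xi> x \<oplus>\<^bsub>R\<^esub> \<xi> y"
    and "\<And>c x. \<lbrakk>c \<in> carrier K; x \<in> carrier M\<rbrakk> \<Longrightarrow> \<xi> (c \<odot>\<^bsub>M\<^esub> x) = c \<odot>\<^bsub>R\<^esub> \<xi> x"
    and "\<And>a x. \<lbrakk>a \<in> carrier R; x \<in> carrier M\<rbrakk> \<Longrightarrow> \<xi> (x \<triangleleft>\<^bsub>M\<^esub> a) = \<xi> x \<otimes>\<^bsub>R\<^esub> a"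
  shows "restrict \<xi> (carrier M) \<in> carrier (dual K R M)"
  using assms by (simp add: dual_simps right_hom_def ract_closed)

lemma dual_eqI:
  assumes "\<xi> \<in> carrier (dual K R M)" "\<upsilon> \<in> carrier (dual K R M)"
    and "\<And>x. x \<in> carrier M \<Longrightarrow> \<xi> x = \<upsilon> x"
  shows "\<xi> = \<upsilon>"
  using assms by (auto simp: dual_simps intro: extensionalityI)

lemma dual_add_closed:
  "\<lbrakk>\<xi> \<in> carrier (dual K R M); \<upsilon> \<in> carrier (dual K R M)\<rbrakk> \<Longrightarrow> \<xi> \<oplus>\<^bsub>dual K R M\<^esub> \<upsilon> \<in> carrier (dual K R M)"
  unfolding dual_simps(3)
  by (rule dualI) (simp_all add: dualD alg.M.a_ac alg.smult_r_distr alg.mult_l_distr alg.mult_closed)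

lemma dual_smult_closed:
  "\<lbrakk>c \<in> carrier K; \<xi> \<in> carrier (dual K R M)\<rbrakk> \<Longrightarrow> c \<odot>\<^bsub>dual K R M\<^esub> \<xi> \<in> carrier (dual K R M)"
  unfolding dual_simps(4)
  by (rule dualI)
    (simp_all add: dualD alg.smult_r_distr alg.smult_mult_l alg.smult_assoc1[symmetric] alg.R.m_comm)

lemma dual_lact_closed:
  "\<lbrakk>a \<in> carrier R; \<xi> \<in> carrier (dual K R M)\<rbrakk> \<Longrightarrow> a \<triangleright>\<^bsub>dual K R M\<^esub> \<xi> \<in> carrier (dual K R M)"
  unfolding dual_simps(5)
  by (rule dualI) (simp_all add: dualD alg.mult_closed alg.mult_r_distr alg.smult_mult_r alg.mult_assoc)

lemma module_dual: "module K (dual K R M)"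
proof (intro moduleI abelian_groupI)
  note [simp] = dual_add_closed dual_smult_closed dualD
  note e = dual_eqI
  show z: "\<zero>\<^bsub>dual K R M\<^esub> \<in> carrier (dual K R M)"
    unfolding dual_simps(2)
    by (rule dualI) (simp_all, metis alg.M.zero_closed alg.M.l_zero alg.M.add.l_cancel_one' alg.mult_closed alg.mult_l_distr)
  fix \<xi> assume \<xi>: "\<xi> \<in> carrier (dual K R M)"
  show "\<zero>\<^bsub>dual K R M\<^esub> \<oplus>\<^bsub>dual K R M\<^esub> \<xi> = \<xi>"
    by (rule dual_eqI) (use \<xi> z in simp_all, simp add: dual_simps)
  show "\<exists>\<upsilon>\<in>carrier (dual K R M). \<upsilon> \<oplus>\<^bsub>dual K R M\<^esub> \<xi> = \<zero>\<^bsub>dual K R M\<^esub>"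
  proof (rule bexI)
    \<comment> \<open>The negative is taken as \<open>(-1) \<xi>\<close>, which lies in the dual by
      closure under scalars.\<close>
    show c: "(\<ominus> \<one>) \<odot>\<^bsub>dual K R M\<^esub> \<xi> \<in> carrier (dual K R M)" using \<xi> by simp
    show "(\<ominus> \<one>) \<odot>\<^bsub>dual K R M\<^esub> \<xi> \<oplus>\<^bsub>dual K R M\<^esub> \<xi> = \<zero>\<^bsub>dual K R M\<^esub>"
      by (rule dual_eqI) (use \<xi> z c in simp_all, simp add: dual_simps alg.smult_l_minus alg.M.l_neg)
  qed
  show "\<one> \<odot>\<^bsub>dual K R M\<^esub> \<xi> = \<xi>"
    by (rule dual_eqI) (use \<xi> in simp_all, simp add: dual_simps)
next
  note [simp] = dual_add_closed dual_smult_closed dualD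
  fix a b \<xi> assume *: "a \<in> carrier K" "b \<in> carrier K" "\<xi> \<in> carrier (dual K R M)"
  show "(a \<oplus> b) \<odot>\<^bsub>dual K R M\<^esub> \<xi> = a \<odot>\<^bsub>dual K R M\<^esub> \<xi> \<oplus>\<^bsub>dual K R M\<^esub> b \<odot>\<^bsub>dual K R M\<^esub> \<xi>"
    by (rule dual_eqI) (use * in simp_all, simp add: dual_simps alg.smult_l_distr)
  show "a \<otimes> b \<odot>\<^bsub>dual K R M\<^esub> \<xi> = a \<odot>\<^bsub>dual K R M\<^esub> (b \<odot>\<^bsub>dual K R M\<^esub> \<xi>)"
    by (rule dual_eqI) (use * in simp_all, simp add: dual_simps alg.smult_assoc1)
next
  note [simp] = dual_add_closed dual_smult_closed dualD
  fix a \<xi> \<upsilon> assume *: "a \<in> carrier K" "\<xi> \<in> carrier (dual K R M)" "\<upsilon> \<in> carrier (dual K R M)"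
  show "a \<odot>\<^bsub>dual K R M\<^esub> (\<xi> \<oplus>\<^bsub>dual K R M\<^esub> \<upsilon>) = a \<odot>\<^bsub>dual K R M\<^esub> \<xi> \<oplus>\<^bsub>dual K R M\<^esub> a \<odot>\<^bsub>dual K R M\<^esub> \<upsilon>"
    by (rule dual_eqI) (use * in simp_all, simp add: dual_simps alg.smult_r_distr)
next
  note [simp] = dual_add_closed dual_smult_closed dualD
  fix \<xi> \<upsilon> \<zeta> assume *: "\<xi> \<in> carrier (dual K R M)" "\<upsilon> \<in> carrier (dual K R M)" "\<zeta> \<in> carrier (dual K R M)"
  show "\<xi> \<oplus>\<^bsub>dual K R M\<^esub> \<upsilon> \<oplus>\<^bsub>dual K R M\<^esub> \<zeta> = \<xi> \<oplus>\<^bsub>dual K R M\<^esub> (\<upsilon> \<oplus>\<^bsub>dual K R M\<^esub> \<zeta>)"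
    by (rule dual_eqI) (use * in simp_all, simp add: dual_simps alg.M.a_assoc)
next
  note [simp] = dual_add_closed dual_smult_closed dualD
  fix \<xi> \<upsilon> assume *: "\<xi> \<in> carrier (dual K R M)" "\<upsilon> \<in> carrier (dual K R M)"
  show "\<xi> \<oplus>\<^bsub>dual K R M\<^esub> \<upsilon> = \<upsilon> \<oplus>\<^bsub>dual K R M\<^esub> \<xi>"
    by (rule dual_eqI) (use * in simp_all, simp add: dual_simps alg.M.a_comm)
qed (simp_all add: dual_add_closed dual_smult_closed alg.R.cring_axioms)

lemma left_module_dual: "left_module K R (dual K R M)"
proof (intro left_module.intro left_module_axioms.intro alg.nu_algebra_axioms module_dual)
  note [simp] = dual_add_closed dual_smult_closed dualD dual_lact_closed alg.mult_closed
  fix r s \<xi> assume *: "r \<in> carrier R" "s \<in> carrier R" "\<xi> \<in> carrier (dual K R M)"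
  show "(r \<oplus>\<^bsub>R\<^esub> s) \<triangleright>\<^bsub>dual K R M\<^esub> \<xi> = r \<triangleright>\<^bsub>dual K R M\<^esub> \<xi> \<oplus>\<^bsub>dual K R M\<^esub> s \<triangleright>\<^bsub>dual K R M\<^esub> \<xi>"
    by (rule dual_eqI) (use * in simp_all, simp add: dual_simps alg.mult_l_distr)
  show "(r \<otimes>\<^bsub>R\<^esub> s) \<triangleright>\<^bsub>dual K R M\<^esub> \<xi> = r \<triangleright>\<^bsub>dual K R M\<^esub> (s \<triangleright>\<^bsub>dual K R M\<^esub> \<xi>)"
    by (rule dual_eqI) (use * in simp_all, simp add: dual_simps alg.mult_assoc)
next
  note [simp] = dual_add_closed dual_smult_closed dualD dual_lact_closed alg.mult_closed
  fix r \<xi> \<upsilon> assume *: "r \<in> carrier R" "\<xi> \<in> carrier (dual K R M)" "\<upsilon> \<in> carrier (dual K R M)"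
  show "r \<triangleright>\<^bsub>dual K R M\<^esub> (\<xi> \<oplus>\<^bsub>dual K R M\<^esub> \<upsilon>) = r \<triangleright>\<^bsub>dual K R M\<^esub> \<xi> \<oplus>\<^bsub>dual K R M\<^esub> r \<triangleright>\<^bsub>dual K R M\<^esub> \<upsilon>"
    by (rule dual_eqI) (use * in simp_all, simp add: dual_simps alg.mult_r_distr)
next
  note [simp] = dual_add_closed dual_smult_closed dualD dual_lact_closed alg.mult_closed
  fix c r \<xi> assume *: "c \<in> carrier K" "r \<in> carrier R" "\<xi> \<in> carrier (dual K R M)"
  show "(c \<odot>\<^bsub>R\<^esub> r) \<triangleright>\<^bsub>dual K R M\<^esub> \<xi> = c \<odot>\<^bsub>dual K R M\<^esub> (r \<triangleright>\<^bsub>dual K R M\<^esub> \<xi>)"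
    by (rule dual_eqI) (use * in simp_all, simp add: dual_simps alg.smult_mult_l)
  show "r \<triangleright>\<^bsub>dual K R M\<^esub> (c \<odot>\<^bsub>dual K R M\<^esub> \<xi>) = c \<odot>\<^bsub>dual K R M\<^esub> (r \<triangleright>\<^bsub>dual K R M\<^esub> \<xi>)"
    by (rule dual_eqI) (use * in simp_all, simp add: dual_simps alg.smult_mult_r)
qed (simp add: dual_lact_closed)

sublocale D: tensor_pair K R M "dual K R M"
  by (intro tensor_pair.intro right_module_axioms left_module_dual)

text \<open>The connecting map \<open>M \<otimes> M^* \<rightarrow> End(M)\<close>, evaluated at a
  point. The point comes first so that \<open>ev y\<close> is an additive map on the tensor product;
  operators are compared pointwise.\<close>

definition ev where
  "ev y = tensor_lift M (\<lambda>(x, \<xi>). x \<triangleleft>\<^bsub>M\<^esub> \<xi> y)"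

lemma balanced_ev:
  assumes y: "y \<in> carrier M"
  shows "balanced K R M (dual K R M) M (\<lambda>x \<xi>. x \<triangleleft>\<^bsub>M\<^esub> \<xi> y)"
  using y
  by (intro balancedI additiveI)
    (simp_all add: dualD ract_closed ract_add_l, simp_all add: dual_simps(3-5) dualD
      ract_add_r ract_smult_l ract_smult_r ract_assoc)

lemma ev_additive: "y \<in> carrier M \<Longrightarrow> ev y \<in> additive D.T M"
  unfolding ev_def by (rule D.lift_additive[OF mod.abelian_group_axioms balanced_ev])

lemma ev_pure:
  "\<lbrakk>y \<in> carrier M; x \<in> carrier M; \<xi> \<in> carrier (dual K R M)\<rbrakk> \<Longrightarrow> ev y (D.p x \<xi>) = x \<triangleleft>\<^bsub>M\<^esub> \<xi> y"
  unfolding ev_def by (rule D.lift_pure[OF mod.abelian_group_axioms balanced_ev])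

lemma ev_closed: "\<lbrakk>y \<in> carrier M; X \<in> carrier D.T\<rbrakk> \<Longrightarrow> ev y X \<in> carrier M"
  using additive_closed[OF ev_additive] .

lemma ev_right_hom:
  assumes X: "X \<in> carrier D.T"
  shows "(\<lambda>y. ev y X) \<in> right_hom K R M M"
proof (rule right_homI)
  show "(\<lambda>y. ev y X) \<in> additive M M"
    unfolding ev_def
    by (rule D.lift_additive_param[OF mod.abelian_group_axioms balanced_ev _ mod.abelian_group_axioms X])
      (auto intro!: additiveI simp: dualD ract_closed ract_add_r)
  have sa: "smult M c \<in> additive M M" if "c \<in> carrier K" for c
    using that by (intro additiveI) (simp_all add: mod.smult_r_distr)
  show "ev (c \<odot>\<^bsub>M\<^esub> y) X = c \<odot>\<^bsub>M\<^esub> ev y X" if "c \<in> carrier K" "y \<in> carrier M" for c y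
    by (rule D.tensor_ext[OF ev_additive additive_comp[OF ev_additive sa] _ X])
      (use that in \<open>simp_all add: ev_pure dualD ract_smult_r\<close>)
  have ra: "(\<lambda>x. x \<triangleleft>\<^bsub>M\<^esub> a) \<in> additive M M" if "a \<in> carrier R" for a
    using that by (intro additiveI) (simp_all add: ract_closed ract_add_l)
  show "ev (y \<triangleleft>\<^bsub>M\<^esub> a) X = ev y X \<triangleleft>\<^bsub>M\<^esub> a" if "a \<in> carrier R" "y \<in> carrier M" for a y
    by (rule D.tensor_ext[OF ev_additive additive_comp[OF ev_additive ra] _ X])
      (use that in \<open>simp_all add: ev_pure dualD ract_assoc ract_closed\<close>)
qed

text \<open>The sums in \<open>finite_rank_algebra\<close> are taken in this group; the group laws
  allow them to be evaluated pointwise by \<open>additive_finsum\<close>.\<close>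

lemma abelian_group_end: "abelian_group (end_algebra K R M)"
proof (rule abelian_groupI)
  have c: "f \<oplus>\<^bsub>end_algebra K R M\<^esub> g \<in> carrier (end_algebra K R M)"
    if "f \<in> carrier (end_algebra K R M)" "g \<in> carrier (end_algebra K R M)" for f g
    using that unfolding end_simps by (auto intro!: right_homI additiveI
      simp: right_homD mod.M.a_ac mod.smult_r_distr ract_add_l ract_closed)
  show "f \<oplus>\<^bsub>end_algebra K R M\<^esub> g \<in> carrier (end_algebra K R M)"
    if "f \<in> carrier (end_algebra K R M)" "g \<in> carrier (end_algebra K R M)" for f g
    by (rule c) fact+
  show "\<exists>g\<in>carrier (end_algebra K R M). g \<oplus>\<^bsub>end_algebra K R M\<^esub> f = \<zero>\<^bsub>end_algebra K R M\<^esub>"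
    if "f \<in> carrier (end_algebra K R M)" for f
  proof (rule bexI)
    show "(\<lambda>x \<in> carrier M. (\<ominus> \<one>) \<odot>\<^bsub>M\<^esub> f x) \<in> carrier (end_algebra K R M)"
      using that unfolding end_simps by (auto intro!: right_homI additiveI
        simp: right_homD mod.smult_r_distr mod.smult_assoc1[symmetric] alg.R.m_comm ract_smult_l ract_closed)
  qed (use that in \<open>auto simp: end_simps right_homD mod.smult_l_minus mod.M.l_neg intro!: ext\<close>)
  show "\<zero>\<^bsub>end_algebra K R M\<^esub> \<in> carrier (end_algebra K R M)"
    unfolding end_simps by (auto intro!: right_homI additiveI simp: ract_closed)
      (metis mod.M.zero_closed mod.M.l_zero mod.M.add.l_cancel_one' ract_closed ract_add_l)
  show "\<zero>\<^bsub>end_algebra K R M\<^esub> \<oplus>\<^bsub>end_algebra K R M\<^esub> f = f"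
    if "f \<in> carrier (end_algebra K R M)" for f
    by (rule ext) (use that in \<open>auto simp: end_simps right_homD extensional_def\<close>)
qed (auto simp: end_simps right_homD mod.M.a_ac intro!: ext)

lemma rank_one_end:
  assumes "x \<in> carrier M" "\<xi> \<in> carrier (dual K R M)"
  shows "(\<lambda>y \<in> carrier M. x \<triangleleft>\<^bsub>M\<^esub> \<xi> y) \<in> carrier (end_algebra K R M)"
  using assms unfolding end_simps
  by (auto intro!: right_homI additiveI simp: dualD ract_closed ract_add_r ract_smult_r ract_assoc)

lemma eval_end_additive: "y \<in> carrier M \<Longrightarrow> (\<lambda>f. f y) \<in> additive (end_algebra K R M) M"
  by (auto intro!: additiveI simp: end_simps right_homD)

lemma finite_rank_end: "carrier (finite_rank_algebra K R M) \<subseteq> carrier (end_algebra K R M)"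
proof -
  interpret E: abelian_group "end_algebra K R M" by (rule abelian_group_end)
  show ?thesis
    unfolding finite_rank_algebra_def by (auto intro!: E.finsum_closed rank_one_end)
qed

lemma finite_rankE:
  assumes "f \<in> carrier (finite_rank_algebra K R M)"
  obtains n :: nat and x \<xi> where "x \<in> {..<n} \<rightarrow> carrier M" "\<xi> \<in> {..<n} \<rightarrow> carrier (dual K R M)"
    and "\<And>y. y \<in> carrier M \<Longrightarrow> f y = (\<Oplus>\<^bsub>M\<^esub>i \<in> {..<n}. x i \<triangleleft>\<^bsub>M\<^esub> \<xi> i y)"
proof -
  obtain n :: nat and x \<xi> where x: "x \<in> {..<n} \<rightarrow> carrier M" "\<xi> \<in> {..<n} \<rightarrow> carrier (dual K R M)"
    and f: "f = (\<Oplus>\<^bsub>end_algebra K R M\<^esub>i \<in> {..<n}. (\<lambda>y \<in> carrier M. x i \<triangleleft>\<^bsub>M\<^esub> \<xi> i y))"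
    using assms by (auto simp: finite_rank_algebra_def)
  have "f y = (\<Oplus>\<^bsub>M\<^esub>i \<in> {..<n}. x i \<triangleleft>\<^bsub>M\<^esub> \<xi> i y)" if y: "y \<in> carrier M" for y
  proof -
    have "f y = (\<Oplus>\<^bsub>M\<^esub>i \<in> {..<n}. (\<lambda>y \<in> carrier M. x i \<triangleleft>\<^bsub>M\<^esub> \<xi> i y) y)"
      unfolding f using x
      by (intro additive_finsum[OF abelian_group_end mod.abelian_group_axioms eval_end_additive[OF y]])
        (auto intro!: rank_one_end)
    then show ?thesis using y by simp
  qed
  with x show thesis by (rule that)
qed

text \<open>Surjectivity of the connecting map onto the finite rank operators: the terms
  \<open>x_i \<xi>_i(-)\<close> of a representation become pure tensors. The element
  \<open>X\<close> is in general not unique.\<close>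

lemma finite_rank_ev:
  assumes "f \<in> carrier (finite_rank_algebra K R M)"
  obtains X where "X \<in> carrier D.T" "\<And>y. y \<in> carrier M \<Longrightarrow> ev y X = f y"
proof -
  interpret T: abelian_group D.T by (rule D.abelian_group_tensor)
  obtain n :: nat and x \<xi> where x: "x \<in> {..<n} \<rightarrow> carrier M" "\<xi> \<in> {..<n} \<rightarrow> carrier (dual K R M)"
    and f: "\<And>y. y \<in> carrier M \<Longrightarrow> f y = (\<Oplus>\<^bsub>M\<^esub>i \<in> {..<n}. x i \<triangleleft>\<^bsub>M\<^esub> \<xi> i y)"
    by (rule finite_rankE[OF assms]; rule that)
  have p: "(\<lambda>i. D.p (x i) (\<xi> i)) \<in> {..<n} \<rightarrow> carrier D.T"
    using x by (auto intro!: D.pure_closed)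
  show thesis
  proof (rule that)
    show "(\<Oplus>\<^bsub>D.T\<^esub>i \<in> {..<n}. D.p (x i) (\<xi> i)) \<in> carrier D.T"
      using p by (rule T.finsum_closed)
    fix y assume y: "y \<in> carrier M"
    have "ev y (\<Oplus>\<^bsub>D.T\<^esub>i \<in> {..<n}. D.p (x i) (\<xi> i)) = (\<Oplus>\<^bsub>M\<^esub>i \<in> {..<n}. ev y (D.p (x i) (\<xi> i)))"
      using p by (intro additive_finsum[OF D.abelian_group_tensor mod.abelian_group_axioms ev_additive[OF y]]) auto
    also have "\<dots> = f y"
      unfolding f[OF y] using x y
      by (intro mod.M.finsum_cong') (auto simp: ev_pure Pi_def ract_closed dualD)
    finally show "ev y (\<Oplus>\<^bsub>D.T\<^esub>i \<in> {..<n}. D.p (x i) (\<xi> i)) = f y" .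
  qed
qed

end

section \<open>The product on \<open>M \<otimes> M^*\<close>\<close>

context right_module begin

lemma balanced_dual_mult_inner:
  assumes "x \<in> carrier M" "\<xi> \<in> carrier (dual K R M)"
  shows "balanced K R M (dual K R M) D.T (\<lambda>y \<upsilon>. D.p (x \<triangleleft>\<^bsub>M\<^esub> \<xi> y) \<upsilon>)"
  using assms
  by (intro balancedI additiveI)
    (simp_all add: D.pure_closed dualD ract_closed D.N.lact_closed D.pure_add_r ract_add_r D.pure_add_l
      ract_smult_r D.pure_smult ract_assoc D.pure_act)

definition dual_mult where
  "dual_mult X Y = tensor_lift D.T (\<lambda>(x, \<xi>). tensor_lift D.T (\<lambda>(y, \<upsilon>). D.p (x \<triangleleft>\<^bsub>M\<^esub> \<xi> y) \<upsilon>) Y) X"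

lemma balanced_dual_mult:
  assumes Y: "Y \<in> carrier D.T"
  shows "balanced K R M (dual K R M) D.T
    (\<lambda>x \<xi>. tensor_lift D.T (\<lambda>(y, \<upsilon>). D.p (x \<triangleleft>\<^bsub>M\<^esub> \<xi> y) \<upsilon>) Y)"
proof (rule balancedI)
  note ab = D.abelian_group_tensor
  note li = D.lift_additive[OF ab balanced_dual_mult_inner] D.lift_pure[OF ab balanced_dual_mult_inner]
  note [simp] = D.pure_closed dualD ract_closed D.pure_add_l ract_add_l D.N.lact_closed
  show "(\<lambda>x. tensor_lift D.T (\<lambda>(y, \<upsilon>). D.p (x \<triangleleft>\<^bsub>M\<^esub> \<xi> y) \<upsilon>) Y) \<in> additive M D.T"
    if "\<xi> \<in> carrier (dual K R M)" for \<xi>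
    by (rule D.lift_additive_param[OF ab balanced_dual_mult_inner _ mod.abelian_group_axioms Y])
      (use that in \<open>auto intro!: additiveI\<close>)
  show "(\<lambda>\<xi>. tensor_lift D.T (\<lambda>(y, \<upsilon>). D.p (x \<triangleleft>\<^bsub>M\<^esub> \<xi> y) \<upsilon>) Y) \<in> additive (dual K R M) D.T"
    if "x \<in> carrier M" for x
    by (rule D.lift_additive_param[OF ab balanced_dual_mult_inner _ D.N.mod.abelian_group_axioms Y])
      (use that in \<open>auto intro!: additiveI simp: dual_simps(3) ract_add_r\<close>)
  show "tensor_lift D.T (\<lambda>(y, \<upsilon>). D.p ((c \<odot>\<^bsub>M\<^esub> x) \<triangleleft>\<^bsub>M\<^esub> \<xi> y) \<upsilon>) Y
      = tensor_lift D.T (\<lambda>(y, \<upsilon>). D.p (x \<triangleleft>\<^bsub>M\<^esub> (c \<odot>\<^bsub>dual K R M\<^esub> \<xi>) y) \<upsilon>) Y"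
    if "c \<in> carrier K" "x \<in> carrier M" "\<xi> \<in> carrier (dual K R M)" for c x \<xi>
    by (rule D.tensor_ext[OF li(1) li(1) _ Y])
      (use that in \<open>simp_all add: li(2)\<close>, simp add: dual_simps(4) ract_smult_l ract_smult_r)
  show "tensor_lift D.T (\<lambda>(y, \<upsilon>). D.p ((x \<triangleleft>\<^bsub>M\<^esub> a) \<triangleleft>\<^bsub>M\<^esub> \<xi> y) \<upsilon>) Y
      = tensor_lift D.T (\<lambda>(y, \<upsilon>). D.p (x \<triangleleft>\<^bsub>M\<^esub> (a \<triangleright>\<^bsub>dual K R M\<^esub> \<xi>) y) \<upsilon>) Y"
    if "a \<in> carrier R" "x \<in> carrier M" "\<xi> \<in> carrier (dual K R M)" for a x \<xi>
    by (rule D.tensor_ext[OF li(1) li(1) _ Y])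
      (use that in \<open>simp_all add: li(2)\<close>, simp add: dual_simps(5) ract_assoc)
qed

text \<open>The left factor enters a product only through the operator it induces: in
  \<open>x \<xi>(y) \<otimes> \<upsilon>\<close>, the vector \<open>x \<xi>(y)\<close> is the value
  at \<open>y\<close> of the operator of \<open>x \<otimes> \<xi>\<close>.\<close>

lemma dual_mult_pure_right:
  assumes "X \<in> carrier D.T" "y \<in> carrier M" "\<upsilon> \<in> carrier (dual K R M)"
  shows "dual_mult X (D.p y \<upsilon>) = D.p (ev y X) \<upsilon>"
proof -
  have pa: "(\<lambda>x. D.p x \<upsilon>) \<in> additive M D.T"
    using assms(3) by (intro additiveI) (simp_all add: D.pure_closed D.pure_add_l)
  show ?thesis
    unfolding dual_mult_def
    by (rule D.tensor_ext[OF D.lift_additive[OF D.abelian_group_tensor balanced_dual_mult]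
          additive_comp[OF ev_additive pa] _ assms(1)])
      (use assms in \<open>simp_all add: D.pure_closed D.lift_pure[OF D.abelian_group_tensor balanced_dual_mult]
        D.lift_pure[OF D.abelian_group_tensor balanced_dual_mult_inner] ev_pure\<close>)
qed

lemma dual_mult_additive_right:
  assumes X: "X \<in> carrier D.T"
  shows "dual_mult X \<in> additive D.T D.T"
  unfolding dual_mult_def[abs_def]
  by (rule D.lift_additive_param[OF D.abelian_group_tensor balanced_dual_mult
        D.lift_additive[OF D.abelian_group_tensor balanced_dual_mult_inner] D.abelian_group_tensor X])

lemma dual_tensor_algebra_simps:
  "carrier (dual_tensor_algebra K R M) = carrier D.T"
  "add (dual_tensor_algebra K R M) = add D.T"
  "ring.zero (dual_tensor_algebra K R M) = ring.zero D.T"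
  "smult (dual_tensor_algebra K R M) = smult D.T"
  "X \<otimes>\<^bsub>dual_tensor_algebra K R M\<^esub> Y = dual_mult X Y"
  by (simp_all add: dual_tensor_algebra_def Let_def module.defs dual_mult_def)

end

section \<open>Firm projectivity\<close>

text \<open>\<open>L\<close> stands for \<open>\<Sigma>\<close> with the action through
  \<open>\<iota>\<close>. The action is restricted to the carrier because members of
  \<open>finite_rank_algebra\<close> are extensional.\<close>

locale firm_finite_rank = firm_tensor K R L + B: bimodule K R A L
  for K :: "('k, 'x) ring_scheme" (structure) and R :: "('k, 'r) module"
    and A :: "('k, 'a) module" and L :: "('k, 'm, 'r, 'a) bimod" +
  assumes finite_rank:
    "r \<in> carrier R \<Longrightarrow> (\<lambda>x \<in> carrier L. r \<triangleright>\<^bsub>L\<^esub> x) \<in> carrier (finite_rank_algebra K A L)"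
begin

sublocale PB: bimodule K R A P.T
  by (rule P.bimodule_tensor[OF R_bimod B.bimodule_axioms])

abbreviation "D \<equiv> tensor K A L (dual K A L)"
abbreviation "Q \<equiv> tensor K A P.T (dual K A P.T)"

text \<open>The functional \<open>\<xi>'\<close> of the overview, i.e. the pullback of
  \<open>\<xi>\<close> along the action \<open>R \<otimes> L \<rightarrow> L\<close>; restricted
  because functionals in \<open>dual\<close> are extensional.\<close>

definition tilde where
  "tilde \<xi> = restrict (tensor_lift A (\<lambda>(u, z). \<xi> (u \<triangleright>\<^bsub>L\<^esub> z))) (carrier P.T)"

lemma A_group: "abelian_group A"
  by (rule B.right.alg.M.abelian_group_axioms)

lemma balanced_tilde:
  "\<xi> \<in> carrier (dual K A L) \<Longrightarrow> balanced K R (regular R) L A (\<lambda>u z. \<xi> (u \<triangleright>\<^bsub>L\<^esub> z))"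
  by (intro balancedI additiveI)
    (simp_all add: dualD L.lact_closed L.lact_add_l L.lact_add_r L.lact_smult_l
      L.lact_smult_r L.lact_assoc)

lemma tilde_lift_additive:
  "\<xi> \<in> carrier (dual K A L) \<Longrightarrow> tensor_lift A (\<lambda>(u, z). \<xi> (u \<triangleright>\<^bsub>L\<^esub> z)) \<in> additive P.T A"
  by (rule P.lift_additive[OF A_group balanced_tilde])

lemma tilde_lift_pure:
  "\<lbrakk>\<xi> \<in> carrier (dual K A L); u \<in> carrier R; z \<in> carrier L\<rbrakk> \<Longrightarrow>
    tensor_lift A (\<lambda>(u, z). \<xi> (u \<triangleright>\<^bsub>L\<^esub> z)) (P.p u z) = \<xi> (u \<triangleright>\<^bsub>L\<^esub> z)"
  using P.lift_pure[OF A_group balanced_tilde] by simp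

lemma pure_ract_P:
  "\<lbrakk>a \<in> carrier A; u \<in> carrier R; z \<in> carrier L\<rbrakk> \<Longrightarrow> P.p u z \<triangleleft>\<^bsub>P.T\<^esub> a = P.p u (z \<triangleleft>\<^bsub>L\<^esub> a)"
  by (rule P.ract_pure[OF B.bimodule_axioms]) simp_all

lemma tilde_closed:
  assumes "\<xi> \<in> carrier (dual K A L)"
  shows "tilde \<xi> \<in> carrier (dual K A P.T)"
  unfolding tilde_def
proof (rule PB.right.dualI)
  let ?t = "tensor_lift A (\<lambda>(u, z). \<xi> (u \<triangleright>\<^bsub>L\<^esub> z))"
  note ta = tilde_lift_additive[OF assms] and tp = tilde_lift_pure[OF assms]
  note [simp] = dualD[OF assms] L.lact_closed B.right.ract_closed
  have sa: "smult A c \<in> additive A A" if "c \<in> carrier K" for c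
    using that by (intro additiveI) (simp_all add: B.right.alg.smult_r_distr)
  have ra: "(\<lambda>x. x \<otimes>\<^bsub>A\<^esub> a) \<in> additive A A" if "a \<in> carrier A" for a
    using that by (intro additiveI) (simp_all add: B.right.alg.mult_closed B.right.alg.mult_l_distr)
  show "?t (c \<odot>\<^bsub>P.T\<^esub> X) = c \<odot>\<^bsub>A\<^esub> ?t X" if "c \<in> carrier K" "X \<in> carrier P.T" for c X
    by (rule P.tensor_ext[OF additive_comp[OF P.smult_additive ta] additive_comp[OF ta sa] _ that(2)])
      (use that(1) in \<open>simp_all add: P.smult_pure tp L.lact_smult_l\<close>)
  show "?t (X \<triangleleft>\<^bsub>P.T\<^esub> a) = ?t X \<otimes>\<^bsub>A\<^esub> a" if "a \<in> carrier A" "X \<in> carrier P.T" for a X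
    by (rule P.tensor_ext[OF additive_comp[OF P.ract_additive[OF B.bimodule_axioms] ta]
          additive_comp[OF ta ra] _ that(2)])
      (use that(1) in \<open>simp_all add: pure_ract_P tp B.lact_ract[symmetric]\<close>)
qed (simp_all add: additive_closed[OF tilde_lift_additive[OF assms]]
    additive_add[OF tilde_lift_additive[OF assms]])

lemma tilde_pure:
  "\<lbrakk>\<xi> \<in> carrier (dual K A L); u \<in> carrier R; z \<in> carrier L\<rbrakk> \<Longrightarrow> tilde \<xi> (P.p u z) = \<xi> (u \<triangleright>\<^bsub>L\<^esub> z)"
  by (simp add: tilde_def P.pure_closed tilde_lift_pure)

lemma dual_P_eqI:
  assumes "\<xi> \<in> carrier (dual K A P.T)" "\<upsilon> \<in> carrier (dual K A P.T)"
    and "\<And>u z. \<lbrakk>u \<in> carrier R; z \<in> carrier L\<rbrakk> \<Longrightarrow> \<xi> (P.p u z) = \<upsilon> (P.p u z)"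
  shows "\<xi> = \<upsilon>"
proof (rule PB.right.dual_eqI[OF assms(1,2)])
  have "\<xi> \<in> additive P.T A" "\<upsilon> \<in> additive P.T A"
    using assms(1,2) by (auto intro!: additiveI simp: dualD)
  then show "\<xi> X = \<upsilon> X" if "X \<in> carrier P.T" for X
    by (rule P.tensor_ext[OF _ _ _ that]) (simp add: assms(3))
qed

lemma tilde_left_hom: "tilde \<in> left_hom K A (dual K A L) (dual K A P.T)"
proof (rule left_homI)
  note [simp] = tilde_closed tilde_pure P.pure_closed L.lact_closed
    B.right.dual_add_closed B.right.dual_smult_closed B.right.dual_lact_closed
    PB.right.dual_add_closed PB.right.dual_smult_closed PB.right.dual_lact_closed
  show "tilde \<in> additive (dual K A L) (dual K A P.T)"
    by (rule additiveI, simp, rule dual_P_eqI) (simp_all, simp add: dual_simps)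
  show "tilde (c \<odot>\<^bsub>dual K A L\<^esub> \<xi>) = c \<odot>\<^bsub>dual K A P.T\<^esub> tilde \<xi>"
    if "c \<in> carrier K" "\<xi> \<in> carrier (dual K A L)" for c \<xi>
    by (rule dual_P_eqI) (use that in simp_all, simp add: dual_simps)
  show "tilde (a \<triangleright>\<^bsub>dual K A L\<^esub> \<xi>) = a \<triangleright>\<^bsub>dual K A P.T\<^esub> tilde \<xi>"
    if "a \<in> carrier A" "\<xi> \<in> carrier (dual K A L)" for a \<xi>
    by (rule dual_P_eqI) (use that in simp_all, simp add: dual_simps)
qed

lemma pure_right_hom: "s \<in> carrier R \<Longrightarrow> P.p s \<in> right_hom K A L P.T"
  by (intro right_homI additiveI)
    (simp_all add: P.pure_closed P.pure_add_r P.smult_pure P.pure_smult[simplified] pure_ract_P)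

lemma tensor_maps_\<Theta>:
  "s \<in> carrier R \<Longrightarrow> tensor_maps K A L (dual K A L) P.T (dual K A P.T) (P.p s) tilde"
  by (intro tensor_maps.intro tensor_maps_axioms.intro pure_right_hom tilde_left_hom
      B.right.D.tensor_pair_axioms PB.right.D.tensor_pair_axioms)

text \<open>On pure tensors
  \<open>x \<otimes> \<xi> \<mapsto> (s \<otimes> x) \<otimes> \<xi>'\<close>: the inner sum over
  \<open>k\<close> in the formula for \<open>j\<close>, as a function of the tensor
  \<open>\<Sum> x_k \<otimes> \<xi>_k\<close> with \<open>s\<close> as parameter.\<close>

definition \<Theta> where "\<Theta> s = tensor_map K A P.T (dual K A P.T) (P.p s) tilde"

lemma \<Theta>_additive: "s \<in> carrier R \<Longrightarrow> \<Theta> s \<in> additive D Q"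
  unfolding \<Theta>_def by (rule tensor_maps.map_additive[OF tensor_maps_\<Theta>])

lemma \<Theta>_pure:
  "\<lbrakk>s \<in> carrier R; x \<in> carrier L; \<xi> \<in> carrier (dual K A L)\<rbrakk> \<Longrightarrow>
    \<Theta> s (B.right.D.p x \<xi>) = PB.right.D.p (P.p s x) (tilde \<xi>)"
  unfolding \<Theta>_def by (rule tensor_maps.map_pure[OF tensor_maps_\<Theta>])

lemma \<Theta>_smult:
  "\<lbrakk>s \<in> carrier R; c \<in> carrier K; X \<in> carrier D\<rbrakk> \<Longrightarrow> \<Theta> s (c \<odot>\<^bsub>D\<^esub> X) = c \<odot>\<^bsub>Q\<^esub> \<Theta> s X"
  unfolding \<Theta>_def by (rule tensor_maps.map_smult[OF tensor_maps_\<Theta>])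

lemma \<Theta>_additive_left:
  assumes X: "X \<in> carrier D"
  shows "(\<lambda>s. \<Theta> s X) \<in> additive R Q"
proof (rule additiveI)
  show "\<Theta> s X \<in> carrier Q" if "s \<in> carrier R" for s
    by (rule additive_closed[OF \<Theta>_additive[OF that] X])
  show "\<Theta> (s \<oplus>\<^bsub>R\<^esub> t) X = \<Theta> s X \<oplus>\<^bsub>Q\<^esub> \<Theta> t X" if "s \<in> carrier R" "t \<in> carrier R" for s t
    by (rule B.right.D.tensor_ext[OF \<Theta>_additive
          additive_plus[OF PB.right.D.abelian_group_tensor \<Theta>_additive \<Theta>_additive] _ X])
      (use that in \<open>simp_all add: \<Theta>_pure P.pure_add_l[simplified] P.pure_closed
        PB.right.D.pure_add_l tilde_closed\<close>)
qed

lemma \<Theta>_smult_left: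
  assumes "s \<in> carrier R" "c \<in> carrier K" and X: "X \<in> carrier D"
  shows "\<Theta> (c \<odot>\<^bsub>R\<^esub> s) X = c \<odot>\<^bsub>Q\<^esub> \<Theta> s X"
  by (rule B.right.D.tensor_ext[OF \<Theta>_additive additive_comp[OF \<Theta>_additive PB.right.D.smult_additive] _ X])
    (use assms in \<open>simp_all add: \<Theta>_pure PB.right.D.smult_pure P.smult_pure P.pure_closed tilde_closed\<close>)

text \<open>Left multiplication by \<open>r\<close> touches only the factor \<open>s\<close>. This
  passes to \<open>J\<close> and gives the left linearity of \<open>j\<close>.\<close>

lemma \<Theta>_lact:
  assumes "r \<in> carrier R" "s \<in> carrier R" and X: "X \<in> carrier D"
  shows "\<Theta> (r \<otimes>\<^bsub>R\<^esub> s) X = r \<triangleright>\<^bsub>Q\<^esub> \<Theta> s X"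
  by (rule B.right.D.tensor_ext[OF \<Theta>_additive
        additive_comp[OF \<Theta>_additive PB.right.D.lact_additive[OF PB.bimodule_axioms]] _ X])
    (use assms in \<open>simp_all add: \<Theta>_pure PB.right.D.lact_pure[OF PB.bimodule_axioms]
      P.lact_pure[OF R_bimod] P.pure_closed tilde_closed mult_closed\<close>)

text \<open>By \<open>s u \<otimes> x = s \<otimes> u x\<close> in \<open>P\<close>, a right factor
  of the parameter turns into an operator on the argument \<open>X\<close>.\<close>

lemma \<Theta>_ract:
  assumes "s \<in> carrier R" "u \<in> carrier R" and X: "X \<in> carrier D"
  shows "\<Theta> (s \<otimes>\<^bsub>R\<^esub> u) X = \<Theta> s (u \<triangleright>\<^bsub>D\<^esub> X)"
  by (rule B.right.D.tensor_ext[OF \<Theta>_additive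
        additive_comp[OF B.right.D.lact_additive[OF B.bimodule_axioms] \<Theta>_additive] _ X])
    (use assms in \<open>simp_all add: \<Theta>_pure B.right.D.lact_pure[OF B.bimodule_axioms]
      P.pure_act[simplified] L.lact_closed mult_closed\<close>)

lemma lact_ev:
  assumes "u \<in> carrier R" "y \<in> carrier L" and X: "X \<in> carrier D"
  shows "B.right.ev y (u \<triangleright>\<^bsub>D\<^esub> X) = u \<triangleright>\<^bsub>L\<^esub> B.right.ev y X"
proof -
  have la: "lact L u \<in> additive L L"
    using assms(1) by (intro additiveI) (simp_all add: L.lact_closed L.lact_add_r)
  show ?thesis
    by (rule B.right.D.tensor_ext[OF additive_comp[OF B.right.D.lact_additive[OF B.bimodule_axioms]
            B.right.ev_additive] additive_comp[OF B.right.ev_additive la] _ X])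
      (use assms in \<open>simp_all add: B.right.D.lact_pure[OF B.bimodule_axioms] B.right.ev_pure
        L.lact_closed dualD B.lact_ract\<close>)
qed

text \<open>Since \<open>\<xi>'(u \<otimes> z) = \<xi>(u z)\<close>, the tensor
  \<open>\<Theta> s X\<close> applies the operator of \<open>X\<close> to \<open>u z\<close> and
  puts \<open>s\<close> in front.\<close>

lemma ev_\<Theta>:
  assumes "s \<in> carrier R" "u \<in> carrier R" "z \<in> carrier L" and X: "X \<in> carrier D"
  shows "PB.right.ev (P.p u z) (\<Theta> s X) = P.p s (B.right.ev (u \<triangleright>\<^bsub>L\<^esub> z) X)"
  by (rule B.right.D.tensor_ext[OF additive_comp[OF \<Theta>_additive PB.right.ev_additive]
        additive_comp[OF B.right.ev_additive right_homD(1)[OF pure_right_hom]] _ X])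
    (use assms in \<open>simp_all add: \<Theta>_pure PB.right.ev_pure P.pure_closed tilde_closed tilde_pure
      B.right.ev_pure L.lact_closed dualD pure_ract_P\<close>)

text \<open>The functional is \<open>\<upsilon> \<circ> f\<close>, where \<open>f\<close> is the
  operator of \<open>X\<close>. Additivity in \<open>X\<close> lets it occur inside maps that are
  compared on pure tensors.\<close>

lemma comp_ev_additive:
  assumes \<upsilon>: "\<upsilon> \<in> carrier (dual K A L)"
  shows "(\<lambda>X. \<lambda>z \<in> carrier L. \<upsilon> (B.right.ev z X)) \<in> additive D (dual K A L)"
proof -
  note e = right_homD[OF B.right.ev_right_hom]
  have c: "(\<lambda>z \<in> carrier L. \<upsilon> (B.right.ev z X)) \<in> carrier (dual K A L)" if "X \<in> carrier D" for X
    by (rule B.right.dualI) (simp_all add: e[OF that] dualD[OF \<upsilon>])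
  show ?thesis
    by (rule additiveI[OF c]) (auto simp: dual_simps(3) additive_add[OF B.right.ev_additive]
        B.right.ev_closed dualD[OF \<upsilon>] intro!: ext)
qed

text \<open>
  If \<open>u\<close> acts as \<open>\<Sum>\<^sub>i y\<^sub>i \<upsilon>\<^sub>i(-)\<close>, then \<open>\<Theta> (s u) X = \<Sum>\<^sub>i (s \<otimes> y\<^sub>i) \<otimes> (\<upsilon>\<^sub>i \<circ> f)'\<close> depends on \<open>X\<close> only through
  the endomorphism \<open>f\<close> that it induces; products \<open>s u\<close> span \<open>R\<close>.
\<close>

lemma \<Theta>_cong:
  assumes s: "s \<in> carrier R" and X: "X \<in> carrier D" and X': "X' \<in> carrier D"
    and eq: "\<And>y. y \<in> carrier L \<Longrightarrow> B.right.ev y X = B.right.ev y X'"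
  shows "\<Theta> s X = \<Theta> s X'"
proof -
  have pure: "\<Theta> (s \<otimes>\<^bsub>R\<^esub> u) X = \<Theta> (s \<otimes>\<^bsub>R\<^esub> u) X'" if s: "s \<in> carrier R" and u: "u \<in> carrier R" for s u
  proof -
    obtain n :: nat and y \<upsilon> where y: "y \<in> {..<n} \<rightarrow> carrier L" "\<upsilon> \<in> {..<n} \<rightarrow> carrier (dual K A L)"
      and sum: "\<And>x. x \<in> carrier L \<Longrightarrow>
        (\<lambda>x \<in> carrier L. u \<triangleright>\<^bsub>L\<^esub> x) x = (\<Oplus>\<^bsub>L\<^esub>i \<in> {..<n}. y i \<triangleleft>\<^bsub>L\<^esub> \<upsilon> i x)"
      by (rule B.right.finite_rankE[OF finite_rank[OF u]]; rule that)
    let ?f = "\<lambda>X. \<Oplus>\<^bsub>Q\<^esub>i \<in> {..<n}.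
      PB.right.D.p (P.p s (y i)) (tilde (\<lambda>z \<in> carrier L. \<upsilon> i (B.right.ev z X)))"
    have pa: "PB.right.D.p Z \<in> additive (dual K A P.T) Q" if "Z \<in> carrier P.T" for Z
      using that by (intro additiveI) (simp_all add: PB.right.D.pure_closed PB.right.D.pure_add_r)
    have fa: "?f \<in> additive D Q"
      by (rule additive_sum[OF PB.right.D.abelian_group_tensor finite_lessThan
            additive_comp[OF additive_comp[OF comp_ev_additive left_homD(1)[OF tilde_left_hom]] pa]])
        (use y s in \<open>auto intro!: P.pure_closed\<close>)
    have "\<Theta> s (u \<triangleright>\<^bsub>D\<^esub> X) = ?f X" if X: "X \<in> carrier D" for X
    proof (rule B.right.D.tensor_ext[OF additive_comp[OF B.right.D.lact_additive[OF B.bimodule_axioms u]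
            \<Theta>_additive[OF s]] fa _ X])
      fix x \<xi> assume x: "x \<in> carrier L" and \<xi>: "\<xi> \<in> carrier (dual K A L)"
      have ma: "(\<lambda>m. PB.right.D.p (P.p s m) (tilde \<xi>)) \<in> additive L Q"
        using s \<xi> by (intro additiveI)
          (simp_all add: P.pure_closed PB.right.D.pure_closed tilde_closed P.pure_add_r PB.right.D.pure_add_l)
      have "\<Theta> s (u \<triangleright>\<^bsub>D\<^esub> B.right.D.p x \<xi>) = PB.right.D.p (P.p s (u \<triangleright>\<^bsub>L\<^esub> x)) (tilde \<xi>)"
        using s u x \<xi> by (simp add: B.right.D.lact_pure[OF B.bimodule_axioms] \<Theta>_pure L.lact_closed)
      also have "u \<triangleright>\<^bsub>L\<^esub> x = (\<Oplus>\<^bsub>L\<^esub>i \<in> {..<n}. y i \<triangleleft>\<^bsub>L\<^esub> \<upsilon> i x)"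
        using sum[OF x] x by simp
      also have "PB.right.D.p (P.p s \<dots>) (tilde \<xi>)
          = (\<Oplus>\<^bsub>Q\<^esub>i \<in> {..<n}. PB.right.D.p (P.p s (y i \<triangleleft>\<^bsub>L\<^esub> \<upsilon> i x)) (tilde \<xi>))"
        using y x
        by (intro additive_finsum[OF L.mod.abelian_group_axioms
              PB.right.D.abelian_group_tensor ma]) (auto intro!: B.right.ract_closed dualD(1)[where K = K and M = L])
      also have "\<dots> = ?f (B.right.D.p x \<xi>)"
      proof (rule abelian_monoid.finsum_cong'[OF abelian_group.axioms(1)[OF PB.right.D.abelian_group_tensor] refl])
        show "(\<lambda>i. PB.right.D.p (P.p s (y i)) (tilde (\<lambda>z \<in> carrier L. \<upsilon> i (B.right.ev z (B.right.D.p x \<xi>)))))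
            \<in> {..<n} \<rightarrow> carrier Q"
          using y x \<xi> s by (auto intro!: PB.right.D.pure_closed P.pure_closed tilde_closed
              additive_closed[OF comp_ev_additive] B.right.D.pure_closed)
        fix i assume "i \<in> {..<n}"
        then have i: "y i \<in> carrier L" "\<upsilon> i \<in> carrier (dual K A L)" using y by auto
        \<comment> \<open>For the operator \<open>f\<close> of \<open>x \<otimes> \<xi>\<close>, the
          composite \<open>\<upsilon>_i \<circ> f\<close> is \<open>\<upsilon>_i(x) \<xi>\<close>.
          As \<open>tilde\<close> is left \<open>A\<close>-linear, the scalar
          \<open>\<upsilon>_i(x)\<close> then crosses the tensor sign over \<open>A\<close>.\<close>
        have "(\<lambda>z \<in> carrier L. \<upsilon> i (B.right.ev z (B.right.D.p x \<xi>))) = \<upsilon> i x \<triangleright>\<^bsub>dual K A L\<^esub> \<xi>"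
          using i x \<xi> by (auto simp: dual_simps(5) B.right.ev_pure dualD intro!: ext)
        then show "PB.right.D.p (P.p s (y i \<triangleleft>\<^bsub>L\<^esub> \<upsilon> i x)) (tilde \<xi>)
          = PB.right.D.p (P.p s (y i)) (tilde (\<lambda>z \<in> carrier L. \<upsilon> i (B.right.ev z (B.right.D.p x \<xi>))))"
          using i x \<xi> s by (simp add: left_homD[OF tilde_left_hom] dualD(1) P.pure_closed
              PB.right.D.pure_act[symmetric] tilde_closed pure_ract_P)
      qed
      finally show "\<Theta> s (u \<triangleright>\<^bsub>D\<^esub> B.right.D.p x \<xi>) = ?f (B.right.D.p x \<xi>)" .
    qed
    moreover have "(\<lambda>z \<in> carrier L. \<upsilon> i (B.right.ev z X)) = (\<lambda>z \<in> carrier L. \<upsilon> i (B.right.ev z X'))" for i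
      using eq by (auto intro!: ext)
    ultimately show ?thesis
      using s u X X' by (simp add: \<Theta>_ract)
  qed
  \<comment> \<open>From products to all of \<open>R\<close>: both sides are additive in the
    parameter, and \<open>s\<close> is the value of \<open>\<mu>\<close> at
    \<open>\<sigma> s\<close>.\<close>
  have "\<Theta> (\<mu> Z) X = \<Theta> (\<mu> Z) X'" if "Z \<in> carrier RR.T" for Z
    by (rule RR.tensor_ext[OF additive_comp[OF \<mu>_additive \<Theta>_additive_left[OF X]]
          additive_comp[OF \<mu>_additive \<Theta>_additive_left[OF X']] _ that])
      (simp add: \<mu>_pure pure)
  from this[OF \<sigma>_closed[OF s]] show ?thesis by (simp add: \<mu>_\<sigma> s)
qed

end

section \<open>The ring morphism from \<open>R\<close> to \<open>P \<otimes> P^*\<close>\<close>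

context firm_finite_rank begin

text \<open>An arbitrary preimage of the operator of \<open>t\<close> under the connecting map. The
  choice need not be additive in \<open>t\<close>; it is used under \<open>\<Theta> s\<close>, which
  depends only on the induced operator.\<close>

definition rep where
  "rep t = (SOME X. X \<in> carrier D \<and> (\<forall>y \<in> carrier L. B.right.ev y X = t \<triangleright>\<^bsub>L\<^esub> y))"

lemma rep:
  assumes "t \<in> carrier R"
  shows "rep t \<in> carrier D" "y \<in> carrier L \<Longrightarrow> B.right.ev y (rep t) = t \<triangleright>\<^bsub>L\<^esub> y"
proof -
  obtain X where "X \<in> carrier D" "\<And>y. y \<in> carrier L \<Longrightarrow> B.right.ev y X = (\<lambda>x \<in> carrier L. t \<triangleright>\<^bsub>L\<^esub> x) y"
    by (rule B.right.finite_rank_ev[OF finite_rank[OF assms]]; rule that)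
  then have "\<exists>X. X \<in> carrier D \<and> (\<forall>y \<in> carrier L. B.right.ev y X = t \<triangleright>\<^bsub>L\<^esub> y)"
    by auto
  from someI_ex[OF this]
  show "rep t \<in> carrier D" "y \<in> carrier L \<Longrightarrow> B.right.ev y (rep t) = t \<triangleright>\<^bsub>L\<^esub> y"
    by (simp_all add: rep_def)
qed

lemma \<Theta>_rep:
  assumes "s \<in> carrier R" "t \<in> carrier R" "X \<in> carrier D"
    and "\<And>y. y \<in> carrier L \<Longrightarrow> B.right.ev y X = t \<triangleright>\<^bsub>L\<^esub> y"
  shows "\<Theta> s (rep t) = \<Theta> s X"
  using assms by (intro \<Theta>_cong) (simp_all add: rep)

text \<open>In every clause that alters the second argument, \<open>rep\<close> of a sum, scalar
  multiple or product is exchanged for the corresponding combination of representatives, which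
  induces the same operator.\<close>

lemma balanced_\<Theta>_rep: "balanced K R (regular R) (regular R) Q (\<lambda>s t. \<Theta> s (rep t))"
proof (rule balancedI)
  interpret DG: module K D by (rule B.right.D.module_tensor)
  interpret DL: left_module K R D by (rule B.right.D.left_module_tensor[OF B.bimodule_axioms])
  show "(\<lambda>s. \<Theta> s (rep t)) \<in> additive (regular R) Q" if "t \<in> carrier (regular R)" for t
    using \<Theta>_additive_left[OF rep(1), of t] that by (simp add: additive_def)
  show "(\<lambda>t. \<Theta> s (rep t)) \<in> additive (regular R) Q" if "s \<in> carrier (regular R)" for s
  proof (rule additiveI)
    have s: "s \<in> carrier R" using that by simp
    show "\<Theta> s (rep t) \<in> carrier Q" if "t \<in> carrier (regular R)" for t
      using additive_closed[OF \<Theta>_additive[OF s] rep(1)] that by simp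
    fix t u assume tu: "t \<in> carrier (regular R)" "u \<in> carrier (regular R)"
    then have "\<Theta> s (rep (t \<oplus>\<^bsub>R\<^esub> u)) = \<Theta> s (rep t \<oplus>\<^bsub>D\<^esub> rep u)"
      by (intro \<Theta>_rep s)
        (simp_all add: rep additive_add[OF B.right.ev_additive] L.lact_add_l)
    then show "\<Theta> s (rep (t \<oplus>\<^bsub>regular R\<^esub> u)) = \<Theta> s (rep t) \<oplus>\<^bsub>Q\<^esub> \<Theta> s (rep u)"
      using tu by (simp add: additive_add[OF \<Theta>_additive[OF s]] rep)
  qed
  show "\<Theta> (c \<odot>\<^bsub>regular R\<^esub> s) (rep t) = \<Theta> s (rep (c \<odot>\<^bsub>regular R\<^esub> t))"
    if "c \<in> carrier K" "s \<in> carrier (regular R)" "t \<in> carrier (regular R)" for c s t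
  proof -
    have ev: "B.right.ev y (c \<odot>\<^bsub>D\<^esub> X) = c \<odot>\<^bsub>L\<^esub> B.right.ev y X"
      if "y \<in> carrier L" "X \<in> carrier D" for y X
    proof -
      have sa: "smult L c \<in> additive L L"
        using \<open>c \<in> carrier K\<close> by (intro additiveI) (simp_all add: L.mod.smult_r_distr)
      show ?thesis
        by (rule B.right.D.tensor_ext[OF additive_comp[OF B.right.D.smult_additive
                B.right.ev_additive] additive_comp[OF B.right.ev_additive sa] _ that(2)])
          (use that \<open>c \<in> carrier K\<close> in \<open>simp_all add: B.right.D.smult_pure B.right.ev_pure dualD
            B.right.ract_smult_l\<close>)
    qed
    have "\<Theta> s (rep (c \<odot>\<^bsub>R\<^esub> t)) = \<Theta> s (c \<odot>\<^bsub>D\<^esub> rep t)"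
      using that by (intro \<Theta>_rep) (simp_all add: rep ev L.lact_smult_l)
    then show ?thesis
      using that by (simp add: \<Theta>_smult \<Theta>_smult_left rep)
  qed
  show "\<Theta> (s \<triangleleft>\<^bsub>regular R\<^esub> u) (rep t) = \<Theta> s (rep (u \<triangleright>\<^bsub>regular R\<^esub> t))"
    if "u \<in> carrier R" "s \<in> carrier (regular R)" "t \<in> carrier (regular R)" for u s t
  proof -
    have "\<Theta> s (rep (u \<otimes>\<^bsub>R\<^esub> t)) = \<Theta> s (u \<triangleright>\<^bsub>D\<^esub> rep t)"
      using that by (intro \<Theta>_rep) (simp_all add: rep lact_ev L.lact_assoc DL.lact_closed mult_closed)
    then show ?thesis
      using that by (simp add: \<Theta>_ract rep)
  qed
qed

text \<open>The morphism \<open>j\<close> is \<open>J\<close> after \<open>\<sigma>\<close>; on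
  \<open>R \<otimes> R\<close> a formula on generators is available.\<close>

definition J where "J = tensor_lift Q (\<lambda>(s, t). \<Theta> s (rep t))"

lemma J_additive: "J \<in> additive RR.T Q"
  unfolding J_def by (rule RR.lift_additive[OF PB.right.D.abelian_group_tensor balanced_\<Theta>_rep])

lemma J_pure: "\<lbrakk>s \<in> carrier R; t \<in> carrier R\<rbrakk> \<Longrightarrow> J (RR.p s t) = \<Theta> s (rep t)"
  unfolding J_def using RR.lift_pure[OF PB.right.D.abelian_group_tensor balanced_\<Theta>_rep] by simp

lemma J_lact:
  assumes "r \<in> carrier R" "Z \<in> carrier RR.T"
  shows "J (r \<triangleright>\<^bsub>RR.T\<^esub> Z) = r \<triangleright>\<^bsub>Q\<^esub> J Z"
  by (rule RR.tensor_ext[OF additive_comp[OF RR.lact_additive[OF R_bimod] J_additive]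
        additive_comp[OF J_additive PB.right.D.lact_additive[OF PB.bimodule_axioms]] _ assms(2)])
    (use assms(1) in \<open>simp_all add: RR.lact_pure[OF R_bimod] J_pure mult_closed \<Theta>_lact rep\<close>)

lemma J_smult:
  assumes "c \<in> carrier K" "Z \<in> carrier RR.T"
  shows "J (c \<odot>\<^bsub>RR.T\<^esub> Z) = c \<odot>\<^bsub>Q\<^esub> J Z"
  by (rule RR.tensor_ext[OF additive_comp[OF RR.smult_additive J_additive]
        additive_comp[OF J_additive PB.right.D.smult_additive] _ assms(2)])
    (use assms(1) in \<open>simp_all add: RR.smult_pure J_pure \<Theta>_smult_left rep\<close>)

text \<open>For \<open>Z = s \<otimes> t\<close> both sides are \<open>s t u \<otimes> z\<close>:
  the operator of \<open>rep t\<close> is the action of \<open>t\<close>, so the left side is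
  \<open>s \<otimes> t u z\<close>.\<close>

lemma ev_J_pure:
  assumes u: "u \<in> carrier R" and z: "z \<in> carrier L" and Z: "Z \<in> carrier RR.T"
  shows "PB.right.ev (P.p u z) (J Z) = \<mu> Z \<triangleright>\<^bsub>P.T\<^esub> P.p u z"
proof -
  have y: "P.p u z \<in> carrier P.T" using u z by (simp add: P.pure_closed)
  have la: "(\<lambda>r. r \<triangleright>\<^bsub>P.T\<^esub> P.p u z) \<in> additive R P.T"
    using y by (intro additiveI) (simp_all add: PL.lact_closed PL.lact_add_l)
  show ?thesis
  proof (rule RR.tensor_ext[OF additive_comp[OF J_additive PB.right.ev_additive[OF y]]
        additive_comp[OF \<mu>_additive la] _ Z])
    fix s t assume "s \<in> carrier (regular R)" "t \<in> carrier (regular R)"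
    then have st: "s \<in> carrier R" "t \<in> carrier R" by simp_all
    have "PB.right.ev (P.p u z) (J (RR.p s t)) = P.p s (t \<triangleright>\<^bsub>L\<^esub> (u \<triangleright>\<^bsub>L\<^esub> z))"
      using st u z by (simp add: J_pure ev_\<Theta> rep L.lact_closed)
    also have "\<dots> = P.p (s \<otimes>\<^bsub>R\<^esub> (t \<otimes>\<^bsub>R\<^esub> u)) z"
      using st u z P.pure_act[of "t \<otimes>\<^bsub>R\<^esub> u" s z] by (simp add: L.lact_assoc mult_closed)
    also have "\<dots> = \<mu> (RR.p s t) \<triangleright>\<^bsub>P.T\<^esub> P.p u z"
      using st u z by (simp add: \<mu>_pure P.lact_pure[OF R_bimod] mult_closed mult_assoc)
    finally show "PB.right.ev (P.p u z) (J (RR.p s t)) = \<mu> (RR.p s t) \<triangleright>\<^bsub>P.T\<^esub> P.p u z" .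
  qed
qed

lemma ev_J:
  assumes y: "y \<in> carrier P.T" and r: "r \<in> carrier R"
  shows "PB.right.ev y (J (\<sigma> r)) = r \<triangleright>\<^bsub>P.T\<^esub> y"
  by (rule P.tensor_ext[OF right_homD(1)[OF PB.right.ev_right_hom[OF additive_closed[OF J_additive \<sigma>_closed[OF r]]]]
        P.lact_additive[OF R_bimod r] _ y])
    (use r in \<open>simp_all add: ev_J_pure \<sigma>_closed \<mu>_\<sigma>\<close>)

lemma dual_mult_eq_lact:
  assumes "X \<in> carrier Q" "r \<in> carrier R" and Y: "Y \<in> carrier Q"
    and "\<And>y. y \<in> carrier P.T \<Longrightarrow> PB.right.ev y X = r \<triangleright>\<^bsub>P.T\<^esub> y"
  shows "PB.right.dual_mult X Y = r \<triangleright>\<^bsub>Q\<^esub> Y"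
  by (rule PB.right.D.tensor_ext[OF PB.right.dual_mult_additive_right
        PB.right.D.lact_additive[OF PB.bimodule_axioms] _ Y])
    (use assms in \<open>simp_all add: PB.right.dual_mult_pure_right PB.right.D.lact_pure[OF PB.bimodule_axioms]\<close>)

text \<open>For products, \<open>j(r s) = J(r \<sigma>(s)) = r j(s)\<close>, and this equals
  \<open>j(r) j(s)\<close> because \<open>j(r)\<close> acts on \<open>P\<close> as
  \<open>r\<close>.\<close>

lemma J_alg_hom: "(\<lambda>r. J (\<sigma> r)) \<in> alg_hom K R (dual_tensor_algebra K A P.T)"
  unfolding alg_hom_def PB.right.dual_tensor_algebra_simps
  by (auto simp: additive_closed[OF J_additive] \<sigma>_closed additive_add[OF \<sigma>_additive]
      additive_add[OF J_additive] \<sigma>_smult J_smult dual_mult_eq_lact ev_J \<sigma>_lact J_lact)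

theorem firmly_projective_tensor:
  assumes "unital_right_module K A L"
  shows "firmly_projective K R A P.T"
proof (intro firmly_projective.intro firmly_projective_axioms.intro firm_ring_axioms
    PB.bimodule_axioms firm_left_module_tensor P.unital_right_module_tensor[OF B.bimodule_axioms assms]
    bexI[OF _ J_alg_hom] ballI allI impI)
  fix r n x \<xi> y
  assume r: "r \<in> carrier R" and x: "x \<in> {..<n::nat} \<rightarrow> carrier P.T"
    and \<xi>: "\<xi> \<in> {..<n} \<rightarrow> carrier (dual K A P.T)"
    and eq: "J (\<sigma> r) = (\<Oplus>\<^bsub>dual_tensor_algebra K A P.T\<^esub>i \<in> {..<n}. PB.right.D.p (x i) (\<xi> i))"
    and y: "y \<in> carrier P.T"
  have ab: "abelian_group (dual_tensor_algebra K A P.T)"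
    by (rule abelian_group_cong[OF PB.right.D.abelian_group_tensor PB.right.dual_tensor_algebra_simps(1-3)])
  have ea: "PB.right.ev y \<in> additive (dual_tensor_algebra K A P.T) P.T"
    using PB.right.ev_additive[OF y] by (simp add: additive_def PB.right.dual_tensor_algebra_simps)
  \<comment> \<open>An arbitrary presentation of \<open>j(r)\<close> is given; the additive map
    \<open>ev y\<close> evaluates it term by term.\<close>
  have "r \<triangleright>\<^bsub>P.T\<^esub> y = PB.right.ev y (J (\<sigma> r))"
    by (rule ev_J[OF y r, symmetric])
  also have "\<dots> = (\<Oplus>\<^bsub>P.T\<^esub>i \<in> {..<n}. PB.right.ev y (PB.right.D.p (x i) (\<xi> i)))"
    unfolding eq using x \<xi>
    by (intro additive_finsum[OF ab P.abelian_group_tensor ea])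
      (auto simp: PB.right.dual_tensor_algebra_simps intro!: PB.right.D.pure_closed)
  also have "\<dots> = (\<Oplus>\<^bsub>P.T\<^esub>i \<in> {..<n}. x i \<triangleleft>\<^bsub>P.T\<^esub> \<xi> i y)"
    using x \<xi> y
    by (intro PL.mod.M.finsum_cong') (auto simp: PB.right.ev_pure Pi_def PB.right.ract_closed dualD)
  finally show "r \<triangleright>\<^bsub>P.T\<^esub> y = (\<Oplus>\<^bsub>P.T\<^esub>i \<in> {..<n}. x i \<triangleleft>\<^bsub>P.T\<^esub> \<xi> i y)" .
qed

end

section \<open>Replacing the left action by the one through \<open>\<iota>\<close>\<close>

lemma end_algebra_with_left: "end_algebra K A (with_left l M) = end_algebra K A M"
  by (simp add: end_algebra_def right_hom_def)

lemma finite_rank_algebra_with_left: "finite_rank_algebra K A (with_left l M) = finite_rank_algebra K A M"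
  by (simp add: finite_rank_algebra_def end_algebra_with_left dual_simps right_hom_def)

lemma unital_right_module_with_left:
  assumes "unital_right_module K A M"
  shows "unital_right_module K A (with_left l M)"
proof -
  interpret unital_right_module K A M by fact
  show ?thesis
    by (intro unital_right_module.intro unital_right_module_axioms.intro
        right_module_with_left[OF right_module_axioms] unital_algebra_axioms) (simp add: ract_one)
qed

lemma firmly_projective_with_left:
  assumes "unital_right_module K A M" "firm_ring K R"
    and \<iota>: "\<iota> \<in> alg_hom K R (finite_rank_algebra K A M)"
  shows "firmly_projective K R A (tensor K R (regular R) (with_left \<iota> M))"
proof -
  interpret M: unital_right_module K A M by fact
  interpret R: firm_ring K R by fact
  have e: "\<iota> \<in> alg_hom K R (end_algebra K A M)"
    using alg_hom_subalgebra[where f = \<iota> and K = K and R = R and S = "end_algebra K A M"] \<iota> M.finite_rank_end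
    by (simp add: finite_rank_algebra_def)
  interpret B: bimodule K R A "with_left \<iota> M"
    by (rule bimodule_with_left[OF M.right_module_axioms R.nu_algebra_axioms e])
  interpret firm_finite_rank K R A "with_left \<iota> M"
  proof
    fix r assume "r \<in> carrier R"
    then have r: "\<iota> r \<in> carrier (finite_rank_algebra K A M)" by (rule alg_homD(1)[OF \<iota>])
    \<comment> \<open>Being extensional, \<open>\<iota> r\<close> coincides with its restriction to
      the carrier, the form in which the locale states finite rank.\<close>
    then have "\<iota> r \<in> extensional (carrier M)"
      using M.finite_rank_end end_algebra_carrierD(2) by blast
    then show "(\<lambda>x \<in> carrier (with_left \<iota> M). r \<triangleright>\<^bsub>with_left \<iota> M\<^esub> x)
        \<in> carrier (finite_rank_algebra K A (with_left \<iota> M))"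
      using r by (simp add: finite_rank_algebra_with_left extensional_restrict)
  qed
  show ?thesis
    by (rule firmly_projective_tensor[OF unital_right_module_with_left[OF assms(1)]])
qed

section \<open>Bicomodules\<close>

locale bicomodule_tensor = X: bicomodule K R A C \<Delta> \<epsilon> M \<rho>
  for K :: "('k, 'x) ring_scheme" (structure) and R :: "('k, 'r) module" and A :: "('k, 'a) module"
    and C :: "('k, 'c, 'a, 'a) bimod" and \<Delta> and \<epsilon>
    and M :: "('k, 'm, 'r, 'a) bimod" and \<rho>
begin

lemma C_bimod: "bimodule K A A C" by (rule X.bimodule_axioms)
lemma R_bimod: "bimodule K R R (regular R)"
  by (rule bimodule_regular) (rule left_module.axioms(1)[OF X.left_module_axioms])
lemma M_unital: "unital_right_module K A M"
  using X.right_comodule_axioms by (simp add: right_comodule_def)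
lemma M_right: "right_module K A M"
  using M_unital by (simp add: unital_right_module_def)
lemma M_left: "left_module K R M" by (rule X.left_module_axioms)

lemma lact_right_hom:
  assumes "r \<in> carrier R"
  shows "(\<lambda>x \<in> carrier M. r \<triangleright>\<^bsub>M\<^esub> x) \<in> right_hom K A M M"
  using X.lact_colinear[OF assms] by (simp add: comodule_end_algebra_def end_simps)

text \<open>A bicomodule is given with separate left and right actions; their compatibility is the
  \<open>A\<close>-linearity contained in \<open>lact_colinear\<close>.\<close>

lemma M_bimod: "bimodule K R A M"
proof (intro bimodule.intro bimodule_axioms.intro M_left M_right)
  fix r x a assume *: "r \<in> carrier R" "x \<in> carrier M" "a \<in> carrier A"
  have "x \<triangleleft>\<^bsub>M\<^esub> a \<in> carrier M" using * right_module.ract_closed[OF M_right] by blast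
  then show "(r \<triangleright>\<^bsub>M\<^esub> x) \<triangleleft>\<^bsub>M\<^esub> a = r \<triangleright>\<^bsub>M\<^esub> (x \<triangleleft>\<^bsub>M\<^esub> a)"
    using right_homD(5)[OF lact_right_hom[OF *(1)] *(3,2)] *(2) by simp
qed

sublocale TM: tensor_triple K A A M C C
  by (intro tensor_triple.intro M_right C_bimod bimodule.axioms(1)[OF C_bimod])

sublocale P: tensor_pair K R "regular R" M
  by (intro tensor_pair.intro bimodule.axioms(2)[OF R_bimod] M_left)

lemma P_bimod: "bimodule K R A P.T"
  by (rule P.bimodule_tensor[OF R_bimod M_bimod])

sublocale TP: tensor_triple K A A P.T C C
  by (intro tensor_triple.intro bimodule.axioms(2)[OF P_bimod] C_bimod bimodule.axioms(1)[OF C_bimod])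

abbreviation "MC \<equiv> tensor K A M C"
abbreviation "CC \<equiv> tensor K A C C"
abbreviation "PC \<equiv> tensor K A P.T C"

lemma R_closed: "\<lbrakk>r \<in> carrier R; s \<in> carrier R\<rbrakk> \<Longrightarrow> r \<otimes>\<^bsub>R\<^esub> s \<in> carrier R"
  using bimodule.axioms(2)[OF R_bimod] right_module.ract_closed[of K R "regular R" r s] by simp

lemma R_smult_closed: "\<lbrakk>c \<in> carrier K; s \<in> carrier R\<rbrakk> \<Longrightarrow> c \<odot>\<^bsub>R\<^esub> s \<in> carrier R"
  using bimodule.axioms(2)[OF R_bimod] module.smult_closed[of K "regular R" c s]
  by (simp add: right_module_def)

lemma pure_right_hom: "r \<in> carrier R \<Longrightarrow> P.p r \<in> right_hom K A M P.T"
  by (intro right_homI additiveI)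
    (simp_all add: P.pure_closed P.pure_add_r P.smult_pure P.pure_smult[simplified]
      P.ract_pure[OF M_bimod])

lemma maps_\<Phi>: "r \<in> carrier R \<Longrightarrow> tensor_maps K A M C P.T C (P.p r) (\<lambda>d. d)"
  by (intro tensor_maps.intro tensor_maps_axioms.intro pure_right_hom left_hom_id
      TM.LM.tensor_pair_axioms TP.LM.tensor_pair_axioms)

text \<open>The map \<open>(r \<otimes> -) \<otimes> C\<close> from \<open>M \<otimes> C\<close> to
  \<open>P \<otimes> C\<close>. As the coaction of \<open>P\<close> is
  \<open>r \<otimes> x \<mapsto> \<Phi> r (\<rho> x)\<close>, the comodule axioms for
  \<open>P\<close> come down to how \<open>\<Phi> r\<close> commutes with the structure
  maps.\<close>

definition \<Phi> where "\<Phi> r = tensor_map K A P.T C (P.p r) (\<lambda>d. d)"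

lemma \<Phi>_right_hom: "r \<in> carrier R \<Longrightarrow> \<Phi> r \<in> right_hom K A MC PC"
  unfolding \<Phi>_def
  by (rule tensor_maps.map_right_hom[OF maps_\<Phi> C_bimod C_bimod right_hom_id])

lemmas \<Phi>_additive = right_homD(1)[OF \<Phi>_right_hom]

lemma \<Phi>_pure:
  "\<lbrakk>r \<in> carrier R; y \<in> carrier M; c \<in> carrier C\<rbrakk> \<Longrightarrow> \<Phi> r (TM.LM.p y c) = TP.LM.p (P.p r y) c"
  unfolding \<Phi>_def by (rule tensor_maps.map_pure[OF maps_\<Phi>])

lemma \<Phi>_add:
  assumes "r \<in> carrier R" "s \<in> carrier R" "Y \<in> carrier MC"
  shows "\<Phi> (r \<oplus>\<^bsub>R\<^esub> s) Y = \<Phi> r Y \<oplus>\<^bsub>PC\<^esub> \<Phi> s Y"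
proof -
  have "r \<oplus>\<^bsub>R\<^esub> s \<in> carrier R" using assms(1,2) P.M.mod.M.a_closed[of r s] by simp
  then show ?thesis
    by (intro TM.LM.tensor_ext[OF \<Phi>_additive
        additive_plus[OF TP.LM.abelian_group_tensor \<Phi>_additive \<Phi>_additive] _ assms(3)])
      (use assms in \<open>simp_all add: \<Phi>_pure P.pure_add_l[simplified] P.pure_closed TP.LM.pure_add_l\<close>)
qed

lemma \<Phi>_smult:
  assumes "c \<in> carrier K" "r \<in> carrier R" "Y \<in> carrier MC"
  shows "\<Phi> (c \<odot>\<^bsub>R\<^esub> r) Y = c \<odot>\<^bsub>PC\<^esub> \<Phi> r Y"
  by (rule TM.LM.tensor_ext[OF \<Phi>_additive additive_comp[OF \<Phi>_additive TP.LM.smult_additive] _ assms(3)])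
    (use assms in \<open>simp_all add: R_smult_closed \<Phi>_pure P.pure_closed TP.LM.smult_pure P.smult_pure\<close>)

lemma \<rho>_hom: "\<rho> \<in> right_hom K A M MC" by (rule X.coact_hom)

lemmas \<rho> = right_homD[OF \<rho>_hom]

lemma maps_lact:
  "r \<in> carrier R \<Longrightarrow> tensor_maps K A M C M C (\<lambda>x \<in> carrier M. r \<triangleright>\<^bsub>M\<^esub> x) (\<lambda>d. d)"
  by (intro tensor_maps.intro tensor_maps_axioms.intro lact_right_hom left_hom_id
      TM.LM.tensor_pair_axioms)

lemma \<rho>_lact:
  assumes "r \<in> carrier R" "x \<in> carrier M"
  shows "\<rho> (r \<triangleright>\<^bsub>M\<^esub> x) = tensor_map K A M C (\<lambda>x \<in> carrier M. r \<triangleright>\<^bsub>M\<^esub> x) (\<lambda>d. d) (\<rho> x)"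
  using X.lact_colinear[OF assms(1)] assms(2) by (simp add: comodule_end_algebra_def)

text \<open>Here colinearity of the action enters: \<open>\<rho> (u x)\<close> is
  \<open>u \<otimes> C\<close> applied to \<open>\<rho> x\<close>, and
  \<open>r u \<otimes> y = r \<otimes> u y\<close> in \<open>P\<close>. This is what makes the
  coaction of \<open>P\<close> balanced over \<open>R\<close>.\<close>

lemma \<Phi>_mult:
  assumes "r \<in> carrier R" "u \<in> carrier R" "x \<in> carrier M"
  shows "\<Phi> (r \<otimes>\<^bsub>R\<^esub> u) (\<rho> x) = \<Phi> r (\<rho> (u \<triangleright>\<^bsub>M\<^esub> x))"
  unfolding \<rho>_lact[OF assms(2,3)]
  by (rule TM.LM.tensor_ext[OF \<Phi>_additive
        additive_comp[OF tensor_maps.map_additive[OF maps_lact] \<Phi>_additive] _ \<rho>(2)[OF assms(3)]])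
    (use assms(1,2) in \<open>simp_all add: R_closed \<Phi>_pure tensor_maps.map_pure[OF maps_lact]
      left_module.lact_closed[OF M_left] P.pure_act[simplified]\<close>)

lemma tensor_coact_eq: "tensor_coact K R A C M \<rho> = tensor_lift PC (\<lambda>(r, x). \<Phi> r (\<rho> x))"
  by (simp add: tensor_coact_def Let_def \<Phi>_def tensor_map_def)

lemma balanced_coact: "balanced K R (regular R) M PC (\<lambda>r x. \<Phi> r (\<rho> x))"
  by (intro balancedI additiveI)
    (simp_all add: additive_closed[OF \<Phi>_additive] additive_add[OF \<Phi>_additive] \<rho> \<Phi>_add \<Phi>_smult
      right_homD[OF \<Phi>_right_hom] \<Phi>_mult)

abbreviation "coact \<equiv> tensor_coact K R A C M \<rho>"

lemma coact_additive: "coact \<in> additive P.T PC"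
  unfolding tensor_coact_eq by (rule P.lift_additive[OF TP.LM.abelian_group_tensor balanced_coact])

lemma coact_pure: "\<lbrakk>r \<in> carrier R; x \<in> carrier M\<rbrakk> \<Longrightarrow> coact (P.p r x) = \<Phi> r (\<rho> x)"
  unfolding tensor_coact_eq
  using P.lift_pure[OF TP.LM.abelian_group_tensor balanced_coact] by simp

lemma coact_right_hom: "coact \<in> right_hom K A P.T PC"
proof (rule right_homI[OF coact_additive])
  show "coact (c \<odot>\<^bsub>P.T\<^esub> X) = c \<odot>\<^bsub>PC\<^esub> coact X" if "c \<in> carrier K" "X \<in> carrier P.T" for c X
    by (rule P.tensor_ext[OF additive_comp[OF P.smult_additive coact_additive]
          additive_comp[OF coact_additive TP.LM.smult_additive] _ that(2)])
      (use that(1) in \<open>simp_all add: P.smult_pure coact_pure R_smult_closed \<Phi>_smult \<rho>\<close>)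
  show "coact (X \<triangleleft>\<^bsub>P.T\<^esub> a) = coact X \<triangleleft>\<^bsub>PC\<^esub> a" if "a \<in> carrier A" "X \<in> carrier P.T" for a X
    by (rule P.tensor_ext[OF additive_comp[OF P.ract_additive[OF M_bimod] coact_additive]
          additive_comp[OF coact_additive TP.LM.ract_additive[OF C_bimod]] _ that(2)])
      (use that(1) in \<open>simp_all add: P.ract_pure[OF M_bimod] coact_pure
        right_module.ract_closed[OF M_right] right_homD[OF \<Phi>_right_hom] \<rho>\<close>)
qed

lemma maps_\<Psi>: "r \<in> carrier R \<Longrightarrow> tensor_maps K A M CC P.T CC (P.p r) (\<lambda>d. d)"
  by (intro tensor_maps.intro tensor_maps_axioms.intro pure_right_hom left_hom_id
      TM.L_MN.tensor_pair_axioms TP.L_MN.tensor_pair_axioms)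

lemma \<Delta>_left: "\<Delta> \<in> left_hom K A C CC"
  by (rule bimodule_hom_left[OF X.comult_hom])

lemma maps_\<rho>: "tensor_maps K A M C MC C \<rho> (\<lambda>d. d)"
  by (intro tensor_maps.intro tensor_maps_axioms.intro \<rho>_hom left_hom_id
      TM.LM.tensor_pair_axioms TM.LM_N.tensor_pair_axioms)

lemma maps_coact: "tensor_maps K A P.T C PC C coact (\<lambda>d. d)"
  by (intro tensor_maps.intro tensor_maps_axioms.intro coact_right_hom left_hom_id
      TP.LM.tensor_pair_axioms TP.LM_N.tensor_pair_axioms)

lemma maps_M\<Delta>: "tensor_maps K A M C M CC (\<lambda>x. x) \<Delta>"
  by (intro tensor_maps.intro tensor_maps_axioms.intro right_hom_id \<Delta>_left
      TM.LM.tensor_pair_axioms TM.L_MN.tensor_pair_axioms)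

lemma maps_P\<Delta>: "tensor_maps K A P.T C P.T CC (\<lambda>x. x) \<Delta>"
  by (intro tensor_maps.intro tensor_maps_axioms.intro right_hom_id \<Delta>_left
      TP.LM.tensor_pair_axioms TP.L_MN.tensor_pair_axioms)

text \<open>Naturality of the associator in its first factor, along \<open>r \<otimes> -\<close>
  from \<open>M\<close> to \<open>P\<close>.\<close>

lemma assoc_\<Phi>:
  assumes r: "r \<in> carrier R" and V: "V \<in> carrier MC" and c: "c \<in> carrier C"
  shows "tensor_assoc K A A P.T C C (TP.LM_N.p (\<Phi> r V) c)
    = tensor_map K A P.T CC (P.p r) (\<lambda>d. d) (tensor_assoc K A A M C C (TM.LM_N.p V c))"
proof -
  have mc: "(\<lambda>V. TM.LM_N.p V c) \<in> additive MC TM.LM_N.T"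
    using c by (intro additiveI) (simp_all add: TM.LM_N.pure_closed TM.LM_N.pure_add_l)
  have pc: "(\<lambda>V. TP.LM_N.p V c) \<in> additive PC TP.LM_N.T"
    using c by (intro additiveI) (simp_all add: TP.LM_N.pure_closed TP.LM_N.pure_add_l)
  show ?thesis
    by (rule TM.LM.tensor_ext[OF additive_comp[OF \<Phi>_additive[OF r] additive_comp[OF pc TP.assoc_additive]]
          additive_comp[OF mc additive_comp[OF TM.assoc_additive tensor_maps.map_additive[OF maps_\<Psi>[OF r]]]] _ V])
      (use r c in \<open>simp_all add: \<Phi>_pure TP.assoc_pure TM.assoc_pure P.pure_closed
        tensor_maps.map_pure[OF maps_\<Psi>] TM.MN.pure_closed\<close>)
qed

text \<open>For \<open>Y = y \<otimes> c\<close> the coaction of \<open>P\<close> produces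
  \<open>\<Phi> r (\<rho> y) \<otimes> c\<close>, so one side of coassociativity for
  \<open>P\<close> is the image of that side for \<open>M\<close>; \<open>comult_\<Phi>\<close>
  treats the other side.\<close>

lemma coassoc_\<Phi>:
  assumes r: "r \<in> carrier R" and Y: "Y \<in> carrier MC"
  shows "tensor_assoc K A A P.T C C (tensor_map K A PC C coact (\<lambda>d. d) (\<Phi> r Y))
    = tensor_map K A P.T CC (P.p r) (\<lambda>d. d)
        (tensor_assoc K A A M C C (tensor_map K A MC C \<rho> (\<lambda>d. d) Y))"
  by (rule TM.LM.tensor_ext[OF additive_comp[OF \<Phi>_additive[OF r]
          additive_comp[OF tensor_maps.map_additive[OF maps_coact] TP.assoc_additive]]
        additive_comp[OF tensor_maps.map_additive[OF maps_\<rho>]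
          additive_comp[OF TM.assoc_additive tensor_maps.map_additive[OF maps_\<Psi>[OF r]]]] _ Y])
    (use r in \<open>simp_all add: \<Phi>_pure tensor_maps.map_pure[OF maps_coact] tensor_maps.map_pure[OF maps_\<rho>]
      P.pure_closed coact_pure assoc_\<Phi> \<rho>\<close>)

lemma comult_\<Phi>:
  assumes r: "r \<in> carrier R" and Y: "Y \<in> carrier MC"
  shows "tensor_map K A P.T CC (\<lambda>x. x) \<Delta> (\<Phi> r Y)
    = tensor_map K A P.T CC (P.p r) (\<lambda>d. d) (tensor_map K A M CC (\<lambda>x. x) \<Delta> Y)"
  by (rule TM.LM.tensor_ext[OF additive_comp[OF \<Phi>_additive[OF r] tensor_maps.map_additive[OF maps_P\<Delta>]]
        additive_comp[OF tensor_maps.map_additive[OF maps_M\<Delta>] tensor_maps.map_additive[OF maps_\<Psi>[OF r]]] _ Y])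
    (use r in \<open>simp_all add: \<Phi>_pure tensor_maps.map_pure[OF maps_P\<Delta>] tensor_maps.map_pure[OF maps_M\<Delta>]
      tensor_maps.map_pure[OF maps_\<Psi>] P.pure_closed left_homD[OF \<Delta>_left]\<close>)

lemma balanced_counit:
  assumes "right_module K A N"
  shows "balanced K A N C N (\<lambda>y d. y \<triangleleft>\<^bsub>N\<^esub> \<epsilon> d)"
proof -
  interpret N: right_module K A N by fact
  have "\<epsilon> \<in> left_hom K A C (regular A)"
    by (rule bimodule_hom_left[OF X.counit_hom])
  note e = left_homD[OF this, simplified]
  show ?thesis
    by (intro balancedI additiveI)
      (simp_all add: e N.ract_closed N.ract_add_l N.ract_add_r N.ract_smult_l N.ract_smult_r
        N.ract_assoc)
qed

lemma counit_\<Phi>: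
  assumes r: "r \<in> carrier R" and Y: "Y \<in> carrier MC"
  shows "tensor_lift P.T (\<lambda>(y, d). y \<triangleleft>\<^bsub>P.T\<^esub> \<epsilon> d) (\<Phi> r Y)
    = P.p r (tensor_lift M (\<lambda>(y, d). y \<triangleleft>\<^bsub>M\<^esub> \<epsilon> d) Y)"
proof -
  have e: "\<epsilon> c \<in> carrier A" if "c \<in> carrier C" for c
    using right_homD(2)[OF bimodule_hom_right[OF X.counit_hom]] that by simp
  have gM: "abelian_group M"
    using M_right by (simp add: right_module_def module_def)
  note bP = balanced_counit[OF bimodule.axioms(2)[OF P_bimod]] and bM = balanced_counit[OF M_right]
  show ?thesis
    by (rule TM.LM.tensor_ext[OF additive_comp[OF \<Phi>_additive[OF r]
            TP.LM.lift_additive[OF P.abelian_group_tensor bP]]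
          additive_comp[OF TM.LM.lift_additive[OF gM bM]
            right_homD(1)[OF pure_right_hom[OF r]]] _ Y])
      (use r in \<open>simp_all add: \<Phi>_pure TP.LM.lift_pure[OF P.abelian_group_tensor bP]
        TM.LM.lift_pure[OF gM bM] P.pure_closed P.ract_pure[OF M_bimod] e\<close>)
qed

text \<open>On a generator \<open>r \<otimes> x\<close>, the two sides of each axiom are images,
  under maps induced by \<open>r \<otimes> -\<close>, of the two sides of the axiom for
  \<open>M\<close> at \<open>x\<close>.\<close>

lemma right_comodule_tensor: "right_comodule K A C \<Delta> \<epsilon> P.T coact"
proof (intro right_comodule.intro right_comodule_axioms.intro coact_right_hom
    P.unital_right_module_tensor[OF M_bimod M_unital])
  show "coring K A C \<Delta> \<epsilon>" by (rule X.coring_axioms)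
  fix X assume X: "X \<in> carrier P.T"
  show "tensor_assoc K A A P.T C C (tensor_map K A PC C coact (\<lambda>d. d) (coact X))
      = tensor_map K A P.T CC (\<lambda>y. y) \<Delta> (coact X)"
    by (rule P.tensor_ext[OF additive_comp[OF coact_additive
            additive_comp[OF tensor_maps.map_additive[OF maps_coact] TP.assoc_additive]]
          additive_comp[OF coact_additive tensor_maps.map_additive[OF maps_P\<Delta>]] _ X])
      (simp_all add: coact_pure coassoc_\<Phi> comult_\<Phi> \<rho> X.coact_coassoc)
  show "tensor_lift P.T (\<lambda>(y, d). y \<triangleleft>\<^bsub>P.T\<^esub> \<epsilon> d) (coact X) = X"
    by (rule P.tensor_ext[OF additive_comp[OF coact_additive TP.LM.lift_additive[OF
              P.abelian_group_tensor balanced_counit[OF bimodule.axioms(2)[OF P_bimod]]]]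
          additive_id _ X])
      (simp_all add: coact_pure counit_\<Phi> \<rho> X.coact_counit)
qed

theorem bicomodule_tensor: "bicomodule K R A C \<Delta> \<epsilon> P.T coact"
proof (intro bicomodule.intro bicomodule_axioms.intro right_comodule_tensor
    bimodule.axioms(1)[OF P_bimod])
  fix r assume r: "r \<in> carrier R"
  interpret PB: bimodule K R A P.T by (rule P_bimod)
  let ?l = "\<lambda>X \<in> carrier P.T. r \<triangleright>\<^bsub>P.T\<^esub> X"
  have l: "?l \<in> right_hom K A P.T P.T"
    using r by (intro right_homI additiveI)
      (simp_all add: PB.left.lact_closed PB.left.lact_add_r PB.left.lact_smult_r PB.lact_ract
        TP.L.ract_closed)
  have m: "tensor_maps K A P.T C P.T C ?l (\<lambda>d. d)"
    by (intro tensor_maps.intro tensor_maps_axioms.intro l left_hom_id TP.LM.tensor_pair_axioms)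
  \<comment> \<open>The action on \<open>P\<close> touches only the factor \<open>R\<close>, so it
    turns \<open>\<Phi> s\<close> into \<open>\<Phi> (r s)\<close>; colinearity follows because the
    coaction is built from \<open>\<Phi>\<close>.\<close>
  have \<Phi>: "\<Phi> (r \<otimes>\<^bsub>R\<^esub> s) Y = tensor_map K A P.T C ?l (\<lambda>d. d) (\<Phi> s Y)"
    if "s \<in> carrier R" "Y \<in> carrier MC" for s Y
    by (rule TM.LM.tensor_ext[OF \<Phi>_additive
          additive_comp[OF \<Phi>_additive tensor_maps.map_additive[OF m]] _ that(2)])
      (use that r in \<open>simp_all add: R_closed \<Phi>_pure P.pure_closed tensor_maps.map_pure[OF m]
        P.lact_pure[OF R_bimod]\<close>)
  have "coact (r \<triangleright>\<^bsub>P.T\<^esub> X) = tensor_map K A P.T C ?l (\<lambda>d. d) (coact X)" if "X \<in> carrier P.T" for X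
    by (rule P.tensor_ext[OF additive_comp[OF P.lact_additive[OF R_bimod r] coact_additive]
          additive_comp[OF coact_additive tensor_maps.map_additive[OF m]] _ that])
      (use r in \<open>simp_all add: P.lact_pure[OF R_bimod] coact_pure R_closed \<Phi> \<rho>\<close>)
  then show "?l \<in> carrier (comodule_end_algebra K A C P.T coact)"
    using l by (simp add: comodule_end_algebra_def end_simps)
qed

end

text \<open>
  Replacing the left action changes the record type, so \<open>with_left l M\<close> and \<open>M\<close> cannot be
  equated; the tensor constructions only see the fields compared here.
\<close>

definition right_cong :: "('k, 'm, 'l, 'b) bimod \<Rightarrow> ('k, 'm, 'l2, 'b) bimod \<Rightarrow> bool" where
  "right_cong M M' \<longleftrightarrow> carrier M = carrier M' \<and> add M = add M' \<and> ring.zero M = ring.zero M' \<and>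
     smult M = smult M' \<and> ract M = ract M'"

lemma right_cong_with_left: "right_cong (with_left l M) M"
  by (simp add: right_cong_def)

lemma tensor_null_cong:
  "right_cong M M' \<Longrightarrow> tensor_null K B M N = tensor_null K B M' N"
  by (simp add: right_cong_def tensor_null_def tensor_rels_def)

lemma pure_cong: "right_cong M M' \<Longrightarrow> pure K B M N = pure K B M' N"
  by (intro ext) (simp add: pure_def tensor_null_cong, simp add: right_cong_def)

lemma tensor_group_cong: "right_cong M M' \<Longrightarrow> tensor_group K B M N = tensor_group K B M' N"
  by (simp add: tensor_group_def tensor_null_cong) (simp add: right_cong_def)

lemma right_cong_tensor: "right_cong M M' \<Longrightarrow> right_cong (tensor K B M N) (tensor K B M' N)"
  by (frule pure_cong[of M M' K B N], frule tensor_group_cong[of M M' K B N])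
    (simp add: right_cong_def tensor_def Let_def)

lemma tensor_lift_cong:
  "right_cong M M' \<Longrightarrow> tensor_lift M f = tensor_lift M' f"
  by (rule tensor_lift_ring_cong) (simp_all add: right_cong_def)

lemma tensor_map_cong:
  "right_cong M M' \<Longrightarrow> tensor_map K B M N = tensor_map K B M' N"
  by (intro ext) (simp add: tensor_map_def pure_cong tensor_lift_cong[OF right_cong_tensor])

lemma tensor_assoc_cong:
  "right_cong L L' \<Longrightarrow> tensor_assoc K A B L M N = tensor_assoc K A B L' M N"
  by (intro ext) (simp add: tensor_assoc_def Let_def pure_cong tensor_lift_cong[OF right_cong_tensor])

lemma right_hom_cong:
  "\<lbrakk>right_cong M M'; right_cong N N'\<rbrakk> \<Longrightarrow> right_hom K A M N = right_hom K A M' N'"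
  by (simp add: right_cong_def right_hom_def)

lemma right_comodule_with_left:
  assumes "right_comodule K A C \<Delta> \<epsilon> M \<rho>"
  shows "right_comodule K A C \<Delta> \<epsilon> (with_left l M) \<rho>"
proof -
  have X: "coring K A C \<Delta> \<epsilon>" "unital_right_module K A M" "right_comodule_axioms K A C \<Delta> \<epsilon> M \<rho>"
    using assms by (simp_all add: right_comodule_def)
  note w = right_cong_with_left[of l M]
  note wt = right_cong_tensor[OF w]
  show ?thesis
    using X(3)
    by (intro right_comodule.intro X(1) unital_right_module_with_left[OF X(2)])
      (simp add: right_comodule_axioms_def right_hom_cong[OF w wt] tensor_assoc_cong[OF w]
        tensor_map_cong[OF w] tensor_map_cong[OF wt] tensor_lift_cong[OF w])
qed

lemma comodule_end_algebra_with_left: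
  "comodule_end_algebra K A C (with_left l M) \<rho> = comodule_end_algebra K A C M \<rho>"
  by (simp add: comodule_end_algebra_def end_algebra_with_left tensor_map_cong[OF right_cong_with_left])

lemma bicomodule_with_left:
  assumes "right_comodule K A C \<Delta> \<epsilon> M \<rho>" "nu_algebra K R"
    and \<iota>: "\<iota> \<in> alg_hom K R (comodule_end_algebra K A C M \<rho>)"
  shows "bicomodule K R A C \<Delta> \<epsilon> (with_left \<iota> M) \<rho>"
proof -
  have M: "right_module K A M"
    using assms(1) by (simp add: right_comodule_def unital_right_module_def)
  have e: "\<iota> \<in> alg_hom K R (end_algebra K A M)"
    using \<iota> unfolding comodule_end_algebra_def by (rule alg_hom_subalgebra) auto
  show ?thesis
  proof (intro bicomodule.intro bicomodule_axioms.intro right_comodule_with_left[OF assms(1)]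
      bimodule.axioms(1)[OF bimodule_with_left[OF M assms(2) e]])
    fix r assume r: "r \<in> carrier R"
    have "\<iota> r \<in> extensional (carrier M)"
      by (rule end_algebra_carrierD(2)[OF alg_homD(1)[OF e r]])
    then show "(\<lambda>x \<in> carrier (with_left \<iota> M). r \<triangleright>\<^bsub>with_left \<iota> M\<^esub> x)
        \<in> carrier (comodule_end_algebra K A C (with_left \<iota> M) \<rho>)"
      using alg_homD(1)[OF \<iota> r] by (simp add: comodule_end_algebra_with_left extensional_restrict)
  qed
qed

text \<open>Firm projectivity concerns \<open>R \<otimes> \<Sigma>\<close> formed with
  \<open>\<iota>\<close>, the bicomodule structure the one formed with \<open>\<iota>'\<close>. The
  last conjunct puts both structures on the same module when the two morphisms agree on
  \<open>R\<close>.\<close>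

theorem proposition2p2:
  fixes K :: "'k ring"
    and A :: "('k, 'a) module"
    and C :: "('k, 'c, 'a, 'a) bimod"
    and \<Delta> :: "'c \<Rightarrow> ('c, 'c) tens"
    and \<epsilon> :: "'c \<Rightarrow> 'a"
    and \<Sigma> :: "('k, 's, 'l, 'a) bimod"
    and \<rho> :: "'s \<Rightarrow> ('s, 'c) tens"
    and R :: "('k, 'r) module"
    and \<iota> :: "'r \<Rightarrow> 's \<Rightarrow> 's"
  assumes "coring K A C \<Delta> \<epsilon>"
    and "right_comodule K A C \<Delta> \<epsilon> \<Sigma> \<rho>"
    and "firm_ring K R"
    and "\<iota> \<in> alg_hom K R (finite_rank_algebra K A \<Sigma>)"
  shows "firmly_projective K R A (tensor K R (regular R) (with_left \<iota> \<Sigma>)) \<and>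
    (\<forall>\<iota>' \<in> alg_hom K R (comodule_end_algebra K A C \<Sigma> \<rho>).
       bicomodule K R A C \<Delta> \<epsilon> (with_left \<iota>' \<Sigma>) \<rho> \<and>
       bicomodule K R A C \<Delta> \<epsilon> (tensor K R (regular R) (with_left \<iota>' \<Sigma>))
         (tensor_coact K R A C (with_left \<iota>' \<Sigma>) \<rho>) \<and>
       ((\<forall>r \<in> carrier R. \<iota>' r = \<iota> r) \<longrightarrow>
         bicomodule K R A C \<Delta> \<epsilon> (tensor K R (regular R) (with_left \<iota> \<Sigma>))
           (tensor_coact K R A C (with_left \<iota> \<Sigma>) \<rho>)))"
proof (intro conjI ballI impI)
  have \<Sigma>: "unital_right_module K A \<Sigma>"
    using assms(2) by (simp add: right_comodule_def)
  have R: "nu_algebra K R"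
    using assms(3) by (simp add: firm_ring_def)
  show "firmly_projective K R A (tensor K R (regular R) (with_left \<iota> \<Sigma>))"
    by (rule firmly_projective_with_left[OF \<Sigma> assms(3,4)])
  note bicomodule_tensor = bicomodule_tensor.bicomodule_tensor[OF bicomodule_tensor.intro]
  fix \<iota>' assume \<iota>': "\<iota>' \<in> alg_hom K R (comodule_end_algebra K A C \<Sigma> \<rho>)"
  show b: "bicomodule K R A C \<Delta> \<epsilon> (with_left \<iota>' \<Sigma>) \<rho>"
    by (rule bicomodule_with_left[OF assms(2) R \<iota>'])
  show "bicomodule K R A C \<Delta> \<epsilon> (tensor K R (regular R) (with_left \<iota>' \<Sigma>))
      (tensor_coact K R A C (with_left \<iota>' \<Sigma>) \<rho>)"
    by (rule bicomodule_tensor[OF b])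
  assume eq: "\<forall>r \<in> carrier R. \<iota>' r = \<iota> r"
  interpret R: nu_algebra K R by (rule R)
  \<comment> \<open>Agreement on the carrier of \<open>R\<close>, which is closed under the
    operations, makes \<open>\<iota>\<close> itself a morphism into the colinear
    endomorphisms.\<close>
  have "\<iota> \<in> alg_hom K R (comodule_end_algebra K A C \<Sigma> \<rho>)"
    using \<iota>' eq by (auto simp: alg_hom_def Pi_def R.mult_closed)
  then show "bicomodule K R A C \<Delta> \<epsilon> (tensor K R (regular R) (with_left \<iota> \<Sigma>))
      (tensor_coact K R A C (with_left \<iota> \<Sigma>) \<rho>)"
    by (intro bicomodule_tensor bicomodule_with_left[OF assms(2) R])
qed

end
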